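(* Fix an integer $r\ge 2$ and a bounded convex set $\mathcal{C}\subset\mathbb{R}^{r-1}$ such that $(x_1-x_2,x_2-x_3,\ldots,x_{r-1}-x_r)\in\mathcal{C}$ implies $x_i\neq x_j$ for all $i\neq j$. Then there exists a constant $c_0>0$, depending only on $r$ and $\mathcal{C}$, such that for all integers $Q\ge 2$, $$R_r(\mathcal{C},Q)=\operatorname{vol}(\mathcal{C})+O\bigl(\exp(-c_0\sqrt{\omega(Q)})\bigr),$$ where the implied constant depends only on $r$ and $\mathcal{C}$.
   Context: For an integer $n$, $\omega(n)$ is the number of distinct prime divisors of $n$. A square in $\mathbb{Z}/Q\mathbb{Z}$ is an element of the form $x^2$, $x\in\mathbb{Z}/Q\mathbb{Z}$; $N_Q$ denotes the number of squares in $\mathbb{Z}/Q\mathbb{Z}$, and $s=Q/N_Q$ is the mean spacing. For $h=(h_1,\ldots,h_{r-1})\in\mathbb{Z}^{r-1}$, $N(h,Q)$ is the number of $r$-tuples $(s_1,\ldots,s_r)$ of squares in $\mathbb{Z}/Q\mathbb{Z}$ with $s_{i+1}-s_i\equiv h_i \pmod Q$ for $i=1,\ldots,r-1$. The $r$-level correlation is $$R_r(\mathcal{C},Q)=\frac{1}{N_Q}\sum_{h\in s\mathcal{C}\cap\mathbb{Z}^{r-1}}N(h,Q),$$ where $s\mathcal{C}=\{sx: x\in\mathcal{C}\}$. *)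

theory Defs
  imports "HOL-Analysis.Analysis" "HOL-Number_Theory.Cong"
    "HOL-Computational_Algebra.Primes"
begin

text \<open>
  The space \<open>\<real>\<close> to the power \<open>r - 1\<close> is \<^typ>\<open>real ^ 'n\<close> for a finite linearly ordered
  index type with \<open>CARD('n) = r - 1\<close>.  The order determines which coordinate is the \<open>k\<close>-th one:
  \<open>pos i = k\<close> says that \<open>i\<close> is the \<open>k\<close>-th smallest index, counting from 1.
\<close>

definition pos :: "'n::{finite,linorder} \<Rightarrow> nat" where
  "pos i = card {..i}"

lemma pos_less_iff: "pos i < pos j \<longleftrightarrow> i < j"
proof -
  have *: "pos a < pos b" if "a < b" for a b :: 'a
    unfolding pos_def using that by (intro psubset_card_mono) auto
  show ?thesis using *[of i j] *[of j i] by (cases i j rule: linorder_cases) auto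
qed

lemma bij_betw_pos: "bij_betw pos (UNIV :: 'n::{finite,linorder} set) {1..CARD('n)}"
proof -
  have inj: "inj (pos :: 'n \<Rightarrow> nat)"
    by (rule injI) (metis less_irrefl linorder_neqE pos_less_iff)
  have sub: "range (pos :: 'n \<Rightarrow> nat) \<subseteq> {1..CARD('n)}"
    by (auto simp: pos_def card_mono card_gt_0_iff Suc_le_eq)
  have "range (pos :: 'n \<Rightarrow> nat) = {1..CARD('n)}"
    by (rule card_subset_eq[OF _ sub]) (simp_all add: card_image[OF inj])
  with inj show ?thesis by (simp add: bij_betw_def)
qed

definition omega :: "int \<Rightarrow> nat" where
  "omega n = card (prime_factors n)"

text \<open>Elements of \<open>\<int>/Q\<int>\<close> are represented by their residues in \<open>{0..<Q}\<close>.\<close>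

definition squares_mod :: "int \<Rightarrow> int set" where
  "squares_mod Q = (\<lambda>x. x\<^sup>2 mod Q) ` {0..<Q}"

definition num_squares :: "int \<Rightarrow> nat" where
  "num_squares Q = card (squares_mod Q)"

definition mean_spacing :: "int \<Rightarrow> real" where
  "mean_spacing Q = of_int Q / of_nat (num_squares Q)"

text \<open>Tuples \<open>(\<sigma> 1, \<dots>, \<sigma> r)\<close> are extensional functions on \<open>{1..r}\<close>, where \<open>r = CARD('n) + 1\<close>.\<close>

definition tuple_count :: "int ^ 'n::{finite,linorder} \<Rightarrow> int \<Rightarrow> nat" where
  "tuple_count h Q = card {\<sigma> \<in> {1..CARD('n) + 1} \<rightarrow>\<^sub>E squares_mod Q.
     \<forall>i. [\<sigma> (pos i + 1) - \<sigma> (pos i) = h $ i] (mod Q)}"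

definition correlation :: "(real ^ 'n::{finite,linorder}) set \<Rightarrow> int \<Rightarrow> real" where
  "correlation C Q =
     1 / of_nat (num_squares Q) *
     (\<Sum>h | (\<chi> i. of_int (h $ i)) \<in> (\<lambda>x. mean_spacing Q *\<^sub>R x) ` C. of_nat (tuple_count h Q))"

end

theory Submission
  imports Defs "HOL-Number_Theory.Euler_Criterion"
begin

text \<open>
  Let \<open>n = r - 1\<close>, let \<open>s\<close> be the mean spacing, and let \<open>B(h,q)\<close> be the density of the \<open>x\<close> modulo
  \<open>q\<close> for which all shifts of \<open>x\<close> prescribed by \<open>h\<close> are squares, normalized so that its mean over
  \<open>h\<close> modulo \<open>q\<close> is 1.  Then \<open>R\<^sub>r(C,Q)\<close> is \<open>s\<close> to the power \<open>-n\<close> times the sum of \<open>B(h,Q)\<close> over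
  the lattice points \<open>h\<close> of \<open>s C\<close>, and \<open>B\<close> is multiplicative in \<open>q\<close>.  Writing \<open>B(h, p\<^sup>k)\<close> as a
  telescoping sum of the increments \<open>B(h, p\<^sup>j) - B(h, p\<^sup>j\<^sup>-\<^sup>1)\<close> turns \<open>B(h,Q)\<close> into a sum over the
  divisors \<open>d\<close> of \<open>Q\<close>.

  The divisor \<open>d = 1\<close> gives the volume.  For \<open>1 < d \<le> s\<^sup>1\<^sup>/\<^sup>4\<close> the sum over \<open>h\<close> is evaluated with the
  lattice point count of convex bodies, and the main terms cancel.  The divisors \<open>d > s\<^sup>1\<^sup>/\<^sup>4\<close> are
  bounded absolutely by Rankin's trick: Stepanov's method (for \<open>j = 1\<close>) and Hensel lifting (for
  \<open>j > 1\<close>) bound the increment by a constant times \<open>p\<^sup>-\<^sup>j\<^sup>/\<^sup>2\<close>, except when \<open>j = 1\<close> and \<open>p\<close> divides a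
  difference of two shifts.  These differences are nonzero by the hypothesis on \<open>C\<close>, so that the
  exceptional primes are controlled on average over \<open>h\<close>.  Finally \<open>s \<ge> (3/2)\<close> to the power
  \<open>\<omega>(Q) - 1\<close>.
\<close>

hide_const (open) Module.smult up_ring.monom up_ring.coeff

section \<open>Counting points with prescribed quadratic character\<close>

text \<open>Two exponentials in \<omega>(Q) compete. Cutting the divisors at a power of s saves
  s^(-\<beta>), which may be no better than exp(-c \<omega>(Q)), whereas an absolute bound for the
  divisor sum threatens to cost a constant factor at every prime. The square-root saving at good
  primes turns the local factors into 1 + O(p^(-1/4)). All but boundedly many primes make that term
  smaller than a given \<epsilon>, so the total cost is exp(\<epsilon> \<omega>(Q) + O(1)) and the
  saving wins. The decay obtained is exponential in \<omega>(Q) itself; it is relaxed to the square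
  root only at the end. Bad primes could spoil this for a single h. On average over h, however, a
  prime divides a nonzero shift difference with frequency about 1/p, which more than pays for the
  weight it receives. Several differences occur at once, and the Rankin exponent 1/(4M), with M the
  number of index pairs, is so small that they can be separated by raising to the M-th
  power.\<close>

lemma poly_dvd_of_const_dvd:
  fixes P :: "int poly"
  assumes "[:p:] dvd P"
  shows "p dvd poly P x"
  using assms by (auto elim!: dvdE)

section \<open>Roots modulo a prime with multiplicity, and linear systems modulo a prime\<close>

lemma higher_pderiv_linear_mult:
  fixes P :: "int poly"
  shows "(pderiv ^^ k) ([:- a, 1:] * P) =
    [:- a, 1:] * (pderiv ^^ k) P + smult (of_nat k) ((pderiv ^^ (k - 1)) P)"
proof (induction k)
  case (Suc k)
  have "(pderiv ^^ Suc k) ([:- a, 1:] * P) =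
    pderiv ([:- a, 1:] * (pderiv ^^ k) P) + smult (of_nat k) (pderiv ((pderiv ^^ (k - 1)) P))"
    by (simp only: funpow.simps o_apply Suc pderiv_add pderiv_smult diff_Suc_1)
  also have "smult (of_nat k) (pderiv ((pderiv ^^ (k - 1)) P)) = smult (of_nat k) ((pderiv ^^ k) P)"
    by (cases k) auto
  also have "pderiv ([:- a, 1:] * (pderiv ^^ k) P) =
    [:- a, 1:] * (pderiv ^^ Suc k) P + (pderiv ^^ k) P"
    by (subst pderiv_mult) (simp add: pderiv_pCons)
  finally show ?case
    by (simp add: algebra_simps smult_add_left)
qed auto

text \<open>Splitting off x - a at a point with \<open>m a > 0\<close> lowers the degree by one and
  leaves a remainder divisible by p; by Leibniz' rule the quotient inherits all conditions, with one
  order less at a. Ordinary derivatives bring in a factor k that must be invertible modulo p, which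
  is why multiplicities are capped at p.\<close>

lemma sum_multiplicities_le_degree:
  fixes P :: "int poly" and p :: int
  assumes "prime p" "finite S"
    and "\<And>x y. x \<in> S \<Longrightarrow> y \<in> S \<Longrightarrow> x \<noteq> y \<Longrightarrow> \<not> p dvd x - y"
    and "\<And>x. x \<in> S \<Longrightarrow> int (m x) \<le> p"
    and "\<And>x k. x \<in> S \<Longrightarrow> k < m x \<Longrightarrow> p dvd poly ((pderiv ^^ k) P) x"
    and "\<not> [:p:] dvd P"
  shows "sum m S \<le> degree P"
  using assms(4-6)
proof (induction "sum m S" arbitrary: m P)
  case 0
  then show ?case by simp
next
  case (Suc N)
  then obtain a where a: "a \<in> S" "m a > 0"
    by (metis (no_types, lifting) gr0I nat.simps(3) sum.neutral)
  define P1 where "P1 = synthetic_div P a"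
  define c where "c = poly P a"
  have P: "P = [:- a, 1:] * P1 + [:c:]"
    unfolding P1_def c_def by (rule synthetic_div_correct'[symmetric])
  have c: "p dvd c"
    using Suc.prems(2)[OF a(1,2)] by (simp add: c_def)
  have nz: "\<not> [:p:] dvd P1"
  proof
    assume "[:p:] dvd P1"
    then have "[:p:] dvd P"
      unfolding P using c by (intro dvd_add dvd_mult) auto
    with Suc.prems(3) show False by blast
  qed
  have deg: "degree P = Suc (degree P1)"
  proof -
    have "degree P \<noteq> 0"
    proof
      assume "degree P = 0"
      then have "P1 = 0" by (simp add: P1_def synthetic_div_eq_0_iff)
      with nz show False by simp
    qed
    then show ?thesis by (simp add: P1_def degree_synthetic_div)
  qed
  have der_const: "p dvd poly ((pderiv ^^ k) [:c:]) x" for k x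
    using c by (cases k) (simp_all only: funpow_Suc_right o_apply, simp_all add: pderiv_pCons)
  have der: "poly ((pderiv ^^ k) P) x = (x - a) * poly ((pderiv ^^ k) P1) x
      + of_nat k * poly ((pderiv ^^ (k - 1)) P1) x + poly ((pderiv ^^ k) [:c:]) x" for k x
    unfolding P higher_pderiv_add higher_pderiv_linear_mult by (simp add: algebra_simps)
  note P_van = Suc.prems(2)
  have van: "p dvd poly ((pderiv ^^ k) P1) x"
    if x: "x \<in> S" and k: "k < (m(a := m a - 1)) x" for x k
  proof (cases "x = a")
    case True
    \<comment> \<open>At a the term with x - a drops out, and k + 1 times the k-th derivative of the
      quotient remains.\<close>
    with k have "Suc k < m a" by simp
    from Suc.prems(2)[OF a(1) this] der[of "Suc k" a] der_const[of "Suc k" a]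
    have "p dvd of_nat (Suc k) * poly ((pderiv ^^ k) P1) a"
      by (simp only: diff_Suc_1 diff_self mult_zero_left add_0 dvd_add_left_iff)
    moreover have "\<not> p dvd of_nat (Suc k)"
    proof
      assume "p dvd of_nat (Suc k)"
      then have "p \<le> int (Suc k)" by (rule zdvd_imp_le) simp
      with \<open>Suc k < m a\<close> Suc.prems(1)[OF a(1)] show False by linarith
    qed
    ultimately show ?thesis
      using \<open>prime p\<close> True by (meson prime_dvd_multD)
  next
    case False
    \<comment> \<open>Away from a the factor x - a is a unit modulo p, and the orders of derivatives
      are settled one after the other.\<close>
    with k have "k < m x" by simp
    then show ?thesis
    proof (induction k)
      case 0
      with der[of 0 x] der_const[of 0 x] Suc.prems(2)[OF x, of 0]
      have "p dvd (x - a) * poly P1 x"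
        by (simp add: dvd_add_left_iff)
      with assms(1,3) x a(1) False show ?case
        by (metis funpow_0 prime_dvd_multD)
    next
      case (Suc k)
      have "p dvd (x - a) * poly ((pderiv ^^ Suc k) P1) x"
      proof -
        have "p dvd of_nat (Suc k) * poly ((pderiv ^^ k) P1) x"
          using Suc by (intro dvd_mult) simp
        moreover have "p dvd poly ((pderiv ^^ Suc k) P) x"
          by (rule P_van[OF x]) (use Suc in simp)
        ultimately show ?thesis
          using der[of "Suc k" x] der_const[of "Suc k" x]
          by (simp only: diff_Suc_1 dvd_add_left_iff)
      qed
      with assms(1,3) x a(1) False show ?case
        by (metis prime_dvd_multD)
    qed
  qed
  have S: "sum m S = m a + sum m (S - {a})"
    using a(1) assms(2) by (simp add: sum.remove)
  have S': "sum (m(a := m a - 1)) S = (m a - 1) + sum m (S - {a})"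
    using a(1) assms(2) by (subst sum.remove[of _ a]) (auto intro!: sum.cong)
  have "sum (m(a := m a - 1)) S \<le> degree P1"
  proof (rule Suc.hyps(1))
    show "N = sum (m(a := m a - 1)) S" using S S' Suc.hyps(2) a(2) by simp
    show "int ((m(a := m a - 1)) x) \<le> p" if "x \<in> S" for x
      using Suc.prems(1)[OF that] by auto
  qed (use van nz in auto)
  then show ?case using S S' deg a(2) by linarith
qed

text \<open>Pigeonhole in place of linear algebra over the field with p elements: there are p^(card
  U) reduced vectors but at most p^(card E) values, and the difference of two vectors with equal
  values is a nontrivial solution. It supplies the coefficients of the auxiliary polynomial.\<close>

lemma exists_nontrivial_solution_mod:
  fixes e :: "'b \<Rightarrow> 'a \<Rightarrow> int" and p :: nat
  assumes "p > 1" "finite U" "finite E" "card E < card U"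
  shows "\<exists>c. (\<exists>u\<in>U. \<not> int p dvd c u) \<and> (\<forall>i\<in>E. int p dvd (\<Sum>u\<in>U. e i u * c u))"
proof -
  define A where "A = PiE U (\<lambda>_. {0..<int p})"
  define B where "B = PiE E (\<lambda>_. {0..<int p})"
  define F where "F c = (\<lambda>i\<in>E. (\<Sum>u\<in>U. e i u * c u) mod int p)" for c
  have "F ` A \<subseteq> B"
    using assms(1) by (auto simp: F_def B_def)
  moreover have "finite B"
    using assms by (auto simp: B_def intro!: finite_PiE)
  ultimately have "card (F ` A) \<le> card B" by (rule card_mono[rotated])
  also have "\<dots> = p ^ card E"
    using assms by (simp add: B_def card_PiE)
  also have "\<dots> < p ^ card U"
    using assms by (intro power_strict_increasing) auto
  also have "\<dots> = card A"
    using assms by (simp add: A_def card_PiE)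
  finally have "\<not> inj_on F A" by (rule pigeonhole)
  then obtain c d where cd: "c \<in> A" "d \<in> A" "F c = F d" "c \<noteq> d"
    by (auto simp: inj_on_def)
  show ?thesis
  proof (rule exI[of _ "\<lambda>u. c u - d u"], intro conjI ballI)
    from cd obtain u where u: "u \<in> U" "c u \<noteq> d u"
      unfolding A_def by (metis PiE_ext)
    then have "c u \<in> {0..<int p}" "d u \<in> {0..<int p}"
      using cd unfolding A_def by auto
    with u have "\<not> int p dvd c u - d u"
      by (metis atLeastLessThan_iff mod_eq_dvd_iff mod_pos_pos_trivial)
    with u show "\<exists>u\<in>U. \<not> int p dvd c u - d u" by blast
    fix i assume i: "i \<in> E"
    from cd(3) have "F c i = F d i" by simp
    then have "(\<Sum>u\<in>U. e i u * c u) mod int p = (\<Sum>u\<in>U. e i u * d u) mod int p"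
      unfolding F_def restrict_apply'[OF i] .
    then show "int p dvd (\<Sum>u\<in>U. e i u * (c u - d u))"
      by (simp add: mod_eq_dvd_iff right_diff_distrib sum_subtractf)
  qed
qed

section \<open>Higher derivatives of products with high powers\<close>

primrec dpow :: "int poly \<Rightarrow> nat \<Rightarrow> nat \<Rightarrow> int poly \<Rightarrow> int poly" where
  "dpow f e 0 r = r"
| "dpow f e (Suc k) r = smult (of_nat (e - k)) (pderiv f * dpow f e k r) + f * pderiv (dpow f e k r)"

lemma higher_pderiv_power_mult:
  "k \<le> e \<Longrightarrow> (pderiv ^^ k) (f ^ e * r) = f ^ (e - k) * dpow f e k r"
proof (induction k)
  case (Suc k)
  then obtain d where d: "e - k = Suc d" "e - Suc k = d"
    by (metis Suc_diff_Suc Suc_le_lessD)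
  have "(pderiv ^^ Suc k) (f ^ e * r) = pderiv (f ^ Suc d * dpow f e k r)"
    using Suc d by simp
  also have "\<dots> = f ^ Suc d * pderiv (dpow f e k r) + dpow f e k r * (smult (of_nat (Suc d)) (f ^ d) * pderiv f)"
    by (simp only: pderiv_mult pderiv_power_Suc)
  also have "\<dots> = f ^ (e - Suc k) * dpow f e (Suc k) r"
    unfolding d dpow.simps by (simp add: algebra_simps)
  finally show ?case .
qed auto

text \<open>\<open>dpow f e k r\<close> is what the k-th derivative of f^e r leaves once f^(e - k)
  is taken out. The bound does not involve e, which will exceed q; this is what keeps the number of
  linear conditions per derivative small.\<close>

lemma degree_dpow: "degree (dpow f e k r) \<le> degree r + k * degree f"
proof (induction k)
  case (Suc k)
  have "degree (smult (of_nat (e - k)) (pderiv f * dpow f e k r)) \<le> degree (pderiv f * dpow f e k r)"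
    by (rule degree_smult_le)
  also have "\<dots> \<le> degree (pderiv f) + degree (dpow f e k r)"
    by (rule degree_mult_le)
  also have "\<dots> \<le> degree r + Suc k * degree f"
    using Suc degree_pderiv[of f] by simp
  finally have 1: "degree (smult (of_nat (e - k)) (pderiv f * dpow f e k r)) \<le> degree r + Suc k * degree f" .
  have "degree (f * pderiv (dpow f e k r)) \<le> degree f + degree (pderiv (dpow f e k r))"
    by (rule degree_mult_le)
  also have "\<dots> \<le> degree r + Suc k * degree f"
    using Suc degree_pderiv[of "dpow f e k r"] by simp
  finally show ?case using 1 by (auto intro: degree_add_le)
qed auto

text \<open>A polynomial whose derivative vanishes modulo p, such as x^(p j), passes through
  differentiation like a constant. Powers of x^p can therefore enter the auxiliary polynomial
  without complicating its derivatives.\<close>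

lemma higher_pderiv_mult_const_mod:
  fixes w :: "int poly"
  assumes "[:p:] dvd pderiv w"
  shows "[:p:] dvd (pderiv ^^ k) (u * w) - w * (pderiv ^^ k) u"
proof (induction k)
  case (Suc k)
  then obtain z where z: "(pderiv ^^ k) (u * w) = w * (pderiv ^^ k) u + [:p:] * z"
    by (metis add.commute diff_add_cancel dvdE)
  from assms obtain y where y: "pderiv w = [:p:] * y" by (rule dvdE)
  have "(pderiv ^^ Suc k) (u * w) - w * (pderiv ^^ Suc k) u = [:p:] * (y * (pderiv ^^ k) u + pderiv z)"
    by (simp add: z pderiv_add pderiv_mult pderiv_smult y algebra_simps smult_add_right)
  then show ?case by (metis dvd_triv_left)
qed auto

section \<open>Cancellation and descent for polynomials modulo p\<close>

lemma const_dvd_linear_mult_iff: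
  fixes p :: int
  assumes "prime p"
  shows "[:p:] dvd [:a, 1:] * P \<longleftrightarrow> [:p:] dvd P"
proof -
  have "prime_elem [:p:]" using prime_imp_prime_elem[OF assms] by (simp only: prime_elem_const_poly_iff)
  moreover have "\<not> [:p:] dvd [:a, 1:]"
    using assms by (auto simp: const_poly_dvd_iff coeff_pCons split: nat.splits
        intro!: exI[of _ "1::nat"] dest: not_prime_unit)
  ultimately show ?thesis by (metis dvd_mult prime_elem_dvd_mult_iff)
qed

lemma const_dvd_monom_mult_iff:
  fixes p :: int
  shows "[:p:] dvd monom 1 n * P \<longleftrightarrow> [:p:] dvd P"
proof
  assume "[:p:] dvd monom 1 n * P"
  then have "p dvd coeff (monom 1 n * P) (i + n)" for i
    by (simp add: const_poly_dvd_iff)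
  then show "[:p:] dvd P"
    by (simp add: const_poly_dvd_iff coeff_monom_mult)
qed auto

lemma linear_decomp_mod:
  fixes P :: "int poly"
  assumes "p dvd poly P (- a)"
  obtains P1 c where "P = [:a, 1:] * P1 + [:p:] * [:c:]" "degree P = 0 \<and> P1 = 0 \<or> degree P1 < degree P"
proof -
  from assms obtain c where c: "poly P (- a) = p * c" by (rule dvdE)
  have "P = [:a, 1:] * synthetic_div P (- a) + [:p:] * [:c:]"
    using synthetic_div_correct'[of "- a" P] c by (simp add: mult.commute)
  moreover have "degree P = 0 \<and> synthetic_div P (- a) = 0 \<or> degree (synthetic_div P (- a)) < degree P"
    by (auto simp: synthetic_div_eq_0_iff degree_synthetic_div)
  ultimately show ?thesis by (rule that)
qed

text \<open>The two half-steps of a descent: replacing s by X s + p u lets X be divided out modulo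
  p, and doing the same with r restores the original shape with both unknowns divided by X.\<close>

lemma descent_identity1:
  fixes X g r s c p u :: "'a :: comm_ring_1"
  shows "r\<^sup>2 * (X * g) - c * (X * s + p * u)\<^sup>2 =
    X * (r\<^sup>2 * g - c * X * s\<^sup>2) - p * (c * u * (2 * X * s + p * u))"
  by (simp add: power2_eq_square algebra_simps)

lemma descent_identity2:
  fixes X g r s c p v :: "'a :: comm_ring_1"
  shows "(X * r + p * v)\<^sup>2 * g - c * X * s\<^sup>2 =
    X * (r\<^sup>2 * (X * g) - c * s\<^sup>2) + p * (v * (2 * X * r + p * v) * g)"
  by (simp add: power2_eq_square algebra_simps)

text \<open>Descent: \<open>r\<^sup>2 f = c s\<^sup>2\<close> is impossible modulo \<open>p\<close>, because the root \<open>- a\<close> has odd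
  multiplicity on the left and even multiplicity on the right.\<close>

lemma square_times_simple_root_mod:
  fixes p :: int and r s g :: "int poly"
  assumes p: "prime p" and g: "\<not> p dvd poly g (- a)" and c: "\<not> p dvd c"
    and eq: "[:p:] dvd r\<^sup>2 * ([:a, 1:] * g) - [:c:] * s\<^sup>2"
  shows "[:p:] dvd r"
  using eq
proof (induction "degree r" arbitrary: r s rule: less_induct)
  case less
  let ?X = "[:a, 1:] :: int poly"
  have "p dvd poly (r\<^sup>2 * (?X * g) - [:c:] * s\<^sup>2) (- a)"
    using less.prems by (rule poly_dvd_of_const_dvd)
  then have "p dvd c * (poly s (- a))\<^sup>2" by simp
  then have "p dvd poly s (- a)"
    using p c by (meson prime_dvd_multD prime_dvd_power)
  then obtain s1 u where s: "s = ?X * s1 + [:p:] * [:u:]" by (rule linear_decomp_mod)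
  have "r\<^sup>2 * (?X * g) - [:c:] * s\<^sup>2 = ?X * (r\<^sup>2 * g - [:c:] * ?X * s1\<^sup>2)
      - [:p:] * ([:c:] * [:u:] * (2 * ?X * s1 + [:p:] * [:u:]))"
    unfolding s by (rule descent_identity1)
  with less.prems have "[:p:] dvd ?X * (r\<^sup>2 * g - [:c:] * ?X * s1\<^sup>2)"
    by (metis dvd_diff_right_iff dvd_triv_left dvd_diff_left_iff)
  then have 1: "[:p:] dvd r\<^sup>2 * g - [:c:] * ?X * s1\<^sup>2"
    using p by (simp only: const_dvd_linear_mult_iff)
  then have "p dvd poly (r\<^sup>2 * g - [:c:] * ?X * s1\<^sup>2) (- a)"
    by (rule poly_dvd_of_const_dvd)
  then have "p dvd (poly r (- a))\<^sup>2 * poly g (- a)" by simp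
  then have "p dvd poly r (- a)"
    using p g by (meson prime_dvd_multD prime_dvd_power)
  then obtain r1 v where r: "r = ?X * r1 + [:p:] * [:v:]"
    and deg: "degree r = 0 \<and> r1 = 0 \<or> degree r1 < degree r" by (rule linear_decomp_mod)
  from deg show ?case
  proof
    assume "degree r = 0 \<and> r1 = 0"
    then show ?thesis using r by (metis add_0 dvd_triv_left mult_zero_right)
  next
    assume "degree r1 < degree r"
    moreover have "r\<^sup>2 * g - [:c:] * ?X * s1\<^sup>2 = ?X * (r1\<^sup>2 * (?X * g) - [:c:] * s1\<^sup>2)
        + [:p:] * ([:v:] * (2 * ?X * r1 + [:p:] * [:v:]) * g)"
      unfolding r by (rule descent_identity2)
    with 1 have "[:p:] dvd ?X * (r1\<^sup>2 * (?X * g) - [:c:] * s1\<^sup>2)"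
      by (metis dvd_add_left_iff dvd_triv_left)
    then have "[:p:] dvd r1\<^sup>2 * (?X * g) - [:c:] * s1\<^sup>2"
      using p by (simp only: const_dvd_linear_mult_iff)
    ultimately have "[:p:] dvd r1" by (rule less.hyps)
    then show ?thesis unfolding r by (meson dvd_add dvd_mult dvd_triv_left)
  qed
qed

lemma const_dvd_power_mult_iff:
  fixes p :: int
  assumes "prime p" "\<not> [:p:] dvd f"
  shows "[:p:] dvd f ^ n * P \<longleftrightarrow> [:p:] dvd P"
proof -
  have "prime_elem [:p:]" using prime_imp_prime_elem[OF assms(1)] by (simp only: prime_elem_const_poly_iff)
  then show ?thesis using assms(2)
    by (metis dvd_mult prime_elem_dvd_mult_iff prime_elem_dvd_power)
qed

section \<open>The auxiliary polynomial does not vanish modulo p\<close>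

lemma dvd_low_coeff_mult:
  fixes g h :: "int poly"
  assumes "\<And>i. i < n \<Longrightarrow> p dvd coeff g i" "i < n"
  shows "p dvd coeff (g * h) i"
  unfolding coeff_mult using assms by (intro dvd_sum dvd_mult2) auto

lemma middle_coeffs_mult:
  fixes g h :: "int poly"
  assumes "\<And>i. 0 < i \<Longrightarrow> i < n \<Longrightarrow> p dvd coeff g i"
    and "\<And>i. 0 < i \<Longrightarrow> i < n \<Longrightarrow> p dvd coeff h i"
    and i: "0 < i" "i < n"
  shows "p dvd coeff (g * h) i"
  unfolding coeff_mult
proof (rule dvd_sum)
  fix k assume k: "k \<in> {..i}"
  show "p dvd coeff g k * coeff h (i - k)"
  proof (cases "k = 0")
    case True
    then show ?thesis using assms by simp
  next
    case False
    then show ?thesis using assms(1)[of k] k i by simp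
  qed
qed

lemma middle_coeffs_linear_power:
  fixes a :: int
  assumes "prime p" "0 < i" "i < p"
  shows "int p dvd coeff ([:a, 1:] ^ p) i"
proof -
  have "p dvd p choose i"
    using assms by (intro dvd_choose_prime) auto
  then have "int p dvd int (p choose i)" by simp
  then show ?thesis using assms(3) by (subst coeff_linear_poly_power) auto
qed

text \<open>Frobenius: modulo p the p-th power is a polynomial in x^p. The range below degree p says
  that f^p is congruent to the constant f(0)^p modulo x^p and p.\<close>

lemma middle_coeffs_prod_linear_power:
  fixes a :: "'a \<Rightarrow> int"
  assumes "prime p" "finite S" "0 < i" "i < p"
  shows "int p dvd coeff ((\<Prod>k\<in>S. [:a k, 1:]) ^ p) i"
  using assms(2-4)
proof (induction S arbitrary: i rule: finite_induct)
  case empty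
  then show ?case by simp
next
  case (insert x S)
  show ?case
    unfolding prod.insert[OF insert.hyps] power_mult_distrib
    by (rule middle_coeffs_mult[where n = p])
      (use middle_coeffs_linear_power[OF assms(1)] insert in auto)
qed

text \<open>Here X stands for x^p, g for f^q and c for f(0)^p. Multiplying the relation by its
  conjugate and by f leaves r^2 f - c s^2, up to multiples of X and of g^2 f - c.\<close>

lemma nonvanishing_identity:
  fixes f g r s X R S c :: "'a :: comm_ring_1"
  shows "r\<^sup>2 * f - c * s\<^sup>2 = (r + X * R + g * (s + X * S)) * (r + X * R - g * (s + X * S)) * f
    + (g\<^sup>2 * f - c) * (s + X * S)\<^sup>2 + X * (c * (2 * s * S + X * S\<^sup>2) - (2 * r * R + X * R\<^sup>2) * f)"
  by (simp add: power2_eq_square algebra_simps)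

text \<open>A vanishing combination gives r 0 = - f^q s 0 modulo x^p. Squaring and multiplying by f
  yields (r 0)^2 f = f(0)^p (s 0)^2, because f^(2q+1) = f^p is constant modulo x^p. The bound on L
  puts both sides below degree p, so the equality holds modulo p alone, and the simple root of f
  then forces r 0 and s 0 to vanish. Afterwards x^p is cancelled and the next pair is treated
  alike.\<close>

lemma auxiliary_poly_nonvanishing:
  fixes r s :: "nat \<Rightarrow> int poly" and a :: int and f :: "int poly" and p q L :: nat
  assumes p: "prime p" "p = 2 * q + 1"
    and f: "f = [:a, 1:] * h" "\<not> int p dvd poly h (- a)" "\<not> int p dvd poly f 0"
    and mid: "\<And>i. 0 < i \<Longrightarrow> i < p \<Longrightarrow> int p dvd coeff (f ^ p) i"
    and L: "2 * L + degree f < p"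
    and deg: "\<And>j. degree (r j) \<le> L" "\<And>j. degree (s j) \<le> L"
  shows "[:int p:] dvd (\<Sum>j<J. r j * monom 1 (p * j)) + f ^ q * (\<Sum>j<J. s j * monom 1 (p * j)) \<Longrightarrow>
    j < J \<Longrightarrow> [:int p:] dvd r j \<and> [:int p:] dvd s j"
  using deg
proof (induction J arbitrary: r s j)
  case 0
  then show ?case by simp
next
  case (Suc J)
  have prime: "prime (int p)" using p(1) by simp
  have nf: "\<not> [:int p:] dvd f" 
    using f(3) poly_dvd_of_const_dvd by blast
  define X where "X = (monom 1 p :: int poly)"
  define R where "R = (\<Sum>j<J. r (Suc j) * monom 1 (p * j))"
  define T where "T = (\<Sum>j<J. s (Suc j) * monom 1 (p * j))"
  define c where "c = (poly f 0) ^ p"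
  have shift: "(\<Sum>j<Suc J. t j * monom 1 (p * j)) = t 0 + X * (\<Sum>j<J. t (Suc j) * monom 1 (p * j))"
    for t :: "nat \<Rightarrow> int poly"
  proof -
    have "monom (1 :: int) (p * Suc j) = X * monom 1 (p * j)" for j
      by (simp add: X_def mult_monom)
    then show ?thesis
      by (simp add: sum.lessThan_Suc_shift sum_distrib_left mult.left_commute del: sum.lessThan_Suc mult_Suc_right)
  qed
  have dvd: "[:int p:] dvd (r 0 + X * R) + f ^ q * (s 0 + X * T)"
    using Suc.prems(1) unfolding shift R_def T_def .
  have fp: "(f ^ q)\<^sup>2 * f = f ^ p"
    by (simp add: p(2) power_mult[symmetric] mult.commute)
  have low: "int p dvd coeff (f ^ p - [:c:]) i" if "i < p" for i
  proof (cases "i = 0")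
    case True
    have "coeff (f ^ p) 0 = c" by (simp add: c_def flip: poly_0_coeff_0)
    with True show ?thesis by simp
  next
    case False
    then show ?thesis using mid[of i] that by (simp add: coeff_pCons split: nat.splits)
  qed
  let ?D = "(r 0)\<^sup>2 * f - [:c:] * (s 0)\<^sup>2"
  have id: "?D = ((r 0 + X * R) + f ^ q * (s 0 + X * T)) * (r 0 + X * R - f ^ q * (s 0 + X * T)) * f
    + (f ^ p - [:c:]) * (s 0 + X * T)\<^sup>2
    + X * ([:c:] * (2 * s 0 * T + X * T\<^sup>2) - (2 * r 0 * R + X * R\<^sup>2) * f)"
    unfolding fp[symmetric] by (rule nonvanishing_identity)
  have degD: "degree ?D < p"
  proof -
    have "degree ((r 0)\<^sup>2 * f) \<le> 2 * degree (r 0) + degree f"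
      by (metis (no_types, opaque_lifting) add_le_mono1 degree_mult_le degree_power_le le_trans mult.commute)
    moreover have "degree ([:c:] * (s 0)\<^sup>2) \<le> 2 * degree (s 0)"
      using degree_smult_le[of c "(s 0)\<^sup>2"] degree_power_le[of "s 0" 2] by simp
    moreover have "degree (r 0) \<le> L" "degree (s 0) \<le> L" using Suc.prems by auto
    moreover note L
    ultimately have "degree ((r 0)\<^sup>2 * f) < p" "degree ([:c:] * (s 0)\<^sup>2) < p" by linarith+
    then show ?thesis by (rule degree_diff_less)
  qed
  have D: "[:int p:] dvd ?D"
    unfolding const_poly_dvd_iff
  proof
    fix i
    show "int p dvd coeff ?D i"
    proof (cases "i < p")
      case True
      have "int p dvd coeff (((r 0 + X * R) + f ^ q * (s 0 + X * T)) * ((r 0 + X * R - f ^ q * (s 0 + X * T)) * f)) i"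
        using dvd_mult2[OF dvd] unfolding const_poly_dvd_iff by blast
      moreover have "int p dvd coeff ((f ^ p - [:c:]) * (s 0 + X * T)\<^sup>2) i"
        by (rule dvd_low_coeff_mult[OF low True])
      moreover have "int p dvd coeff (X * ([:c:] * (2 * s 0 * T + X * T\<^sup>2) - (2 * r 0 * R + X * R\<^sup>2) * f)) i"
        using True by (simp only: X_def coeff_monom_mult) simp
      ultimately show ?thesis
        unfolding id by (simp only: coeff_add mult.assoc) (intro dvd_add)
    next
      case False
      then show ?thesis using degD by (simp only: coeff_eq_0 dvd_0_right)
    qed
  qed
  have nc: "\<not> int p dvd c"
    unfolding c_def using f(3) prime prime_dvd_power by blast
  have r0: "[:int p:] dvd r 0"
    by (rule square_times_simple_root_mod[OF prime f(2) nc]) (use D f(1) in simp)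
  have "[:int p:] dvd [:c:] * (s 0)\<^sup>2"
  proof -
    have "[:int p:] dvd (r 0)\<^sup>2 * f" using r0 by (simp add: power2_eq_square)
    with D show ?thesis by (meson dvd_diff_right_iff)
  qed
  moreover have "prime_elem [:int p:]"
    using prime_imp_prime_elem[OF prime] by (simp only: prime_elem_const_poly_iff)
  ultimately have s0: "[:int p:] dvd s 0"
    using nc by (metis const_poly_dvd_const_poly_iff prime_elem_dvd_multD prime_elem_dvd_power)
  have "[:int p:] dvd X * (R + f ^ q * T)"
  proof -
    have "(r 0 + X * R) + f ^ q * (s 0 + X * T) = (r 0 + f ^ q * s 0) + X * (R + f ^ q * T)"
      by (simp add: algebra_simps)
    moreover have "[:int p:] dvd r 0 + f ^ q * s 0" using r0 s0 by (intro dvd_add dvd_mult)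
    ultimately show ?thesis using dvd by (metis dvd_add_right_iff)
  qed
  then have "[:int p:] dvd R + f ^ q * T"
    unfolding X_def const_dvd_monom_mult_iff .
  then have IH: "[:int p:] dvd r (Suc j) \<and> [:int p:] dvd s (Suc j)" if "j < J" for j
    using Suc.IH[of "\<lambda>j. r (Suc j)" "\<lambda>j. s (Suc j)" j] that Suc.prems unfolding R_def T_def by blast
  with r0 s0 Suc.prems(2) show ?case by (cases j) auto
qed

section \<open>Stepanov's method for products of linear polynomials\<close>

lemma fermat_int:
  assumes "prime p"
  shows "[x ^ p = x] (mod int p)"
proof -
  define y where "y = nat (x mod int p)"
  have p1: "p > 1" using assms by (rule prime_gt_1_nat)
  have y: "int y = x mod int p" using p1 by (simp add: y_def)
  have "[y ^ p = y] (mod p)"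
  proof (cases "p dvd y")
    case True
    then have "p dvd y ^ p" using p1 by (auto intro: dvd_trans dvd_power)
    with True show ?thesis by (simp add: cong_def mod_eq_0_iff_dvd)
  next
    case False
    then have "[y ^ (p - 1) * y = 1 * y] (mod p)"
      by (intro cong_scalar_right fermat_theorem assms)
    then show ?thesis using p1 power_minus_mult[of p y] by simp
  qed
  then have "[int (y ^ p) = int y] (mod int p)" by (simp only: cong_int_iff)
  then show ?thesis by (simp add: y cong_def mod_simps)
qed

text \<open>
  The auxiliary polynomial is \<open>P = f\<^sup>M (R + f\<^sup>q T)\<close>, where \<open>R\<close> and \<open>T\<close> are polynomials in \<open>x\<close> and
  \<open>x\<^sup>p\<close>.  Since \<open>x\<^sup>p = x\<close> and \<open>f\<^sup>q = \<theta>\<close> at the points to be counted, the derivatives of order less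
  than \<open>M\<close> vanish there as soon as the coefficients of \<open>R\<close> and \<open>T\<close> solve a linear system with
  fewer equations than unknowns.
\<close>

lemma stepanov_count:
  fixes a :: "'a \<Rightarrow> int" and p q B :: nat and \<theta> :: int
  assumes p: "prime p" "p = 2 * q + 1"
    and S: "finite S" "S \<noteq> {}"
    and distinct: "\<And>k l. k \<in> S \<Longrightarrow> l \<in> S \<Longrightarrow> k \<noteq> l \<Longrightarrow> \<not> int p dvd a k - a l"
    and nz: "\<And>k. k \<in> S \<Longrightarrow> \<not> int p dvd a k"
    and \<theta>: "\<theta> = 1 \<or> \<theta> = -1"
    and B: "B \<ge> 1" "(2 * card S + 3) * B\<^sup>2 + card S + 2 < p"
  defines "f \<equiv> \<Prod>k\<in>S. [:a k, 1:]"
  shows "2 * B * card {x \<in> {0..<int p}. [poly f x ^ q = \<theta>] (mod int p)} \<le>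
    2 * B * card S + card S * q + p * (B + 2)"
proof -
  define m where "m = card S"
  \<comment> \<open>There are 2 J L unknowns, namely J powers of x^p with coefficients of degree
    below L in each of R and T, against M W conditions. L is the largest value with 2 L + m < p, as
    nonvanishing demands. The two extra powers in J = B + 2 give a surplus of 4 L, which pays for
    the M (J + M m) conditions beyond M L.\<close>
  define M where "M = 2 * B"
  define J where "J = B + 2"
  define L where "L = (p - m - 1) div 2"
  define W where "W = L + J + M * m"
  define U where "U = (UNIV :: bool set) \<times> {..<J} \<times> {..<L}"
  define Eq where "Eq = {..<M} \<times> {..<W}"
  \<comment> \<open>The k-th derivative of \<open>b u\<close> at a counted point with f^(M - k)
    removed: x^(p j) has become x^j and f^q has become \<theta>. This brings the degree below
    W.\<close>
  define V where "V k u = (case u of (b, j, l) \<Rightarrow> (if b then [:\<theta>:] * dpow f (M + q) k (monom 1 l) * monom 1 j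
     else dpow f M k (monom 1 l) * monom 1 j))" for k :: nat and u :: "bool \<times> nat \<times> nat"
  define b where "b u = (case u of (b, j, l) \<Rightarrow> f ^ (if b then M + q else M) * monom 1 l * monom 1 (p * j))"
    for u :: "bool \<times> nat \<times> nat"
  have prime: "prime (int p)" using p(1) by simp
  have p1: "p > 1" using p(1) by (rule prime_gt_1_nat)
  have degf: "degree f = m"
  proof -
    have "degree (\<Prod>k\<in>S. [:a k, 1:]) = (\<Sum>k\<in>S. degree [:a k, 1:])"
      by (rule degree_prod_eq_sum_degree) auto
    then show ?thesis by (simp add: f_def m_def)
  qed
  have B2: "B \<le> B\<^sup>2" using B(1) by (simp add: power2_eq_square)
  have L1: "2 * L + m < p" and L2: "p \<le> 2 * L + m + 2"
    using B(2) unfolding L_def m_def[symmetric] by linarith+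
  have "card Eq < card U"
  proof -
    have cU: "card U = 2 * J * L" by (simp add: U_def card_cartesian_product)
    have cE: "card Eq = M * W" by (simp add: Eq_def card_cartesian_product)
    have "(2 * m + 3) * B\<^sup>2 < 2 * L" using B(2) L2 unfolding m_def by linarith
    then have "2 * B\<^sup>2 + 4 * B + 4 * m * B\<^sup>2 < 4 * L"
      using B2 by (simp add: algebra_simps)
    then show ?thesis unfolding cU cE W_def M_def J_def by (simp add: algebra_simps power2_eq_square)
  qed
  have finU: "finite U" and finE: "finite Eq" by (simp_all add: U_def Eq_def)
  from \<open>card Eq < card U\<close> obtain c where c: "\<exists>u\<in>U. \<not> int p dvd c u"
    "\<And>i. i \<in> Eq \<Longrightarrow> int p dvd (\<Sum>u\<in>U. coeff (V (fst i) u) (snd i) * c u)"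
    using exists_nontrivial_solution_mod[OF p1, of U Eq "\<lambda>i u. coeff (V (fst i) u) (snd i)"] finU finE
    by blast
  define r where "r j = (\<Sum>l<L. monom (c (False, j, l)) l)" for j
  define s where "s j = (\<Sum>l<L. monom (c (True, j, l)) l)" for j
  define P where "P = (\<Sum>u\<in>U. [:c u:] * b u)"
  define R where "R = (\<Sum>j<J. r j * monom 1 (p * j))"
  define T where "T = (\<Sum>j<J. s j * monom 1 (p * j))"
  have degr: "degree (r j) \<le> L" "degree (s j) \<le> L" for j
    unfolding r_def s_def by (intro degree_sum_le; auto intro: order_trans[OF degree_monom_le])+
  have PRT: "P = f ^ M * (R + f ^ q * T)"
  proof -
    have "P = (\<Sum>j<J. \<Sum>l<L. [:c (False, j, l):] * b (False, j, l)) + (\<Sum>j<J. \<Sum>l<L. [:c (True, j, l):] * b (True, j, l))"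
      unfolding P_def U_def by (simp add: sum.cartesian_product' UNIV_bool add.commute)
    also have "\<dots> = f ^ M * R + f ^ M * (f ^ q * T)"
    proof -
      have mono: "monom d l = [:d:] * monom 1 l" for d :: int and l
        by (simp add: smult_monom)
      show ?thesis
        unfolding R_def T_def r_def s_def b_def prod.case if_True if_False power_add
          sum_distrib_left sum_distrib_right
        by (intro arg_cong2[where f = "(+)"] sum.cong refl; subst (2) mono; simp only: mult_ac)
    qed
    finally show ?thesis by (simp add: algebra_simps)
  qed
  obtain k0 where k0: "k0 \<in> S" using S by blast
  define h where "h = (\<Prod>k\<in>S - {k0}. [:a k, 1:])"
  have fh: "f = [:a k0, 1:] * h"
    unfolding f_def h_def by (rule prod.remove[OF S(1) k0])
  have h0: "\<not> int p dvd poly h (- a k0)"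
  proof
    assume "int p dvd poly h (- a k0)"
    then have "int p dvd (\<Prod>k\<in>S - {k0}. a k - a k0)"
      by (simp add: h_def poly_prod)
    then show False
      using prime S distinct k0 by (subst (asm) prime_dvd_prod_iff) auto
  qed
  have f0: "\<not> int p dvd poly f 0"
  proof
    assume "int p dvd poly f 0"
    then have "int p dvd (\<Prod>k\<in>S. a k)" by (simp add: f_def poly_prod)
    then show False using prime S nz by (subst (asm) prime_dvd_prod_iff) auto
  qed
  have Pnz: "\<not> [:int p:] dvd P"
  proof
    assume "[:int p:] dvd P"
    moreover have "\<not> [:int p:] dvd f" using f0 poly_dvd_of_const_dvd by blast
    ultimately have *: "[:int p:] dvd R + f ^ q * T"
      unfolding PRT using const_dvd_power_mult_iff[OF prime] by blast
    have rs: "[:int p:] dvd r j \<and> [:int p:] dvd s j" if "j < J" for j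
    proof (rule auxiliary_poly_nonvanishing[OF p fh h0 f0 _ _ degr])
      show "int p dvd coeff (f ^ p) i" if "0 < i" "i < p" for i
        unfolding f_def using middle_coeffs_prod_linear_power[OF p(1) S(1) that] .
      show "2 * L + degree f < p" using L1 by (simp add: degf)
    qed (use * that in \<open>auto simp: R_def T_def\<close>)
    have "int p dvd c (bb, j, l)" if "j < J" "l < L" for bb j l
    proof -
      have "coeff (r j) l = c (False, j, l)" "coeff (s j) l = c (True, j, l)"
        unfolding r_def s_def using that(2) by (simp_all add: coeff_sum)
      then show ?thesis using rs[OF that(1)] unfolding const_poly_dvd_iff by (cases bb) metis+
    qed
    with c(1) show False by (auto simp: U_def)
  qed
  define X where "X = {x \<in> {0..<int p}. [poly f x ^ q = \<theta>] (mod int p)}"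
  have van: "int p dvd poly ((pderiv ^^ k) P) x" if x: "x \<in> X" and k: "k < M" for x k
  proof -
    have fermat: "[x ^ (p * j) = x ^ j] (mod int p)" for j
    proof -
      have "[x ^ p = x] (mod int p)" using p(1) by (rule fermat_int)
      then show ?thesis unfolding power_mult by (rule cong_pow)
    qed
    have theta: "[poly f x ^ q = \<theta>] (mod int p)" using x by (simp add: X_def)
    have bV: "[poly ((pderiv ^^ k) (b u)) x = poly f x ^ (M - k) * poly (V k u) x] (mod int p)" for u
    proof -
      obtain bb j l where u: "u = (bb, j, l)" by (cases u) auto
      define e where "e = (if bb then M + q else M)"
      have "[:int p:] dvd pderiv (monom 1 (p * j))"
        by (simp add: pderiv_monom const_poly_dvd_iff)
      from higher_pderiv_mult_const_mod[OF this, of k "f ^ e * monom 1 l"]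
      have "[:int p:] dvd (pderiv ^^ k) (b u) - monom 1 (p * j) * (f ^ (e - k) * dpow f e k (monom 1 l))"
        using k by (subst (asm) higher_pderiv_power_mult) (auto simp: b_def u e_def)
      then have "int p dvd poly ((pderiv ^^ k) (b u) - monom 1 (p * j) * (f ^ (e - k) * dpow f e k (monom 1 l))) x"
        by (rule poly_dvd_of_const_dvd)
      then have 1: "[poly ((pderiv ^^ k) (b u)) x = x ^ (p * j) * (poly f x ^ (e - k) * poly (dpow f e k (monom 1 l)) x)] (mod int p)"
        by (simp add: cong_iff_dvd_diff poly_monom)
      have 2: "[x ^ (p * j) * (poly f x ^ (e - k) * poly (dpow f e k (monom 1 l)) x)
        = x ^ j * (poly f x ^ (e - k) * poly (dpow f e k (monom 1 l)) x)] (mod int p)"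
        by (intro cong_mult fermat cong_refl)
      have "[x ^ j * (poly f x ^ (e - k) * poly (dpow f e k (monom 1 l)) x)
        = poly f x ^ (M - k) * poly (V k u) x] (mod int p)"
      proof (cases bb)
        case True
        have "e - k = q + (M - k)" using k True by (simp add: e_def)
        then have "poly f x ^ (e - k) = poly f x ^ q * poly f x ^ (M - k)"
          by (simp only: power_add)
        then have "[poly f x ^ (e - k) = \<theta> * poly f x ^ (M - k)] (mod int p)"
          using cong_scalar_right[OF theta] by metis
        then have "[x ^ j * (poly f x ^ (e - k) * poly (dpow f e k (monom 1 l)) x)
          = x ^ j * (\<theta> * poly f x ^ (M - k) * poly (dpow f e k (monom 1 l)) x)] (mod int p)"
          by (intro cong_mult cong_refl)
        then show ?thesis using True by (simp add: V_def u e_def poly_monom algebra_simps)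
      qed (simp add: V_def u e_def poly_monom algebra_simps)
      with 1 2 show ?thesis using cong_trans by blast
    qed
    have "poly ((pderiv ^^ k) P) x = (\<Sum>u\<in>U. c u * poly ((pderiv ^^ k) (b u)) x)"
    proof -
      have "(pderiv ^^ k) P = (\<Sum>u\<in>U. [:c u:] * (pderiv ^^ k) (b u))"
        unfolding P_def by (simp add: higher_pderiv_sum higher_pderiv_smult)
      then show ?thesis by (simp add: poly_sum)
    qed
    also have "[\<dots> = (\<Sum>u\<in>U. c u * (poly f x ^ (M - k) * poly (V k u) x))] (mod int p)"
      by (intro cong_sum cong_mult bV cong_refl)
    also have "(\<Sum>u\<in>U. c u * (poly f x ^ (M - k) * poly (V k u) x)) =
      poly f x ^ (M - k) * (\<Sum>u\<in>U. c u * (\<Sum>i<W. coeff (V k u) i * x ^ i))"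
    proof -
      have "poly (V k u) x = (\<Sum>i<W. coeff (V k u) i * x ^ i)" if u: "u \<in> U" for u
      proof -
        obtain bb j l where ujl: "u = (bb, j, l)" by (cases u) auto
        have jl: "j < J" "l < L" using u by (auto simp: U_def ujl)
        have "degree (dpow f e k (monom 1 l) * monom 1 j) < W" for e
        proof -
          have "degree (dpow f e k (monom 1 l) * monom 1 j) \<le> degree (dpow f e k (monom 1 l)) + degree (monom (1::int) j)"
            by (rule degree_mult_le)
          also have "\<dots> \<le> l + k * m + j"
            using degree_dpow[of f e k "monom 1 l"] by (simp add: degree_monom_eq degf)
          also have "k * m \<le> M * m" using k by simp
          finally show ?thesis using jl by (simp add: W_def)
        qed
        then have "degree (V k u) < W"
          using \<theta> by (auto simp: V_def ujl)
        then show ?thesis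
          unfolding poly_altdef by (intro sum.mono_neutral_left) (auto simp: coeff_eq_0)
      qed
      then show ?thesis by (simp add: sum_distrib_left mult.left_commute)
    qed
    also have "(\<Sum>u\<in>U. c u * (\<Sum>i<W. coeff (V k u) i * x ^ i)) = (\<Sum>i<W. x ^ i * (\<Sum>u\<in>U. coeff (V k u) i * c u))"
      by (simp add: sum_distrib_left, subst sum.swap) (simp add: mult_ac)
    also have "[poly f x ^ (M - k) * (\<Sum>i<W. x ^ i * (\<Sum>u\<in>U. coeff (V k u) i * c u)) = 0] (mod int p)"
      unfolding cong_0_iff
    proof (rule dvd_mult, rule dvd_sum, rule dvd_mult)
      fix i assume "i \<in> {..<W}"
      with k c(2)[of "(k, i)"] show "int p dvd (\<Sum>u\<in>U. coeff (V k u) i * c u)"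
        by (simp add: Eq_def)
    qed
    finally show ?thesis by (simp add: cong_0_iff)
  qed
  have finX: "finite X" by (rule finite_subset[of _ "{0..<int p}"]) (auto simp: X_def)
  \<comment> \<open>Every counted point is a zero of order M = 2 B while the degree is about p (B +
    1); their quotient is the main term p / 2.\<close>
  have "card X * M = (\<Sum>x\<in>X. M)" by simp
  also have "\<dots> \<le> degree P"
  proof (rule sum_multiplicities_le_degree[OF prime finX _ _ van Pnz])
    show "\<not> int p dvd x - y" if "x \<in> X" "y \<in> X" "x \<noteq> y" for x y
    proof
      assume "int p dvd x - y"
      then have "x mod int p = y mod int p" by (simp add: mod_eq_dvd_iff)
      with that show False by (simp add: X_def)
    qed
    have "M \<le> p" using B(2) B2 unfolding M_def by (simp add: algebra_simps)
    then show "int M \<le> int p" by simp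
  qed
  also have "degree P \<le> M * m + (q * m + (L + p * (J - 1)))"
  proof -
    have RT: "degree (\<Sum>j<J. t j * monom 1 (p * j)) \<le> L + p * (J - 1)"
      if "\<And>j. degree (t j) \<le> L" for t :: "nat \<Rightarrow> int poly"
    proof (intro degree_sum_le)
      fix j assume "j \<in> {..<J}"
      then have "p * j \<le> p * (J - 1)" by (intro mult_le_mono) auto
      then show "degree (t j * monom 1 (p * j)) \<le> L + p * (J - 1)"
        using that[of j] by (intro order_trans[OF degree_mult_le]) (simp add: degree_monom_eq add_mono)
    qed simp
    have dp: "degree (f ^ n) \<le> n * m" for n
      using degree_power_le[of f n] by (simp add: degf mult.commute)
    have "degree (f ^ q * T) \<le> q * m + (L + p * (J - 1))"
      using degree_mult_le[of "f ^ q" T] dp[of q] RT[of s, OF degr(2)] unfolding T_def by linarith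
    moreover have "degree R \<le> q * m + (L + p * (J - 1))"
      using RT[of r, OF degr(1)] unfolding R_def by linarith
    ultimately have "degree (R + f ^ q * T) \<le> q * m + (L + p * (J - 1))"
      by (rule degree_add_le[rotated])
    then show ?thesis
      unfolding PRT using degree_mult_le[of "f ^ M" "R + f ^ q * T"] dp[of M] by linarith
  qed
  finally have "card X * M \<le> M * m + (q * m + (L + p * (B + 1)))" by (simp add: J_def)
  moreover have "L \<le> p" using L1 by linarith
  ultimately show ?thesis
    unfolding X_def[symmetric] m_def[symmetric] M_def by (simp add: algebra_simps)
qed

text \<open>The losses for m factors once B is taken close to sqrt(p / (4 m + 6)): m for the share
  of f^M in the degree, and (m + 1) p / B with B at least half of that square root.\<close>

definition stepanov_const :: "nat \<Rightarrow> real" where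
  "stepanov_const m = real m + 2 * (real m + 1) * sqrt (4 * real m + 6)"

lemma stepanov_const_nonneg: "0 \<le> stepanov_const m"
  by (simp add: stepanov_const_def)

lemma stepanov_const_mono: "m \<le> n \<Longrightarrow> stepanov_const m \<le> stepanov_const n"
  unfolding stepanov_const_def by (intro add_mono mult_mono) auto

lemma card_residues_shift:
  fixes p t :: int
  assumes "p > 0" and per: "\<And>x y. [x = y] (mod p) \<Longrightarrow> P x \<longleftrightarrow> P y"
  shows "card {x \<in> {0..<p}. P (x + t)} = card {x \<in> {0..<p}. P x}"
proof (rule bij_betw_same_card[of "\<lambda>x. (x + t) mod p"], rule bij_betw_byWitness[where f' = "\<lambda>x. (x - t) mod p"])
  have *: "P (x mod p) = P x" for x by (rule per) simp
  show "(\<lambda>x. (x + t) mod p) ` {x \<in> {0..<p}. P (x + t)} \<subseteq> {x \<in> {0..<p}. P x}"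
    using assms(1) * by auto
  have "P ((x - t) mod p + t) = P x" for x
    by (rule per) (simp add: cong_def mod_simps)
  then show "(\<lambda>x. (x - t) mod p) ` {x \<in> {0..<p}. P x} \<subseteq> {x \<in> {0..<p}. P (x + t)}"
    using assms(1) by auto
qed (auto simp: mod_simps)

lemma stepanov_bound_nonzero:
  fixes a :: "'a \<Rightarrow> int" and p :: nat and \<theta> :: int
  assumes p: "prime p" "odd p"
    and S: "finite S" "S \<noteq> {}"
    and distinct: "\<And>k l. k \<in> S \<Longrightarrow> l \<in> S \<Longrightarrow> k \<noteq> l \<Longrightarrow> \<not> int p dvd a k - a l"
    and nz: "\<And>k. k \<in> S \<Longrightarrow> \<not> int p dvd a k"
    and \<theta>: "\<theta> = 1 \<or> \<theta> = -1"
    and big: "p \<ge> 4 * card S + 6"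
  shows "real (card {x \<in> {0..<int p}. [(\<Prod>k\<in>S. x + a k) ^ ((p - 1) div 2) = \<theta>] (mod int p)}) \<le>
    p / 2 + stepanov_const (card S) * sqrt p"
proof -
  define m where "m = card S"
  define q where "q = (p - 1) div 2"
  have q: "p = 2 * q + 1" using p(2) unfolding q_def by presburger
  \<comment> \<open>Since D = 2 (2 m + 3), the B^2 term of the size condition takes at most half of
    p, and the other half covers m + 2.\<close>
  define D where "D = 4 * real m + 6"
  define z where "z = sqrt (p / D)"
  define B where "B = nat \<lfloor>z\<rfloor>"
  have D: "D > 0" "real p \<ge> D" using big by (simp_all add: D_def m_def)
  have z1: "z \<ge> 1" unfolding z_def using D by simp
  then have Bz: "real B \<le> z" "z < real B + 1" "B \<ge> 1" unfolding B_def by linarith+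
  have "(real B)\<^sup>2 \<le> z\<^sup>2" using Bz by (intro power_mono) auto
  also have "z\<^sup>2 = p / D" unfolding z_def using D by simp
  finally have "(real B)\<^sup>2 * D \<le> p" using D by (simp add: field_simps)
  then have "2 * ((2 * real m + 3) * (real B)\<^sup>2) \<le> p" by (simp add: D_def algebra_simps)
  then have "2 * ((2 * m + 3) * B\<^sup>2) \<le> p"
    by (simp flip: of_nat_le_iff[where 'a = real] add: algebra_simps)
  then have "(2 * m + 3) * B\<^sup>2 + m + 2 < p" using big unfolding m_def by linarith
  from stepanov_count[OF p(1) q S distinct nz \<theta> Bz(3) this[unfolded m_def]]
  have "2 * B * card {x \<in> {0..<int p}. [(\<Prod>k\<in>S. x + a k) ^ q = \<theta>] (mod int p)} \<le> 2 * B * m + m * q + p * (B + 2)"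
    by (simp add: poly_prod m_def add.commute)
  then have "2 * real B * card {x \<in> {0..<int p}. [(\<Prod>k\<in>S. x + a k) ^ q = \<theta>] (mod int p)} \<le> 2 * real B * m + m * real q + p * (real B + 2)"
    by (simp flip: of_nat_le_iff[where 'a = real] add: algebra_simps)
  also have "real m * q \<le> real m * (2 * p)" using q by (intro mult_left_mono) auto
  finally have 1: "real (card {x \<in> {0..<int p}. [(\<Prod>k\<in>S. x + a k) ^ q = \<theta>] (mod int p)}) \<le>
      p / 2 + m + (real m + 1) * (p / B)"
    using Bz(3) by (simp add: field_simps)
  have "p / B \<le> sqrt D * sqrt p * 2"
  proof -
    have "z \<le> 2 * B" using Bz by simp
    moreover have "p = z * (sqrt D * sqrt p)"
      using D by (simp add: z_def real_sqrt_divide)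
    ultimately have "p \<le> (2 * B) * (sqrt D * sqrt p)"
      using D by (metis mult_right_mono mult_nonneg_nonneg of_nat_0_le_iff real_sqrt_ge_zero less_imp_le)
    then show ?thesis using Bz(3) by (simp add: field_simps)
  qed
  then have 2: "(real m + 1) * (p / B) \<le> (real m + 1) * (sqrt D * sqrt p * 2)"
    by (intro mult_left_mono) auto
  have 3: "real m \<le> real m * sqrt p" using p(1) prime_ge_1_nat[OF p(1)] by (simp add: mult_le_cancel_left1)
  have "p / 2 + stepanov_const m * sqrt p = p / 2 + real m * sqrt p + (real m + 1) * (sqrt D * sqrt p * 2)"
    by (simp add: stepanov_const_def D_def algebra_simps)
  with 1 2 3 show ?thesis unfolding m_def[symmetric] q_def[symmetric] by linarith
qed

text \<open>Translating x does not change the count, and for p \<ge> 4 m + 6 some translation makes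
  every \<open>a k\<close> nonzero modulo p. For smaller p the claimed bound is at least p.\<close>

lemma stepanov_bound:
  fixes a :: "'a \<Rightarrow> int" and p :: nat and \<theta> :: int
  assumes p: "prime p" "odd p"
    and S: "finite S" "S \<noteq> {}"
    and distinct: "\<And>k l. k \<in> S \<Longrightarrow> l \<in> S \<Longrightarrow> k \<noteq> l \<Longrightarrow> \<not> int p dvd a k - a l"
    and \<theta>: "\<theta> = 1 \<or> \<theta> = -1"
  shows "real (card {x \<in> {0..<int p}. [(\<Prod>k\<in>S. x + a k) ^ ((p - 1) div 2) = \<theta>] (mod int p)}) \<le>
    p / 2 + stepanov_const (card S) * sqrt p"
proof (cases "p \<ge> 4 * card S + 6")
  case True
  let ?P = "\<lambda>x. [(\<Prod>k\<in>S. x + a k) ^ ((p - 1) div 2) = \<theta>] (mod int p)"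
  have p0: "int p > 0" using True by simp
  obtain t where t: "\<And>k. k \<in> S \<Longrightarrow> \<not> int p dvd t + a k"
  proof -
    have "card ((\<lambda>k. (- a k) mod int p) ` S) \<le> card S" using S by (intro card_image_le)
    also have "\<dots> < card {0..<int p}" using True by simp
    finally have "\<not> {0..<int p} \<subseteq> (\<lambda>k. (- a k) mod int p) ` S"
      using S by (meson card_mono finite_imageI not_le)
    then obtain t where t: "t \<in> {0..<int p}" "t \<notin> (\<lambda>k. (- a k) mod int p) ` S" by blast
    have "\<not> int p dvd t + a k" if "k \<in> S" for k
    proof
      assume "int p dvd t + a k"
      then have "int p dvd t - (- a k)" by simp
      then have "t mod int p = (- a k) mod int p" by (simp only: mod_eq_dvd_iff)
      with t(1) have "t = (- a k) mod int p" by simp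
      with that t(2) show False by blast
    qed
    then show ?thesis by (rule that)
  qed
  have "card {x \<in> {0..<int p}. ?P x} = card {x \<in> {0..<int p}. ?P (x + t)}"
  proof (rule card_residues_shift[OF p0, symmetric])
    fix x y assume "[x = y] (mod int p)"
    then have "[(\<Prod>k\<in>S. x + a k) ^ ((p - 1) div 2) = (\<Prod>k\<in>S. y + a k) ^ ((p - 1) div 2)] (mod int p)"
      by (intro cong_pow cong_prod cong_add cong_refl)
    then show "?P x = ?P y" using cong_sym cong_trans by blast
  qed
  also have "real \<dots> \<le> p / 2 + stepanov_const (card S) * sqrt p"
    using stepanov_bound_nonzero[where a = "\<lambda>k. t + a k", OF p S _ t \<theta> True] distinct
    by (simp add: add.assoc add.left_commute)
  finally show ?thesis .
next
  case False
  define m where "m = card S"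
  define D where "D = 4 * real m + 6"
  have "sqrt p \<le> sqrt D" using False by (simp add: D_def m_def)
  then have "sqrt p * sqrt p \<le> sqrt D * sqrt p" by (intro mult_right_mono) auto
  also have "sqrt D \<le> stepanov_const m"
    unfolding stepanov_const_def D_def[symmetric] by (simp add: mult_le_cancel_right1 D_def add_nonneg_pos algebra_simps)
  finally have 1: "real p \<le> stepanov_const m * sqrt p" by (simp add: mult_right_mono)
  have "card {x \<in> {0..<int p}. [(\<Prod>k\<in>S. x + a k) ^ ((p - 1) div 2) = \<theta>] (mod int p)} \<le> card {0..<int p}"
    by (intro card_mono) auto
  then show ?thesis using 1 by (simp add: m_def)
qed

section \<open>Sums of Legendre symbols\<close>

lemma legendre_values: "Legendre a p = 1 \<or> Legendre a p = -1 \<or> Legendre a p = 0"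
  by (auto simp: Legendre_def)

lemma card_legendre_zeros_le:
  fixes a :: "'a \<Rightarrow> int"
  assumes "finite S"
  shows "card {x \<in> {0..<p}. \<exists>k\<in>S. Legendre (x + a k) p = 0} \<le> card S"
proof -
  have "{x \<in> {0..<p}. \<exists>k\<in>S. Legendre (x + a k) p = 0} \<subseteq> (\<lambda>k. (- a k) mod p) ` S"
  proof
    fix x assume "x \<in> {x \<in> {0..<p}. \<exists>k\<in>S. Legendre (x + a k) p = 0}"
    then obtain k where k: "x \<in> {0..<p}" "k \<in> S" "Legendre (x + a k) p = 0" by blast
    then have "p dvd x - (- a k)" by (auto simp: Legendre_def cong_0_iff split: if_splits)
    then have "x mod p = (- a k) mod p" by (simp only: mod_eq_dvd_iff)
    with k show "x \<in> (\<lambda>k. (- a k) mod p) ` S" by auto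
  qed
  then show ?thesis by (meson assms card_image_le card_mono finite_imageI le_trans)
qed

text \<open>An elementary substitute for Weil's bound. Only upper bounds are available for either
  sign, but the counts of 1, -1 and 0 add up to p and the last is at most \<open>card S\<close>, so
  an upper bound for one sign is a lower bound for the other. The factor 3 is 2 from this argument
  and 1 from the zeros.\<close>

lemma legendre_sum_bound:
  fixes a :: "'a \<Rightarrow> int" and p :: nat
  assumes p: "prime p" "odd p"
    and S: "finite S" "S \<noteq> {}"
    and distinct: "\<And>k l. k \<in> S \<Longrightarrow> l \<in> S \<Longrightarrow> k \<noteq> l \<Longrightarrow> \<not> int p dvd a k - a l"
  shows "\<bar>real_of_int (\<Sum>x\<in>{0..<int p}. \<Prod>k\<in>S. Legendre (x + a k) (int p))\<bar> \<le> 3 * stepanov_const (card S) * sqrt p"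
proof -
  define v where "v x = (\<Prod>k\<in>S. Legendre (x + a k) (int p))" for x
  define X where "X = {0..<int p}"
  define N where "N \<theta> = card {x \<in> X. v x = \<theta>}" for \<theta>
  have p2: "p > 2" using p prime_ge_2_nat[of p] by (cases "p = 2") auto
  have prime: "prime (int p)" using p(1) by simp
  have fin: "finite X" by (simp add: X_def)
  have v: "v x = 1 \<or> v x = -1 \<or> v x = 0" for x
    unfolding v_def using S(1)
  proof (induction S rule: finite_induct)
    case (insert k S)
    then show ?case using legendre_values[of "x + a k" "int p"] by auto
  qed auto
  have cong: "[v x = (\<Prod>k\<in>S. x + a k) ^ ((p - 1) div 2)] (mod int p)" for x
    unfolding v_def prod_power_distrib
    by (intro cong_prod euler_criterion p2 p(1))
  have upper: "real (N \<theta>) \<le> p / 2 + stepanov_const (card S) * sqrt p" if "\<theta> = 1 \<or> \<theta> = -1" for \<theta>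
  proof -
    have "N \<theta> \<le> card {x \<in> X. [(\<Prod>k\<in>S. x + a k) ^ ((p - 1) div 2) = \<theta>] (mod int p)}"
      unfolding N_def using fin cong by (intro card_mono) (auto intro: cong_sym)
    then show ?thesis using stepanov_bound[where a = a, OF p S distinct that] by (simp add: X_def)
  qed
  have zero: "N 0 \<le> card S"
  proof -
    have "{x \<in> X. v x = 0} = {x \<in> X. \<exists>k\<in>S. Legendre (x + a k) (int p) = 0}"
      using S(1) by (auto simp: v_def)
    then show ?thesis unfolding N_def X_def by (simp only: card_legendre_zeros_le[OF S(1)])
  qed
  have "X = {x \<in> X. v x = 1} \<union> {x \<in> X. v x = -1} \<union> {x \<in> X. v x = 0}" using v by blast
  then have "card X = card ({x \<in> X. v x = 1} \<union> {x \<in> X. v x = -1} \<union> {x \<in> X. v x = 0})" by simp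
  also have "\<dots> = N 1 + N (-1) + N 0"
    unfolding N_def using fin by (subst card_Un_disjoint; auto simp: card_Un_disjoint)+
  finally have total: "p = N 1 + N (-1) + N 0" by (simp add: X_def)
  have "(\<Sum>x\<in>X. v x) = (\<Sum>x\<in>X. (if v x = 1 then 1 else 0) - (if v x = -1 then 1 else 0))"
    by (intro sum.cong refl) (use v in force)
  also have "\<dots> = int (N 1) - int (N (-1))"
    using fin by (simp add: sum_subtractf N_def sum.If_cases Int_def)
  finally have sum: "real_of_int (\<Sum>x\<in>X. v x) = real (N 1) - real (N (-1))" by simp
  have "real (card S) \<le> stepanov_const (card S)" by (simp add: stepanov_const_def)
  also have "\<dots> \<le> stepanov_const (card S) * sqrt p"
    using p2 stepanov_const_nonneg[of "card S"] by (simp add: mult_le_cancel_left1)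
  finally have m: "real (N 0) \<le> stepanov_const (card S) * sqrt p" using zero by linarith
  have "real p = real (N 1) + real (N (-1)) + real (N 0)" using total by linarith
  then show ?thesis
    unfolding v_def[symmetric] X_def[symmetric] sum using upper[of 1] upper[of "-1"] m by linarith
qed

section \<open>Squares modulo prime powers\<close>

definition sq_mod :: "int \<Rightarrow> int \<Rightarrow> bool" where
  "sq_mod q y \<longleftrightarrow> (\<exists>z. [z\<^sup>2 = y] (mod q))"

text \<open>The index type is left free: besides the shifts of a tuple it admits the one-point
  pattern over \<open>unit\<close>, so that results on patterns also apply to the number of
  squares.\<close>

definition pattern_count :: "'a set \<Rightarrow> ('a \<Rightarrow> int) \<Rightarrow> int \<Rightarrow> nat" where
  "pattern_count I a q = card {x \<in> {0..<q}. \<forall>k\<in>I. sq_mod q (x + a k)}"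

section \<open>Dependence on the modulus: reduction and the Chinese remainder theorem\<close>

lemma sq_mod_cong: "[x = y] (mod q) \<Longrightarrow> sq_mod q x \<longleftrightarrow> sq_mod q y"
  unfolding sq_mod_def using cong_trans cong_sym by blast

lemma sq_mod_dvd: "sq_mod q x \<Longrightarrow> d dvd q \<Longrightarrow> sq_mod d x"
  unfolding sq_mod_def using cong_dvd_modulus by blast

lemma sq_mod_mult_coprime:
  assumes "coprime q1 q2"
  shows "sq_mod (q1 * q2) x \<longleftrightarrow> sq_mod q1 x \<and> sq_mod q2 x"
proof
  assume "sq_mod q1 x \<and> sq_mod q2 x"
  then obtain y z where yz: "[y\<^sup>2 = x] (mod q1)" "[z\<^sup>2 = x] (mod q2)"
    by (auto simp: sq_mod_def)
  obtain w where w: "[w = y] (mod q1)" "[w = z] (mod q2)"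
    using binary_chinese_remainder_int[OF assms] by blast
  have "[w\<^sup>2 = x] (mod q1)" "[w\<^sup>2 = x] (mod q2)"
    using w yz cong_pow cong_trans by blast+
  then have "[w\<^sup>2 = x] (mod q1 * q2)" using assms by (rule coprime_cong_mult)
  then show "sq_mod (q1 * q2) x" by (auto simp: sq_mod_def)
qed (auto intro: sq_mod_dvd)

lemma squares_mod_eq:
  assumes "q > 0"
  shows "squares_mod q = {x \<in> {0..<q}. sq_mod q x}"
proof (intro equalityI subsetI)
  fix x assume "x \<in> {x \<in> {0..<q}. sq_mod q x}"
  then obtain z where z: "[z\<^sup>2 = x] (mod q)" "0 \<le> x" "x < q" by (auto simp: sq_mod_def)
  then have "x = (z mod q)\<^sup>2 mod q" by (simp add: cong_def mod_simps)
  then show "x \<in> squares_mod q" using assms unfolding squares_mod_def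
    by (intro image_eqI[of _ _ "z mod q"]) auto
next
  fix x assume "x \<in> squares_mod q"
  then show "x \<in> {x \<in> {0..<q}. sq_mod q x}"
    using assms unfolding squares_mod_def sq_mod_def by (auto simp: cong_def)
qed

lemma num_squares_eq: "q > 0 \<Longrightarrow> num_squares q = pattern_count {()} (\<lambda>_. 0) q"
  by (simp add: num_squares_def squares_mod_eq pattern_count_def)

lemma finite_squares_mod [simp]: "finite (squares_mod q)"
  by (simp add: squares_mod_def)

lemma num_squares_pos: "q > 0 \<Longrightarrow> num_squares q > 0"
  unfolding num_squares_def card_gt_0_iff by (auto simp: squares_mod_def)

lemma num_squares_le: "q > 0 \<Longrightarrow> int (num_squares q) \<le> q"
proof -
  assume "q > 0"
  then have "num_squares q \<le> card {0..<q}"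
    unfolding num_squares_def squares_mod_eq[OF \<open>q > 0\<close>] by (intro card_mono) auto
  then show ?thesis using \<open>q > 0\<close> by simp
qed

lemma pattern_count_mult_coprime:
  assumes "coprime q1 q2" "q1 > 0" "q2 > 0"
  shows "pattern_count I a (q1 * q2) = pattern_count I a q1 * pattern_count I a q2"
proof -
  let ?X = "\<lambda>q. {x \<in> {0..<q}. \<forall>k\<in>I. sq_mod q (x + a k)}"
  let ?f = "\<lambda>x. (x mod q1, x mod q2)"
  have mod: "sq_mod q (x mod q + y) \<longleftrightarrow> sq_mod q (x + y)" for q x y
    by (rule sq_mod_cong) (simp add: cong_def mod_simps)
  have "bij_betw ?f (?X (q1 * q2)) (?X q1 \<times> ?X q2)"
    unfolding bij_betw_def
  proof
    show "inj_on ?f (?X (q1 * q2))"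
    proof (rule inj_onI)
      fix x y assume xy: "x \<in> ?X (q1 * q2)" "y \<in> ?X (q1 * q2)" "?f x = ?f y"
      then have "[x = y] (mod q1)" "[x = y] (mod q2)" by (auto simp: cong_def)
      then have "[x = y] (mod q1 * q2)" using assms(1) by (rule coprime_cong_mult)
      then show "x = y" using xy by (auto simp: cong_def)
    qed
    show "?f ` ?X (q1 * q2) = ?X q1 \<times> ?X q2"
    proof (intro equalityI subsetI)
      fix z assume "z \<in> ?f ` ?X (q1 * q2)"
      then show "z \<in> ?X q1 \<times> ?X q2"
        using assms by (auto simp: sq_mod_mult_coprime mod)
    next
      fix z assume z: "z \<in> ?X q1 \<times> ?X q2"
      obtain x1 x2 where zx: "z = (x1, x2)" by (cases z)
      obtain w where w: "[w = x1] (mod q1)" "[w = x2] (mod q2)"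
        using binary_chinese_remainder_int[OF assms(1)] by blast
      define y where "y = w mod (q1 * q2)"
      have y: "y mod q1 = x1" "y mod q2 = x2"
        using w z zx by (auto simp: y_def cong_def mod_mod_cancel)
      have "y \<in> ?X (q1 * q2)"
        using z zx assms mod[of q1 y] mod[of q2 y] y by (auto simp: sq_mod_mult_coprime y_def)
      then show "z \<in> ?f ` ?X (q1 * q2)" using y zx by (intro image_eqI[of _ _ y]) auto
    qed
  qed
  from bij_betw_same_card[OF this] show ?thesis
    by (simp only: pattern_count_def card_cartesian_product)
qed

section \<open>Lifting squares to higher prime powers\<close>

lemma card_periodic:
  fixes q :: int
  assumes "q > 0" and per: "\<And>x y. [x = y] (mod q) \<Longrightarrow> P x \<longleftrightarrow> P y"
  shows "card {x \<in> {0..<q * int n}. P x} = n * card {x \<in> {0..<q}. P x}"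
proof -
  have "bij_betw (\<lambda>(i, y). q * i + y) ({0..<int n} \<times> {x \<in> {0..<q}. P x}) {x \<in> {0..<q * int n}. P x}"
  proof (rule bij_betw_byWitness[where f' = "\<lambda>x. (x div q, x mod q)"])
    have "P (q * i + y) = P y" for i y by (rule per) (simp add: cong_def)
    moreover have "q * i + y < q * int n" if "i < int n" "y < q" for i y
    proof -
      have "q * i + y < q * (i + 1)" using that by (simp add: algebra_simps)
      also have "\<dots> \<le> q * int n" using that assms(1) by (intro mult_left_mono) auto
      finally show ?thesis .
    qed
    ultimately show "(\<lambda>(i, y). q * i + y) ` ({0..<int n} \<times> {x \<in> {0..<q}. P x}) \<subseteq> {x \<in> {0..<q * int n}. P x}"
      using assms(1) by auto
    have div_less: "x div q < int n" if "x < q * int n" for x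
    proof -
      have "q * (x div q) < q * int n"
        using that assms(1) pos_mod_sign[of q x] mult_div_mod_eq[of q x] by linarith
      then show ?thesis using assms(1) by simp
    qed
    have "P (x mod q) = P x" for x by (rule per) simp
    then show "(\<lambda>x. (x div q, x mod q)) ` {x \<in> {0..<q * int n}. P x} \<subseteq> {0..<int n} \<times> {x \<in> {0..<q}. P x}"
      using assms(1) by (auto simp: pos_imp_zdiv_nonneg_iff div_less)
  qed (use assms(1) in auto)
  from bij_betw_same_card[OF this] show ?thesis by (simp add: card_cartesian_product)
qed

lemma card_multiples_shift:
  fixes q a :: int
  assumes "q > 0"
  shows "card {x \<in> {0..<q * int n}. q dvd x + a} = n"
proof -
  have per: "[x = y] (mod q) \<Longrightarrow> q dvd x + a \<longleftrightarrow> q dvd y + a" for x y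
    by (metis cong_add_rcancel cong_dvd_iff)
  have "card {x \<in> {0..<q}. q dvd x + a} = card {x \<in> {0..<q}. q dvd x}"
    by (rule card_residues_shift[OF assms]) (rule cong_dvd_iff)
  also have "{x \<in> {0..<q}. q dvd x} = {0}"
    using assms by (auto dest: zdvd_imp_le)
  finally show ?thesis using card_periodic[where n = n, OF assms per] by simp
qed

text \<open>Hensel lifting for all primes at once, where p^b is the exact power of p in 2. If p^w is
  the exact power in the root z, then z is corrected by p^v t with v = j - w - b: the cross term 2 z
  p^v t can realize any multiple of p^j modulo p^(j+1), and the hypothesis on y gives 2 v > j, so
  that the square term disappears.\<close>

lemma sq_mod_lift:
  fixes p u y :: int
  assumes p: "prime p" and u: "2 = u * p ^ b" "\<not> p dvd u"
    and sq: "sq_mod (p ^ j) y" and y: "\<not> p ^ (j - 2 * b) dvd y"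
  shows "sq_mod (p ^ Suc j) y"
proof -
  obtain z where z: "[z\<^sup>2 = y] (mod p ^ j)" using sq by (auto simp: sq_mod_def)
  \<comment> \<open>For j \<le> 2 b the truncated exponent is 0, and p^0 divides everything.\<close>
  have jb: "2 * b < j" using y by (cases "2 * b < j") auto
  have "\<not> p ^ (j - 2 * b) dvd z\<^sup>2"
    using z y by (meson cong_dvd_iff cong_dvd_modulus diff_le_self le_imp_power_dvd)
  then have "z \<noteq> 0" using jb by auto
  then obtain w z1 where z1: "z = p ^ w * z1" "\<not> p dvd z1"
    using multiplicity_decompose'[of z p] p by (metis not_prime_unit)
  have w: "2 * w < j - 2 * b"
  proof (rule ccontr)
    assume "\<not> 2 * w < j - 2 * b"
    then have "p ^ (j - 2 * b) dvd p ^ (2 * w)" by (simp add: le_imp_power_dvd)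
    then have "p ^ (j - 2 * b) dvd z\<^sup>2"
      unfolding z1(1) power_mult_distrib by (simp add: mult.commute flip: power_mult)
    with \<open>\<not> p ^ (j - 2 * b) dvd z\<^sup>2\<close> show False by blast
  qed
  obtain d where d: "y - z\<^sup>2 = p ^ j * d"
    using z by (metis cong_iff_dvd_diff cong_sym dvd_def)
  have "coprime (u * z1) p"
    using p u z1 by (meson coprime_commute prime_dvd_multD prime_imp_coprime)
  then obtain t0 where "[u * z1 * t0 = 1] (mod p)" by (meson cong_solve_coprime_int)
  then have "[u * z1 * t0 * d = 1 * d] (mod p)" by (rule cong_scalar_right)
  then obtain t where "[u * z1 * t = d] (mod p)" by (metis mult.assoc mult_1)
  then obtain e where e: "d - u * z1 * t = p * e" by (metis cong_iff_dvd_diff cong_sym dvd_def)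
  define v where "v = j - w - b"
  have v: "w + b + v = j" using w jb by (simp add: v_def)
  have v2: "2 * v = Suc j + (2 * v - Suc j)" using w jb by (simp add: v_def)
  have "(p ^ v)\<^sup>2 = p ^ (2 * v)" by (simp add: mult.commute flip: power_mult)
  moreover have "(z + g * t)\<^sup>2 = z\<^sup>2 + 2 * z * g * t + g\<^sup>2 * t\<^sup>2" for g
    by (simp add: power2_eq_square algebra_simps)
  ultimately have "(z + p ^ v * t)\<^sup>2 = z\<^sup>2 + 2 * z * p ^ v * t + p ^ (2 * v) * t\<^sup>2" by metis
  also have "2 * z * p ^ v * t = p ^ (w + b + v) * (u * z1 * t)"
    unfolding z1(1) u(1) by (simp add: power_add algebra_simps)
  also have "\<dots> = p ^ j * d - p ^ j * (p * e)"
    unfolding v using e by (simp flip: right_diff_distrib)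
  also have "p ^ (2 * v) = p ^ Suc j * p ^ (2 * v - Suc j)" by (metis v2 power_add)
  finally have "(z + p ^ v * t)\<^sup>2 - y = p ^ Suc j * (p ^ (2 * v - Suc j) * t\<^sup>2 - e)"
    using d by (simp add: algebra_simps)
  then have "[(z + p ^ v * t)\<^sup>2 = y] (mod p ^ Suc j)" by (simp add: cong_iff_dvd_diff)
  then show ?thesis by (auto simp: sq_mod_def)
qed

lemma two_decomp:
  fixes p :: int
  assumes "prime p"
  obtains u b where "2 = u * p ^ b" "\<not> p dvd u" "p ^ (2 * b) \<le> 4"
proof (cases "p = 2")
  case True
  then show ?thesis using that[of 1 1] by simp
next
  case False
  then have "\<not> p dvd 2"
    using assms primes_dvd_imp_eq[of p 2] by auto
  then show ?thesis using that[of 2 0] by simp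
qed

text \<open>A pattern modulo p^j lifts to all p classes above it unless some x + a k is divisible by
  p^(j - 2b), where p^b is the power of p in 2. For each k at most p^(2b+1) \<le> 4 p residues
  modulo p^(j+1) are of this kind, whatever j is.\<close>

lemma pattern_count_prime_power_step:
  fixes p :: int and a :: "'a \<Rightarrow> int"
  assumes p: "prime p" and I: "finite I"
  shows "int (pattern_count I a (p ^ Suc j)) \<le> p * int (pattern_count I a (p ^ j))"
    and "p * int (pattern_count I a (p ^ j)) - int (pattern_count I a (p ^ Suc j)) \<le> 4 * int (card I) * p"
proof -
  have p0: "p > 0" using p by (simp add: prime_gt_0_int)
  obtain u b where u: "2 = u * p ^ b" "\<not> p dvd u" "p ^ (2 * b) \<le> 4" by (rule two_decomp[OF p])
  define X where "X = {x \<in> {0..<p ^ Suc j}. \<forall>k\<in>I. sq_mod (p ^ Suc j) (x + a k)}"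
  define Y where "Y = {x \<in> {0..<p ^ Suc j}. \<forall>k\<in>I. sq_mod (p ^ j) (x + a k)}"
  define Z where "Z k = {x \<in> {0..<p ^ Suc j}. p ^ (j - 2 * b) dvd x + a k}" for k
  have XY: "X \<subseteq> Y" unfolding X_def Y_def by (auto intro: sq_mod_dvd)
  have finY: "finite Y" unfolding Y_def by (rule finite_subset[of _ "{0..<p ^ Suc j}"]) auto
  have X: "card X = pattern_count I a (p ^ Suc j)" by (simp add: X_def pattern_count_def)
  have "card {x \<in> {0..<p ^ j * int (nat p)}. \<forall>k\<in>I. sq_mod (p ^ j) (x + a k)} = nat p * pattern_count I a (p ^ j)"
    unfolding pattern_count_def
  proof (rule card_periodic)
    fix x y assume "[x = y] (mod p ^ j)"
    then have "[x + a k = y + a k] (mod p ^ j)" for k by (simp add: cong_add_rcancel)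
    then show "(\<forall>k\<in>I. sq_mod (p ^ j) (x + a k)) = (\<forall>k\<in>I. sq_mod (p ^ j) (y + a k))"
      using sq_mod_cong by blast
  qed (use p0 in simp)
  then have Y: "int (card Y) = p * int (pattern_count I a (p ^ j))"
    using p0 by (simp add: Y_def mult.commute)
  show "int (pattern_count I a (p ^ Suc j)) \<le> p * int (pattern_count I a (p ^ j))"
    using card_mono[OF finY XY] X Y by simp
  have "Y - X \<subseteq> (\<Union>k\<in>I. Z k)"
    using sq_mod_lift[OF p u(1,2)] by (fastforce simp: X_def Y_def Z_def)
  then have "card (Y - X) \<le> card (\<Union>k\<in>I. Z k)"
    using I by (intro card_mono finite_UN_I) (auto simp: Z_def intro: finite_subset[of _ "{0..<p ^ Suc j}"])
  also have "\<dots> \<le> (\<Sum>k\<in>I. card (Z k))" using I by (rule card_UN_le)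
  finally have "int (card (Y - X)) \<le> (\<Sum>k\<in>I. int (card (Z k)))" by (metis of_nat_mono of_nat_sum)
  also have "\<dots> \<le> (\<Sum>k\<in>I. 4 * p)"
  proof (rule sum_mono)
    fix k
    have "p ^ Suc j = p ^ (j - 2 * b) * p ^ (Suc j - (j - 2 * b))" by (simp flip: power_add)
    then have "card (Z k) = nat (p ^ (Suc j - (j - 2 * b)))"
      using card_multiples_shift[of "p ^ (j - 2 * b)" "nat (p ^ (Suc j - (j - 2 * b)))" "a k"] p0
      by (simp add: Z_def)
    then have "int (card (Z k)) = p ^ (Suc j - (j - 2 * b))" using p0 by simp
    also have "\<dots> \<le> p ^ Suc (2 * b)" using p0 by (intro power_increasing) auto
    also have "\<dots> \<le> 4 * p" using u(3) p0 by (simp add: mult.commute)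
    finally show "int (card (Z k)) \<le> 4 * p" .
  qed
  also have "card (Y - X) = card Y - card X" using finY XY by (simp add: card_Diff_subset finite_subset)
  finally show "p * int (pattern_count I a (p ^ j)) - int (pattern_count I a (p ^ Suc j)) \<le> 4 * int (card I) * p"
    using card_mono[OF finY XY] X Y by (simp add: of_nat_diff)
qed

section \<open>The number of squares and the mean spacing at prime powers\<close>

lemma num_squares_odd_prime:
  assumes "prime p" "odd p"
  shows "2 * num_squares (int p) = p + 1"
proof -
  define q where "q = (p - 1) div 2"
  have q: "p = 2 * q + 1" using assms(2) unfolding q_def by presburger
  have prime: "prime (int p)" using assms by simp
  have p0: "p > 0" using prime_gt_0_nat[OF assms(1)] .
  let ?f = "\<lambda>x. x\<^sup>2 mod int p"
  have "squares_mod (int p) = ?f ` {0..int q}"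
  proof (intro equalityI subsetI)
    fix y assume "y \<in> squares_mod (int p)"
    then obtain x where x: "0 \<le> x" "x < int p" "y = ?f x" by (auto simp: squares_mod_def)
    show "y \<in> ?f ` {0..int q}"
    proof (cases "x \<le> int q")
      case False
      have "(int p - x)\<^sup>2 = x\<^sup>2 + int p * (int p - 2 * x)"
        by (simp add: power2_eq_square algebra_simps)
      then have "?f x = ?f (int p - x)" by simp
      then show ?thesis using x False q by (intro image_eqI[of _ _ "int p - x"]) auto
    qed (use x in auto)
  qed (use q in \<open>auto simp: squares_mod_def\<close>)
  moreover have "inj_on ?f {0..int q}"
  proof (rule inj_onI)
    fix x y assume xy: "x \<in> {0..int q}" "y \<in> {0..int q}" "?f x = ?f y"
    then have "int p dvd (x - y) * (x + y)"
      by (simp add: mod_eq_dvd_iff power2_eq_square algebra_simps)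
    then have "int p dvd x - y \<or> int p dvd x + y" using prime by (simp add: prime_dvd_mult_iff)
    then show "x = y"
    proof
      assume "int p dvd x - y"
      then have "x \<noteq> y \<Longrightarrow> int p \<le> \<bar>x - y\<bar>" using dvd_imp_le_int[of "x - y" "int p"] by auto
      moreover have "0 \<le> x" "0 \<le> y" "x \<le> int q" "y \<le> int q" "int p = 2 * int q + 1" using xy q by auto
      ultimately show ?thesis by linarith
    next
      assume "int p dvd x + y"
      then have "x + y \<noteq> 0 \<Longrightarrow> int p \<le> \<bar>x + y\<bar>" using dvd_imp_le_int[of "x + y" "int p"] by auto
      moreover have "0 \<le> x" "0 \<le> y" "x \<le> int q" "y \<le> int q" "int p = 2 * int q + 1" using xy q by auto
      ultimately show ?thesis by linarith
    qed
  qed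
  ultimately have "num_squares (int p) = q + 1"
    by (simp add: num_squares_def card_image)
  then show ?thesis using q by simp
qed

lemma sq_mod_prime_power_of_unit:
  fixes p :: int
  assumes "prime p" "odd p" "\<not> p dvd x" "sq_mod p x"
  shows "sq_mod (p ^ Suc j) x"
proof (induction j)
  case 0
  then show ?case using assms by simp
next
  case (Suc j)
  have "\<not> p dvd 2"
    using assms primes_dvd_imp_eq[of p 2] by auto
  then show ?case
    using sq_mod_lift[OF assms(1), of 2 0 "Suc j" x] Suc assms(3) by (auto dest: dvd_mult_left)
qed

text \<open>Up to the modulus 8 the root 1 serves. From there on lifting applies with b = 1, since
  an odd x is not divisible by 2^(j - 2) when j \<ge> 3.\<close>

lemma sq_mod_two_power:
  assumes "[x = 1] (mod 8)"
  shows "sq_mod (2 ^ j) x"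
proof (induction j)
  case 0
  then show ?case by (simp add: sq_mod_def)
next
  case (Suc j)
  show ?case
  proof (cases "j \<le> 2")
    case True
    have "[1\<^sup>2 = x] (mod 8)" using assms by (simp add: cong_sym)
    then have "sq_mod 8 x" unfolding sq_mod_def by blast
    then have "sq_mod (2 ^ 3) x" by simp
    moreover have "(2::int) ^ Suc j dvd 2 ^ 3" using True by (intro le_imp_power_dvd) auto
    ultimately show ?thesis by (rule sq_mod_dvd)
  next
    case False
    have "[x = 1] (mod 2)" using assms by (rule cong_dvd_modulus) simp
    then have "\<not> 2 dvd x" by (simp add: cong_dvd_iff)
    moreover obtain i where "j - 2 = Suc i" using False by (metis Suc_diff_Suc not_le diff_Suc_Suc numeral_2_eq_2)
    ultimately have "\<not> (2::int) ^ (j - 2 * 1) dvd x" by (auto dest: dvd_mult_left)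
    then show ?thesis using sq_mod_lift[of 2 1 1 j x] Suc by simp
  qed
qed

text \<open>Squares of units suffice. For large powers of 2 these are the residues 1 modulo 8,
  whence the constant 8; for odd p a unit that is a square modulo p is one modulo every power, and
  (p - 1) / 2 \<ge> p / 8.\<close>

lemma num_squares_prime_power_ge:
  assumes "prime p"
  shows "int p ^ j \<le> 8 * int (num_squares (int p ^ j))"
proof (cases "p = 2")
  case True
  show ?thesis
  proof (cases "j \<le> 3")
    case True
    then have "(2::int) ^ j \<le> 2 ^ 3" by (intro power_increasing) auto
    moreover have "num_squares (2 ^ j) > 0" by (rule num_squares_pos) simp
    ultimately show ?thesis using \<open>p = 2\<close> by simp
  next
    case False
    then have j: "(2::int) ^ j = 8 * int (2 ^ (j - 3))"
      using power_add[of "2::int" 3 "j - 3"] by simp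
    have "2 ^ (j - 3) = card {x \<in> {0..<8 * int (2 ^ (j - 3))}. 8 dvd x + (- 1)}"
      by (rule card_multiples_shift[symmetric]) simp
    also have "\<dots> \<le> num_squares (2 ^ j)"
      unfolding num_squares_def j[symmetric] squares_mod_eq[of "2 ^ j", simplified]
      by (rule card_mono) (auto intro!: sq_mod_two_power finite_subset[of _ "{0..<2 ^ j}"] simp: cong_iff_dvd_diff)
    finally show ?thesis using j \<open>p = 2\<close> by simp
  qed
next
  case False
  then have "odd p" using assms prime_odd_nat[of p] prime_ge_2_nat[of p] by (metis le_neq_implies_less)
  have p3: "p \<ge> 3" using assms False prime_ge_2_nat[of p] by simp
  have prime: "prime (int p)" using assms by simp
  show ?thesis
  proof (cases j)
    case 0
    then show ?thesis using num_squares_pos[of 1] by simp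
  next
    case (Suc i)
    define P where "P x \<longleftrightarrow> sq_mod (int p) x \<and> \<not> int p dvd x" for x
    have "card {x \<in> {0..<int p * int (p ^ i)}. P x} = p ^ i * card {x \<in> {0..<int p}. P x}"
    proof (rule card_periodic)
      show "P x \<longleftrightarrow> P y" if "[x = y] (mod int p)" for x y
        unfolding P_def using that sq_mod_cong cong_dvd_iff by blast
    qed (use p3 in simp)
    moreover have "card {x \<in> {0..<int p * int (p ^ i)}. P x} \<le> num_squares (int p ^ j)"
    proof -
      have "{x \<in> {0..<int p * int (p ^ i)}. P x} \<subseteq> squares_mod (int p ^ j)"
        using p3 prime \<open>odd p\<close> sq_mod_prime_power_of_unit[OF prime, of _ i]
        by (auto simp: P_def Suc squares_mod_eq)
      then show ?thesis unfolding num_squares_def by (rule card_mono[rotated]) simp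
    qed
    moreover have "card {x \<in> {0..<int p}. P x} = num_squares (int p) - 1"
    proof -
      have zero: "sq_mod (int p) 0" unfolding sq_mod_def by (rule exI[of _ 0]) simp
      have "squares_mod (int p) = insert 0 {x \<in> {0..<int p}. P x}"
        using p3 zero by (auto simp: squares_mod_eq P_def dest: zdvd_imp_le)
      moreover have "0 \<notin> {x \<in> {0..<int p}. P x}" by (simp add: P_def)
      ultimately show ?thesis
        unfolding num_squares_def
        by (metis (no_types, lifting) card_insert_disjoint diff_Suc_1 finite_insert finite_squares_mod)
    qed
    ultimately have "p ^ i * (num_squares (int p) - 1) \<le> num_squares (int p ^ j)" by simp
    moreover have "p \<le> 8 * (num_squares (int p) - 1)"
      using num_squares_odd_prime[OF assms \<open>odd p\<close>] p3 by simp
    then have "p ^ i * p \<le> p ^ i * (8 * (num_squares (int p) - 1))" by (rule mult_le_mono2)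
    moreover have "p ^ i * (8 * (num_squares (int p) - 1)) = 8 * (p ^ i * (num_squares (int p) - 1))"
      by (rule mult.left_commute)
    moreover have "p ^ j = p ^ i * p" by (simp add: Suc)
    ultimately have "p ^ j \<le> 8 * num_squares (int p ^ j)" by linarith
    then have "int (p ^ j) \<le> int (8 * num_squares (int p ^ j))" by (simp only: of_nat_le_iff)
    then show ?thesis by simp
  qed
qed

lemma mean_spacing_bounds:
  assumes "prime p"
  shows "1 \<le> mean_spacing (int p ^ j)" "mean_spacing (int p ^ j) \<le> 8"
proof -
  have p0: "int p ^ j > 0" using prime_gt_0_nat[OF assms] by simp
  note N = num_squares_pos[OF p0] num_squares_le[OF p0] num_squares_prime_power_ge[OF assms, of j]
  have "real (num_squares (int p ^ j)) \<le> real_of_int (int p ^ j)" using N(2) by linarith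
  then show "1 \<le> mean_spacing (int p ^ j)" using N(1) by (simp add: mean_spacing_def field_simps)
  have "real_of_int (int p ^ j) \<le> 8 * real (num_squares (int p ^ j))" using N(3) by linarith
  then show "mean_spacing (int p ^ j) \<le> 8" using N(1) by (simp add: mean_spacing_def field_simps)
qed

lemma mean_spacing_ge_1: "q > 0 \<Longrightarrow> 1 \<le> mean_spacing q"
proof -
  assume q: "q > 0"
  then have "real (num_squares q) \<le> real_of_int q" using num_squares_le[OF q] by linarith
  then show ?thesis using num_squares_pos[OF q] by (simp add: mean_spacing_def field_simps)
qed

lemma num_squares_mult_coprime:
  "coprime q1 q2 \<Longrightarrow> q1 > 0 \<Longrightarrow> q2 > 0 \<Longrightarrow> num_squares (q1 * q2) = num_squares q1 * num_squares q2"
  by (simp add: num_squares_eq pattern_count_mult_coprime)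

text \<open>At p the spacing is 2 p / (p + 1), which is smallest for p = 3. Higher powers cannot
  lower it, because squares reduce to squares and so their number grows by a factor of at most
  p.\<close>

lemma mean_spacing_odd_prime_power_ge:
  assumes "prime p" "odd p"
  shows "3 / 2 \<le> mean_spacing (int p ^ Suc j)"
proof -
  have p0: "int p ^ j > 0" for j using prime_gt_0_nat[OF assms(1)] by simp
  have prime: "prime (int p)" using assms(1) by simp
  have p3: "p \<ge> 3" using assms prime_ge_2_nat[of p] by (cases "p = 2") auto
  have "3 * int (num_squares (int p ^ Suc j)) \<le> 2 * int p ^ Suc j"
  proof (induction j)
    case 0
    then show ?case using num_squares_odd_prime[OF assms] p3 by simp
  next
    case (Suc j)
    have "int (num_squares (int p ^ Suc (Suc j))) \<le> int p * int (num_squares (int p ^ Suc j))"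
      unfolding num_squares_eq[OF p0] by (rule pattern_count_prime_power_step(1)[OF prime]) simp
    also have "3 * \<dots> \<le> int p * (2 * int p ^ Suc j)" using Suc p3 by (simp add: mult_left_mono)
    finally show ?case by simp
  qed
  then have "3 * real (num_squares (int p ^ Suc j)) \<le> 2 * real_of_int (int p ^ Suc j)" by linarith
  then show ?thesis using num_squares_pos[OF p0[of "Suc j"]] by (simp add: mean_spacing_def field_simps)
qed

section \<open>The normalized density and its value at primes\<close>

definition norm_density :: "'a set \<Rightarrow> ('a \<Rightarrow> int) \<Rightarrow> int \<Rightarrow> real" where
  "norm_density I a q = mean_spacing q ^ card I * (real (pattern_count I a q) / real_of_int q)"

lemma residues_1: "{0..<1::int} = {0}"
  by auto

lemma norm_density_1: "norm_density I a 1 = 1"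
proof -
  have "squares_mod 1 = {0}" by (simp add: squares_mod_def residues_1)
  moreover have "{x \<in> {0..<1}. \<forall>k\<in>I. sq_mod 1 (x + a k)} = {0}" by (auto simp: sq_mod_def)
  ultimately show ?thesis
    by (simp add: norm_density_def mean_spacing_def num_squares_def pattern_count_def)
qed

lemma norm_density_nonneg: "q > 0 \<Longrightarrow> 0 \<le> norm_density I a q"
  by (simp add: norm_density_def mean_spacing_def)

lemma pattern_count_le: "q > 0 \<Longrightarrow> int (pattern_count I a q) \<le> q"
proof -
  assume "q > 0"
  have "pattern_count I a q \<le> card {0..<q}"
    unfolding pattern_count_def by (intro card_mono) auto
  then show ?thesis using \<open>q > 0\<close> by simp
qed

lemma mean_spacing_mult_coprime:
  "coprime q1 q2 \<Longrightarrow> q1 > 0 \<Longrightarrow> q2 > 0 \<Longrightarrow> mean_spacing (q1 * q2) = mean_spacing q1 * mean_spacing q2"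
  by (simp add: mean_spacing_def num_squares_mult_coprime)

lemma norm_density_mult_coprime:
  "coprime q1 q2 \<Longrightarrow> q1 > 0 \<Longrightarrow> q2 > 0 \<Longrightarrow>
    norm_density I a (q1 * q2) = norm_density I a q1 * norm_density I a q2"
  by (simp add: norm_density_def mean_spacing_mult_coprime pattern_count_mult_coprime power_mult_distrib)

lemma norm_density_prod_coprime:
  assumes "finite P" "\<And>p. p \<in> P \<Longrightarrow> f p > 0"
    and "\<And>p q. p \<in> P \<Longrightarrow> q \<in> P \<Longrightarrow> p \<noteq> q \<Longrightarrow> coprime (f p) (f q)"
  shows "norm_density I a (\<Prod>p\<in>P. f p) = (\<Prod>p\<in>P. norm_density I a (f p))"
    and "mean_spacing (\<Prod>p\<in>P. f p) = (\<Prod>p\<in>P. mean_spacing (f p))"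
  using assms
proof (induction P rule: finite_induct)
  case empty
  {
    case 1
    show ?case by (simp add: norm_density_1)
  next
    case 2
    show ?case by (simp add: mean_spacing_def num_squares_def squares_mod_def residues_1)
  }
next
  case (insert p P)
  have "coprime (f p) (\<Prod>p\<in>P. f p)" if "\<And>p' q. p' \<in> insert p P \<Longrightarrow> q \<in> insert p P \<Longrightarrow> p' \<noteq> q \<Longrightarrow> coprime (f p') (f q)"
    using that insert.hyps by (intro prod_coprime_right) auto
  moreover have "(\<Prod>p\<in>P. f p) > 0" if "\<And>q. q \<in> insert p P \<Longrightarrow> f q > 0"
    using that by (intro prod_pos) auto
  moreover {
    case 1
    with calculation insert show ?case by (simp add: norm_density_mult_coprime)
  next
    case 2
    with calculation insert show ?case by (simp add: mean_spacing_mult_coprime)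
  }
qed

lemma abs_power_diff_le:
  fixes x y M :: real
  assumes "0 \<le> x" "x \<le> M" "0 \<le> y" "y \<le> M" "M \<ge> 1"
  shows "\<bar>x ^ n - y ^ n\<bar> \<le> real n * M ^ n * \<bar>x - y\<bar>"
proof (induction n)
  case (Suc n)
  have "x ^ Suc n - y ^ Suc n = x * (x ^ n - y ^ n) + y ^ n * (x - y)" by (simp add: algebra_simps)
  then have "\<bar>x ^ Suc n - y ^ Suc n\<bar> \<le> x * \<bar>x ^ n - y ^ n\<bar> + y ^ n * \<bar>x - y\<bar>"
    using assms by (metis abs_mult abs_of_nonneg abs_triangle_ineq zero_le_power)
  also have "x * \<bar>x ^ n - y ^ n\<bar> \<le> M * (real n * M ^ n * \<bar>x - y\<bar>)"
    using assms Suc by (intro mult_mono) auto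
  also have "y ^ n * \<bar>x - y\<bar> \<le> M ^ Suc n * \<bar>x - y\<bar>"
  proof (intro mult_right_mono)
    have "y ^ n \<le> M ^ n" using assms by (intro power_mono) auto
    also have "\<dots> \<le> M ^ Suc n" using assms by (intro power_increasing) auto
    finally show "y ^ n \<le> M ^ Suc n" .
  qed simp
  finally show ?case by (simp add: algebra_simps)
qed simp

lemma sq_mod_legendre:
  assumes "Legendre x p \<noteq> 0"
  shows "(if sq_mod p x then 1 else 0) = (1 + real_of_int (Legendre x p)) / 2"
  using assms by (auto simp: Legendre_def QuadRes_def sq_mod_def)

text \<open>Away from the zeros of the symbols the indicator of a pattern is the product of (1 +
  Legendre) / 2. Expanding it gives p / 2^(card I) from the empty subset and character sums from the
  others. At the zeros, at most \<open>card I\<close> in number, the indicator and its model both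
  lie in [0, 1].\<close>

lemma pattern_count_prime_approx:
  fixes a :: "'a \<Rightarrow> int"
  assumes p: "prime p" "odd p" and I: "finite I"
    and distinct: "\<And>k l. k \<in> I \<Longrightarrow> l \<in> I \<Longrightarrow> k \<noteq> l \<Longrightarrow> \<not> int p dvd a k - a l"
  shows "\<bar>real (pattern_count I a (int p)) - p / 2 ^ card I\<bar> \<le> (card I + 3 * stepanov_const (card I)) * sqrt p"
proof -
  define X where "X = {0..<int p}"
  define L where "L k x = Legendre (x + a k) (int p)" for k x
  define ind where "ind x = (\<Prod>k\<in>I. if sq_mod (int p) (x + a k) then 1 else 0 :: real)" for x
  define lin where "lin x = (\<Prod>k\<in>I. (1 + real_of_int (L k x)) / 2)" for x
  define Z where "Z = {x \<in> X. \<exists>k\<in>I. L k x = 0}"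
  have p0: "p > 0" using p(1) by (rule prime_gt_0_nat)
  have finX: "finite X" by (simp add: X_def)
  have "real (pattern_count I a (int p)) = (\<Sum>x\<in>X. ind x)"
  proof -
    have "ind x = (if \<forall>k\<in>I. sq_mod (int p) (x + a k) then 1 else 0)" for x
      using I by (auto simp: ind_def intro!: prod.neutral)
    then show ?thesis
      using finX by (simp add: sum.If_cases Int_def pattern_count_def X_def)
  qed
  moreover have "\<bar>(\<Sum>x\<in>X. ind x) - (\<Sum>x\<in>X. lin x)\<bar> \<le> real (card Z)"
  proof -
    have "\<bar>ind x - lin x\<bar> \<le> (if x \<in> Z then 1 else 0)" if "x \<in> X" for x
    proof (cases "x \<in> Z")
      case True
      have "0 \<le> ind x \<and> ind x \<le> 1" unfolding ind_def by (auto intro!: prod_nonneg prod_le_1)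
      moreover have "0 \<le> (1 + real_of_int (L k x)) / 2 \<and> (1 + real_of_int (L k x)) / 2 \<le> 1" for k
        using legendre_values[of "x + a k" "int p"] by (auto simp: L_def)
      then have "0 \<le> lin x \<and> lin x \<le> 1" unfolding lin_def by (auto intro!: prod_nonneg prod_le_1)
      ultimately show ?thesis using True by auto
    next
      case False
      then have "ind x = lin x"
        unfolding ind_def lin_def L_def using that
        by (intro prod.cong refl sq_mod_legendre) (auto simp: Z_def L_def)
      then show ?thesis by simp
    qed
    then have "(\<Sum>x\<in>X. \<bar>ind x - lin x\<bar>) \<le> (\<Sum>x\<in>X. if x \<in> Z then 1 else 0)" by (rule sum_mono)
    also have "\<dots> = real (card (X \<inter> Z))" using finX by (simp add: sum.If_cases Int_def)
    also have "X \<inter> Z = Z" by (auto simp: Z_def)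
    finally show ?thesis
      using sum_abs[of "\<lambda>x. ind x - lin x" X] by (simp add: sum_subtractf)
  qed
  moreover have "card Z \<le> card I"
    unfolding Z_def X_def L_def by (rule card_legendre_zeros_le[OF I])
  moreover have "\<bar>(\<Sum>x\<in>X. lin x) - p / 2 ^ card I\<bar> \<le> 3 * stepanov_const (card I) * sqrt p"
  proof -
    have "lin x = (\<Sum>S\<in>Pow I. real_of_int (\<Prod>k\<in>S. L k x)) / 2 ^ card I" for x
    proof -
      have "lin x = (\<Prod>k\<in>I. real_of_int (L k x) + 1) / 2 ^ card I"
        by (simp add: lin_def prod_dividef add.commute)
      then show ?thesis using I by (simp add: prod_add)
    qed
    then have "(\<Sum>x\<in>X. lin x) = (\<Sum>x\<in>X. \<Sum>S\<in>Pow I. real_of_int (\<Prod>k\<in>S. L k x)) / 2 ^ card I"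
      by (simp add: sum_divide_distrib)
    also have "\<dots> = (\<Sum>S\<in>Pow I. real_of_int (\<Sum>x\<in>X. \<Prod>k\<in>S. L k x)) / 2 ^ card I"
      by (subst sum.swap) simp
    also have "\<dots> = (p + (\<Sum>S\<in>Pow I - {{}}. real_of_int (\<Sum>x\<in>X. \<Prod>k\<in>S. L k x))) / 2 ^ card I"
      using I by (subst sum.remove[of _ "{}"]) (auto simp: X_def)
    finally have eq: "(\<Sum>x\<in>X. lin x) - p / 2 ^ card I = (\<Sum>S\<in>Pow I - {{}}. real_of_int (\<Sum>x\<in>X. \<Prod>k\<in>S. L k x)) / 2 ^ card I"
      by (simp add: add_divide_distrib)
    have "\<bar>\<Sum>S\<in>Pow I - {{}}. real_of_int (\<Sum>x\<in>X. \<Prod>k\<in>S. L k x)\<bar> \<le> (\<Sum>S\<in>Pow I - {{}}. \<bar>real_of_int (\<Sum>x\<in>X. \<Prod>k\<in>S. L k x)\<bar>)"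
      by (rule sum_abs)
    also have "\<dots> \<le> (\<Sum>S\<in>Pow I - {{}}. 3 * stepanov_const (card I) * sqrt p)"
    proof (rule sum_mono)
      fix S assume S: "S \<in> Pow I - {{}}"
      then have "finite S" using I finite_subset by blast
      then have "\<bar>real_of_int (\<Sum>x\<in>X. \<Prod>k\<in>S. L k x)\<bar> \<le> 3 * stepanov_const (card S) * sqrt p"
        unfolding X_def L_def using S distinct by (intro legendre_sum_bound[OF p]) auto
      also have "\<dots> \<le> 3 * stepanov_const (card I) * sqrt p"
        using S I by (intro mult_right_mono mult_left_mono stepanov_const_mono card_mono) auto
      finally show "\<bar>real_of_int (\<Sum>x\<in>X. \<Prod>k\<in>S. L k x)\<bar> \<le> 3 * stepanov_const (card I) * sqrt p" .
    qed
    also have "\<dots> = real (card (Pow I - {{}})) * (3 * stepanov_const (card I) * sqrt p)" by simp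
    also have "\<dots> \<le> 2 ^ card I * (3 * stepanov_const (card I) * sqrt p)"
    proof (rule mult_right_mono)
      have "card (Pow I - {{}}) \<le> card (Pow I)" using I by (intro card_mono) auto
      then have "card (Pow I - {{}}) \<le> 2 ^ card I" using I by (simp add: card_Pow)
      then have "real (card (Pow I - {{}})) \<le> real (2 ^ card I)" by (simp only: of_nat_le_iff)
      then show "real (card (Pow I - {{}})) \<le> 2 ^ card I" by simp
    qed (simp add: stepanov_const_nonneg)
    finally show ?thesis unfolding eq by (simp add: field_simps)
  qed
  moreover have "real (card I) \<le> card I * sqrt p" using p0 by (simp add: mult_le_cancel_left1)
  ultimately show ?thesis by (simp add: distrib_right)
qed

section \<open>Increments of the density along the powers of a prime\<close>

lemma pattern_density_step:
  assumes p: "prime p" and K: "finite K"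
  shows "\<bar>real (pattern_count K b (int p ^ Suc j)) / real p ^ Suc j - real (pattern_count K b (int p ^ j)) / real p ^ j\<bar>
    \<le> 4 * real (card K) / real p ^ j"
proof -
  let ?n = "real (pattern_count K b (int p ^ j))" and ?n' = "real (pattern_count K b (int p ^ Suc j))"
  have prime: "prime (int p)" using p by simp
  have p0: "p > 0" using p by (rule prime_gt_0_nat)
  from pattern_count_prime_power_step[OF prime K, of b j]
  have "real_of_int (int (pattern_count K b (int p ^ Suc j))) \<le> real_of_int (int p * int (pattern_count K b (int p ^ j)))"
    "real_of_int (int p * int (pattern_count K b (int p ^ j)) - int (pattern_count K b (int p ^ Suc j))) \<le> real_of_int (4 * int (card K) * int p)"
    by (simp_all only: of_int_le_iff)
  then have 1: "?n' \<le> p * ?n" and 2: "p * ?n - ?n' \<le> 4 * real (card K) * p" by simp_all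
  have "?n' / real p ^ Suc j - ?n / real p ^ j = (?n' - p * ?n) / real p ^ Suc j"
    using p0 by (simp add: field_simps)
  also have "\<bar>\<dots>\<bar> = (p * ?n - ?n') / real p ^ Suc j" using 1 p0 by (simp add: abs_divide)
  also have "\<dots> \<le> 4 * real (card K) * p / real p ^ Suc j" using 2 p0 by (intro divide_right_mono) auto
  also have "\<dots> = 4 * real (card K) / real p ^ j" using p0 by simp
  finally show ?thesis .
qed

text \<open>The pattern density moves by O(p^(-j)) by the lifting count, and so does the spacing,
  being the reciprocal of the density of squares. As spacings are at most 8, the constant 260 is 4
  from the patterns plus 64 times 4 from the spacing.\<close>

lemma norm_density_step:
  fixes I :: "'a set"
  assumes p: "prime p" and I: "finite I"
  shows "\<bar>norm_density I a (int p ^ Suc j) - norm_density I a (int p ^ j)\<bar>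
    \<le> 260 * (real (card I) * 8 ^ card I) / real p ^ j"
proof -
  define r where "r = card I"
  define A where "A I a j = real (pattern_count I a (int p ^ j)) / real p ^ j" for I :: "'a set" and a j
  define \<rho> where "\<rho> j = real (num_squares (int p ^ j)) / real p ^ j" for j
  define s where "s j = mean_spacing (int p ^ j)" for j
  have prime: "prime (int p)" using p by simp
  have p0: "p > 0" using p by (rule prime_gt_0_nat)
  have q0: "int p ^ j > 0" for j using p0 by simp
  have s: "1 \<le> s j" "s j \<le> 8" for j unfolding s_def by (rule mean_spacing_bounds[OF p])+
  have s\<rho>: "s j * \<rho> j = 1" for j
    using num_squares_pos[OF q0[of j]] p0 by (simp add: s_def \<rho>_def mean_spacing_def)
  have A: "\<bar>A I a (Suc j) - A I a j\<bar> \<le> 4 * real r / real p ^ j"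
    unfolding A_def r_def by (rule pattern_density_step[OF p I])
  have "\<bar>\<rho> (Suc j) - \<rho> j\<bar> \<le> 4 / real p ^ j"
    using pattern_density_step[OF p, of "{()}" "\<lambda>_. 0" j] unfolding \<rho>_def num_squares_eq[OF q0] by simp
  moreover have "s (Suc j) - s j = s (Suc j) * s j * (\<rho> j - \<rho> (Suc j))"
    using s\<rho>[of j] s\<rho>[of "Suc j"] by (simp add: algebra_simps)
  then have "\<bar>s (Suc j) - s j\<bar> = s (Suc j) * s j * \<bar>\<rho> (Suc j) - \<rho> j\<bar>"
    using s[of j] s[of "Suc j"] by (simp add: abs_mult abs_minus_commute)
  moreover have "s (Suc j) * s j \<le> 8 * 8" using s[of j] s[of "Suc j"] by (intro mult_mono) auto
  ultimately have sd: "\<bar>s (Suc j) - s j\<bar> \<le> 64 * (4 / real p ^ j)"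
    by (metis abs_ge_zero mult_mono numeral_times_numeral semiring_norm(11) semiring_norm(12) semiring_norm(13) zero_le_numeral)
  have sr: "\<bar>s (Suc j) ^ r - s j ^ r\<bar> \<le> real r * 8 ^ r * (256 / real p ^ j)"
  proof -
    have "\<bar>s (Suc j) ^ r - s j ^ r\<bar> \<le> real r * 8 ^ r * \<bar>s (Suc j) - s j\<bar>"
      using s[of j] s[of "Suc j"] by (intro abs_power_diff_le) auto
    also have "\<dots> \<le> real r * 8 ^ r * (256 / real p ^ j)" using sd by (intro mult_left_mono) auto
    finally show ?thesis .
  qed
  have A1: "0 \<le> A I a j" "A I a j \<le> 1" for j
  proof -
    have "real_of_int (int (pattern_count I a (int p ^ j))) \<le> real_of_int (int p ^ j)"
      using pattern_count_le[OF q0[of j], of I a] by (simp only: of_int_le_iff)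
    then show "0 \<le> A I a j" "A I a j \<le> 1" using p0 by (simp_all add: A_def)
  qed
  have "norm_density I a (int p ^ Suc j) - norm_density I a (int p ^ j)
    = s (Suc j) ^ r * (A I a (Suc j) - A I a j) + (s (Suc j) ^ r - s j ^ r) * A I a j"
    by (simp add: norm_density_def s_def A_def r_def algebra_simps)
  also have "\<bar>\<dots>\<bar> \<le> s (Suc j) ^ r * \<bar>A I a (Suc j) - A I a j\<bar> + \<bar>s (Suc j) ^ r - s j ^ r\<bar> * A I a j"
    using A1(1)[of j] s(1)[of "Suc j"] by (intro order_trans[OF abs_triangle_ineq]) (simp add: abs_mult)
  also have "s (Suc j) ^ r * \<bar>A I a (Suc j) - A I a j\<bar> \<le> 8 ^ r * (4 * real r / real p ^ j)"
    using A s(1)[of "Suc j"] s(2)[of "Suc j"] by (intro mult_mono power_mono) auto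
  also have "\<bar>s (Suc j) ^ r - s j ^ r\<bar> * A I a j \<le> (real r * 8 ^ r * (256 / real p ^ j)) * 1"
    using sr A1[of j] by (intro mult_mono) auto
  finally show ?thesis by (simp add: r_def algebra_simps add_divide_distrib[symmetric])
qed

text \<open>For shifts distinct modulo p the pattern density is close to 2^(-card I), and the
  spacing 2 p / (p + 1) is within 2 / sqrt p of 2, so the main terms multiply to 1.\<close>

lemma norm_density_prime_approx:
  fixes a :: "'a \<Rightarrow> int"
  assumes p: "prime p" "odd p" and I: "finite I"
    and distinct: "\<And>k l. k \<in> I \<Longrightarrow> l \<in> I \<Longrightarrow> k \<noteq> l \<Longrightarrow> \<not> int p dvd a k - a l"
  shows "\<bar>norm_density I a (int p) - 1\<bar> \<le> 8 ^ card I * (3 * card I + 3 * stepanov_const (card I)) / sqrt p"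
proof -
  define r where "r = card I"
  define s where "s = mean_spacing (int p)"
  define A where "A = real (pattern_count I a (int p)) / p"
  define K where "K = real r + 3 * stepanov_const r"
  have p0: "p > 0" using p(1) by (rule prime_gt_0_nat)
  have s: "1 \<le> s" "s \<le> 8" unfolding s_def using mean_spacing_bounds[OF p(1), of 1] by simp_all
  have "\<bar>real (pattern_count I a (int p)) - p / 2 ^ r\<bar> \<le> K * sqrt p"
    unfolding K_def r_def by (rule pattern_count_prime_approx[OF p I distinct])
  then have "\<bar>real (pattern_count I a (int p)) - p / 2 ^ r\<bar> / p \<le> K * sqrt p / p"
    by (rule divide_right_mono) simp
  moreover have "\<bar>A - 1 / 2 ^ r\<bar> = \<bar>real (pattern_count I a (int p)) - p / 2 ^ r\<bar> / p"
  proof -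
    have "A - 1 / 2 ^ r = (real (pattern_count I a (int p)) - p / 2 ^ r) / p"
      using p0 by (simp add: A_def diff_divide_distrib)
    then show ?thesis by simp
  qed
  moreover have "sqrt p / p = 1 / sqrt p" using p0 by (simp add: real_div_sqrt field_simps)
  ultimately have A: "\<bar>A - 1 / 2 ^ r\<bar> \<le> K / sqrt p"
    by (metis times_divide_eq_right mult.right_neutral)
  have "real (2 * num_squares (int p)) = real (p + 1)"
    by (simp only: num_squares_odd_prime[OF p])
  then have N: "real (num_squares (int p)) = (real p + 1) / 2" by simp
  have "2 - s = 2 / (real p + 1)" unfolding s_def mean_spacing_def N by (simp add: field_simps)
  moreover have "2 / (real p + 1) \<le> 2 / sqrt p"
  proof (intro divide_left_mono)
    have "sqrt p \<le> p" using p0 by (intro real_le_lsqrt) (auto simp: power2_eq_square)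
    then show "sqrt p \<le> real p + 1" by simp
  qed (use p0 in \<open>auto intro!: mult_pos_pos\<close>)
  moreover have "2 / (real p + 1) \<ge> 0" by simp
  ultimately have sd: "\<bar>s - 2\<bar> \<le> 2 / sqrt p" by linarith
  have sr: "\<bar>s ^ r - 2 ^ r\<bar> \<le> real r * 8 ^ r * (2 / sqrt p)"
  proof -
    have "\<bar>s ^ r - 2 ^ r\<bar> \<le> real r * 8 ^ r * \<bar>s - 2\<bar>"
      using s by (intro abs_power_diff_le) auto
    also have "\<dots> \<le> real r * 8 ^ r * (2 / sqrt p)" using sd by (intro mult_left_mono) auto
    finally show ?thesis .
  qed
  have "norm_density I a (int p) - 1 = s ^ r * (A - 1 / 2 ^ r) + (s ^ r - 2 ^ r) * (1 / 2 ^ r)"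
    by (simp add: norm_density_def s_def A_def r_def algebra_simps)
  also have "\<bar>\<dots>\<bar> \<le> s ^ r * \<bar>A - 1 / 2 ^ r\<bar> + \<bar>s ^ r - 2 ^ r\<bar> * (1 / 2 ^ r)"
    using s by (intro order_trans[OF abs_triangle_ineq]) (simp add: abs_mult)
  also have "s ^ r * \<bar>A - 1 / 2 ^ r\<bar> \<le> 8 ^ r * (K / sqrt p)"
    using A s by (intro mult_mono power_mono) auto
  also have "\<bar>s ^ r - 2 ^ r\<bar> * (1 / 2 ^ r) \<le> (real r * 8 ^ r * (2 / sqrt p)) * 1"
    using sr by (intro mult_mono) auto
  finally show ?thesis by (simp add: r_def K_def algebra_simps add_divide_distrib)
qed

lemma norm_density_difference_bound:
  assumes I: "finite I"
  shows "\<exists>C\<ge>1. \<forall>p a j. prime p \<longrightarrow>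
    \<bar>norm_density I a (int p ^ Suc j) - norm_density I a (int p ^ j)\<bar> \<le>
      C * real p powr (- real (Suc j) / 2) *
      (if j = 0 \<and> (\<exists>k\<in>I. \<exists>l\<in>I. k \<noteq> l \<and> int p dvd a k - a l) then sqrt p else 1)"
proof -
  define C1 where "C1 = 260 * (real (card I) * 8 ^ card I)"
  define C2 where "C2 = 8 ^ card I * (3 * card I + 3 * stepanov_const (card I))"
  \<comment> \<open>The part 2 C1 absorbs sqrt 2 at p = 2, where character sums give nothing; C2
    serves odd primes with distinct shifts; the 1 secures C \<ge> 1.\<close>
  define C where "C = 1 + 2 * C1 + C2"
  have C1: "C1 \<ge> 0" and C2: "C2 \<ge> 0" by (simp_all add: C1_def C2_def stepanov_const_nonneg)
  have "\<bar>norm_density I a (int p ^ Suc j) - norm_density I a (int p ^ j)\<bar> \<le>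
      C * real p powr (- real (Suc j) / 2) *
      (if j = 0 \<and> (\<exists>k\<in>I. \<exists>l\<in>I. k \<noteq> l \<and> int p dvd a k - a l) then sqrt p else 1)"
    if p: "prime p" for p a j
  proof -
    have p1: "real p \<ge> 1" using prime_gt_0_nat[OF p] by simp
    have sq: "real p powr (- real (Suc 0) / 2) = 1 / sqrt p"
      using p1 by (simp add: powr_minus powr_half_sqrt field_simps)
    have step: "\<bar>norm_density I a (int p ^ Suc j) - norm_density I a (int p ^ j)\<bar> \<le> C1 / real p ^ j"
      unfolding C1_def by (rule norm_density_step[OF p I])
    consider "j > 0" | "j = 0" "\<exists>k\<in>I. \<exists>l\<in>I. k \<noteq> l \<and> int p dvd a k - a l"
      | "j = 0" "\<not> (\<exists>k\<in>I. \<exists>l\<in>I. k \<noteq> l \<and> int p dvd a k - a l)" "p = 2"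
      | "j = 0" "\<not> (\<exists>k\<in>I. \<exists>l\<in>I. k \<noteq> l \<and> int p dvd a k - a l)" "odd p"
      using p by (metis prime_odd_nat prime_ge_2_nat order_le_imp_less_or_eq gr0I)
    then show ?thesis
    proof cases
      case 1
      \<comment> \<open>For j \<ge> 1 the lifting bound p^(-j) is already at most p^(-(j+1)/2), even
        if shifts coincide modulo p.\<close>
      have "1 / real p ^ j = real p powr (- real j)"
        using p1 by (simp add: powr_minus powr_realpow field_simps)
      also have "\<dots> \<le> real p powr (- real (Suc j) / 2)"
        using p1 1 by (intro powr_mono) (auto simp: field_simps)
      finally have "C1 * (1 / real p ^ j) \<le> C * real p powr (- real (Suc j) / 2)"
        using C1 C2 p1 by (intro mult_mono) (auto simp: C_def)
      then show ?thesis using step 1 by simp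
    next
      case 2
      have "C1 \<le> C * (1 / sqrt p) * sqrt p" using p1 C1 C2 by (simp add: C_def)
      then show ?thesis using step 2 sq by simp
    next
      case 3
      have "C1 * sqrt 2 \<le> C1 * 2" using C1 by (intro mult_left_mono real_le_lsqrt) auto
      also have "\<dots> \<le> C" using C2 C1 by (simp add: C_def)
      finally have "C1 \<le> C * (1 / sqrt p)" using 3 by (simp add: field_simps)
      moreover have "C1 \<le> C" using C1 C2 by (simp add: C_def)
      ultimately show ?thesis using step 3 sq by auto
    next
      case 4
      have "\<bar>norm_density I a (int p) - 1\<bar> \<le> C2 / sqrt p"
        unfolding C2_def using 4 by (intro norm_density_prime_approx p I) auto
      also have "\<dots> \<le> C * (1 / sqrt p)" using C1 p1 by (simp add: C_def divide_right_mono)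
      finally show ?thesis using 4 sq by (auto simp: norm_density_1)
    qed
  qed
  moreover have "C \<ge> 1" using C1 C2 by (simp add: C_def)
  ultimately show ?thesis by blast
qed

section \<open>Lattice points in dilated convex bodies\<close>

definition rvec :: "int ^ 'n \<Rightarrow> real ^ 'n" where
  "rvec h = (\<chi> i. of_int (h $ i))"

lemma rvec_nth [simp]: "rvec h $ i = of_int (h $ i)"
  by (simp add: rvec_def)

section \<open>Integer points in boxes and on hyperplanes\<close>

lemma card_int_interval_le:
  fixes u w :: real
  assumes "w \<ge> 0"
  shows "finite {k::int. u \<le> k \<and> k \<le> u + w}" "real (card {k::int. u \<le> k \<and> k \<le> u + w}) \<le> w + 1"
proof -
  have eq: "{k::int. u \<le> k \<and> k \<le> u + w} = {\<lceil>u\<rceil>..\<lfloor>u + w\<rfloor>}"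
    by (auto simp: ceiling_le_iff le_floor_iff)
  show "finite {k::int. u \<le> k \<and> k \<le> u + w}" unfolding eq by simp
  show "real (card {k::int. u \<le> k \<and> k \<le> u + w}) \<le> w + 1"
    unfolding eq using assms by (simp add: of_nat_nat) linarith
qed

lemma finite_lattice_box:
  fixes F :: "(int ^ 'n::finite) set"
  assumes "\<And>m i. m \<in> F \<Longrightarrow> u i \<le> real_of_int (m $ i) \<and> real_of_int (m $ i) \<le> u i + w" "w \<ge> 0"
  shows "finite F"
proof -
  have "(\<lambda>m. \<lambda>i\<in>UNIV. m $ i) ` F \<subseteq> (\<Pi>\<^sub>E i\<in>UNIV. {k. u i \<le> real_of_int k \<and> real_of_int k \<le> u i + w})"
    using assms(1) by auto
  then have "finite ((\<lambda>m. \<lambda>i\<in>UNIV. m $ i) ` F)"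
    by (rule finite_subset) (intro finite_PiE card_int_interval_le assms(2), simp)
  moreover have "inj_on (\<lambda>m. \<lambda>i\<in>UNIV. m $ i) F"
    by (rule inj_onI) (simp add: vec_eq_iff restrict_def fun_eq_iff)
  ultimately show ?thesis by (rule finite_imageD)
qed

text \<open>A coordinate with nonzero coefficient is determined by the others, which saves one
  factor w + 1. This serves bodies without interior as well as the fibres of shift
  differences.\<close>

lemma card_lattice_hyperplane_le:
  fixes F :: "(int ^ 'n::finite) set" and a :: "real ^ 'n"
  assumes box: "\<And>m i. m \<in> F \<Longrightarrow> u i \<le> real_of_int (m $ i) \<and> real_of_int (m $ i) \<le> u i + w" and w: "w \<ge> 0"
    and hyp: "\<And>m. m \<in> F \<Longrightarrow> a \<bullet> rvec m = b" and a: "a $ i0 \<noteq> 0"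
  shows "real (card F) \<le> (w + 1) ^ (CARD('n) - 1)"
proof -
  define J where "J i = {k::int. u i \<le> real_of_int k \<and> real_of_int k \<le> u i + w}" for i
  define f where "f m = (\<lambda>i\<in>UNIV - {i0}. m $ i)" for m :: "int ^ 'n"
  have J: "finite (J i)" "real (card (J i)) \<le> w + 1" for i
    unfolding J_def by (rule card_int_interval_le[OF w])+
  have "inj_on f F"
  proof (rule inj_onI)
    fix m m' assume m: "m \<in> F" "m' \<in> F" "f m = f m'"
    have eq: "m $ i = m' $ i" if "i \<noteq> i0" for i
      using fun_cong[OF m(3), of i] that by (simp add: f_def)
    have "a \<bullet> rvec m = a $ i0 * m $ i0 + (\<Sum>i\<in>UNIV - {i0}. a $ i * m $ i)" for m
      by (simp add: inner_vec_def) (subst sum.remove[of UNIV i0], auto)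
    moreover have "(\<Sum>i\<in>UNIV - {i0}. a $ i * m $ i) = (\<Sum>i\<in>UNIV - {i0}. a $ i * m' $ i)"
      using eq by (intro sum.cong) auto
    ultimately have "a $ i0 * m $ i0 = a $ i0 * m' $ i0"
      using hyp[OF m(1)] hyp[OF m(2)] by (metis add_right_cancel)
    then have "m $ i0 = m' $ i0" using a by simp
    with eq show "m = m'" by (metis vec_eq_iff)
  qed
  then have "card F = card (f ` F)" by (simp add: card_image)
  also have "\<dots> \<le> card (\<Pi>\<^sub>E i\<in>UNIV - {i0}. J i)"
    using box J(1) by (intro card_mono finite_PiE) (auto simp: f_def J_def)
  also have "\<dots> = (\<Prod>i\<in>UNIV - {i0}. card (J i))" by (simp add: card_PiE)
  finally have "real (card F) \<le> (\<Prod>i\<in>UNIV - {i0}. real (card (J i)))"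
    by (metis of_nat_mono of_nat_prod)
  also have "\<dots> \<le> (\<Prod>i\<in>UNIV - {i0}. w + 1)" using J by (intro prod_mono) auto
  finally show ?thesis by (simp add: card_Diff_singleton)
qed

text \<open>The inner ball absorbs the error e: y + e is the image, under dilation by 1 + \<kappa>
  about c, of the convex combination of y and c + e / \<kappa> with weights proportional to 1 and
  \<kappa>.\<close>

lemma dilation_contains_perturbation:
  fixes D :: "'a::real_normed_vector set"
  assumes "convex D" "ball c R \<subseteq> D" "y \<in> D" "0 < \<kappa>" "norm e < \<kappa> * R"
  shows "y + e \<in> (\<lambda>x. (1 + \<kappa>) *\<^sub>R x + (- \<kappa>) *\<^sub>R c) ` D"
proof -
  have "norm (e /\<^sub>R \<kappa>) < R" using assms by (simp add: field_simps)
  then have "c + e /\<^sub>R \<kappa> \<in> D" using assms(2) by (auto simp: dist_norm)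
  then have "(1 / (1 + \<kappa>)) *\<^sub>R y + (\<kappa> / (1 + \<kappa>)) *\<^sub>R (c + e /\<^sub>R \<kappa>) \<in> D"
    using assms by (intro convexD[OF assms(1)]) (auto simp: field_simps)
  moreover have "y + e = (1 + \<kappa>) *\<^sub>R ((1 / (1 + \<kappa>)) *\<^sub>R y + (\<kappa> / (1 + \<kappa>)) *\<^sub>R (c + e /\<^sub>R \<kappa>)) + (- \<kappa>) *\<^sub>R c"
  proof -
    have *: "(1 + \<kappa>) * (1 / (1 + \<kappa>)) = 1" "(1 + \<kappa>) * (\<kappa> / (1 + \<kappa>)) = \<kappa>"
      "(1 + \<kappa>) * (\<kappa> / (1 + \<kappa>) * inverse \<kappa>) = 1"
      using assms(4) by auto
    show ?thesis unfolding scaleR_right_distrib scaleR_scaleR * by simp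
  qed
  ultimately show ?thesis by (rule rev_image_eqI)
qed

lemma contraction_perturbation:
  fixes D :: "'a::real_normed_vector set"
  assumes "convex D" "ball c R \<subseteq> D" "z \<in> (\<lambda>x. (1 - \<kappa>) *\<^sub>R x + \<kappa> *\<^sub>R c) ` D" "0 < \<kappa>" "\<kappa> \<le> 1" "norm e < \<kappa> * R"
  shows "z + e \<in> D"
proof -
  obtain y where y: "y \<in> D" "z = (1 - \<kappa>) *\<^sub>R y + \<kappa> *\<^sub>R c" using assms(3) by blast
  have "norm (e /\<^sub>R \<kappa>) < R" using assms by (simp add: field_simps)
  then have "c + e /\<^sub>R \<kappa> \<in> D" using assms(2) by (auto simp: dist_norm)
  then have "(1 - \<kappa>) *\<^sub>R y + \<kappa> *\<^sub>R (c + e /\<^sub>R \<kappa>) \<in> D"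
    using assms y by (intro convexD[OF assms(1)]) auto
  moreover have "(1 - \<kappa>) *\<^sub>R y + \<kappa> *\<^sub>R (c + e /\<^sub>R \<kappa>) = z + e"
    using y assms(4) by (simp add: scaleR_right_distrib)
  ultimately show ?thesis by simp
qed

section \<open>Comparing lattice points with unit cubes\<close>

lemma measure_unit_cbox:
  fixes a :: "real ^ 'n::finite"
  shows "measure lebesgue (cbox a (a + 1)) = 1"
proof -
  have "cbox a (a + 1) \<noteq> {}" using mem_box_cart(2)[of a a "a + 1"] by auto
  then have "measure lborel (cbox a (a + 1)) = (\<Prod>i\<in>UNIV. (a + 1) $ i - a $ i)"
    by (rule content_cbox_cart)
  then show ?thesis by simp
qed

lemma measure_unit_box:
  fixes a :: "real ^ 'n::finite"
  shows "measure lebesgue (box a (a + 1)) = 1"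
proof -
  have "measure lborel (box a (a + 1)) = measure lborel (cbox a (a + 1))"
    by (simp add: measure_lborel_box_eq measure_lborel_cbox_eq)
  then show ?thesis using measure_unit_cbox[of a] by simp
qed

lemma norm_le_card_cart:
  fixes x :: "real ^ 'n::finite"
  assumes "\<And>i. \<bar>x $ i\<bar> \<le> 1"
  shows "norm x \<le> real CARD('n)"
proof -
  have "norm x \<le> (\<Sum>i\<in>UNIV. \<bar>x $ i\<bar>)" by (rule norm_le_l1_cart)
  also have "\<dots> \<le> (\<Sum>i\<in>(UNIV :: 'n set). 1)" using assms by (intro sum_mono) auto
  finally show ?thesis by simp
qed

text \<open>The open unit cubes at the lattice points of D are disjoint and stay inside the dilate
  by 1 + \<kappa> about c; the closed ones cover the dilate by 1 - \<kappa>. Points of a cube are at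
  most \<open>CARD('n)\<close> from its corner, an error that the ball of radius R absorbs.\<close>

lemma lattice_count_between_dilations:
  fixes D :: "(real ^ 'n::finite) set"
  assumes D: "convex D" "bounded D" "ball c R \<subseteq> D" and fin: "finite {m. rvec m \<in> D}"
    and \<kappa>: "0 < \<kappa>" "real CARD('n) < \<kappa> * R"
  shows "real (card {m. rvec m \<in> D}) \<le> (1 + \<kappa>) ^ CARD('n) * measure lebesgue D"
    and "\<kappa> \<le> 1 \<Longrightarrow> (1 - \<kappa>) ^ CARD('n) * measure lebesgue D \<le> real (card {m. rvec m \<in> D})"
proof -
  let ?F = "{m. rvec m \<in> D}" 
  have Dm: "(\<lambda>x. s *\<^sub>R x + w) ` D \<in> lmeasurable" for s w
  proof (rule measurable_convex)
    have "convex ((\<lambda>x. w + x) ` ((\<lambda>x. s *\<^sub>R x) ` D))"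
      using D(1) by (intro convex_translation convex_scaling)
    then show "convex ((\<lambda>x. s *\<^sub>R x + w) ` D)" by (simp add: image_image add.commute)
    have "bounded ((\<lambda>x. w + x) ` ((\<lambda>x. s *\<^sub>R x) ` D))"
      using D(2) by (intro bounded_translation bounded_scaling)
    then show "bounded ((\<lambda>x. s *\<^sub>R x + w) ` D)" by (simp add: image_image add.commute)
  qed
  have "real (card ?F) = (\<Sum>m\<in>?F. measure lebesgue (box (rvec m) (rvec m + 1)))"
    by (simp add: measure_unit_box del: measure_completion)
  also have "\<dots> = measure lebesgue (\<Union>m\<in>?F. box (rvec m) (rvec m + 1))"
  proof (rule measure_UNION'[symmetric, OF fin])
    show "pairwise (\<lambda>i j. disjnt (box (rvec i) (rvec i + 1)) (box (rvec j) (rvec j + 1))) ?F"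
    proof (rule pairwiseI)
      fix m m' :: "int ^ 'n" assume "m \<noteq> m'"
      then obtain i where i: "m $ i \<noteq> m' $ i" by (metis vec_eq_iff)
      have False if "x \<in> box (rvec m) (rvec m + 1)" "x \<in> box (rvec m') (rvec m' + 1)" for x
      proof -
        have "real_of_int (m $ i) < x $ i" "x $ i < real_of_int (m $ i) + 1"
          "real_of_int (m' $ i) < x $ i" "x $ i < real_of_int (m' $ i) + 1"
          using that by (auto simp: mem_box_cart)
        with i show False by linarith
      qed
      then show "disjnt (box (rvec m) (rvec m + 1)) (box (rvec m') (rvec m' + 1))"
        by (auto simp: disjnt_iff)
    qed
  qed simp
  also have "\<dots> \<le> measure lebesgue ((\<lambda>x. (1 + \<kappa>) *\<^sub>R x + (- \<kappa>) *\<^sub>R c) ` D)"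
  proof (rule measure_mono_fmeasurable[OF _ _ Dm])
    show "(\<Union>m\<in>?F. box (rvec m) (rvec m + 1)) \<subseteq> (\<lambda>x. (1 + \<kappa>) *\<^sub>R x + (- \<kappa>) *\<^sub>R c) ` D"
    proof
      fix x assume "x \<in> (\<Union>m\<in>?F. box (rvec m) (rvec m + 1))"
      then obtain m where m: "rvec m \<in> D" "x \<in> box (rvec m) (rvec m + 1)" by blast
      have "norm (x - rvec m) \<le> real CARD('n)"
      proof (rule norm_le_card_cart)
        fix i
        have "real_of_int (m $ i) < x $ i" "x $ i < real_of_int (m $ i) + 1"
          using m(2) by (auto simp: mem_box_cart)
        then show "\<bar>(x - rvec m) $ i\<bar> \<le> 1" by simp
      qed
      then have "norm (x - rvec m) < \<kappa> * R" using \<kappa>(2) by simp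
      from dilation_contains_perturbation[OF D(1,3) m(1) \<kappa>(1) this]
      show "x \<in> (\<lambda>x. (1 + \<kappa>) *\<^sub>R x + (- \<kappa>) *\<^sub>R c) ` D" by simp
    qed
    show "(\<Union>m\<in>?F. box (rvec m) (rvec m + 1)) \<in> sets lebesgue"
      by (intro sets.finite_UN fin) auto
  qed
  also have "\<dots> = (1 + \<kappa>) ^ CARD('n) * measure lebesgue D"
    using \<kappa>(1) by (subst measure_lebesgue_affine) simp
  finally show "real (card ?F) \<le> (1 + \<kappa>) ^ CARD('n) * measure lebesgue D" .
  assume \<kappa>1: "\<kappa> \<le> 1"
  have "(1 - \<kappa>) ^ CARD('n) * measure lebesgue D = measure lebesgue ((\<lambda>x. (1 - \<kappa>) *\<^sub>R x + \<kappa> *\<^sub>R c) ` D)"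
    using \<kappa>1 by (subst measure_lebesgue_affine) simp
  also have "\<dots> \<le> measure lebesgue (\<Union>m\<in>?F. cbox (rvec m) (rvec m + 1))"
  proof (rule measure_mono_fmeasurable)
    show "(\<Union>m\<in>?F. cbox (rvec m) (rvec m + 1)) \<in> lmeasurable"
      using fin by (intro fmeasurable.finite_UN) auto
    show "(\<lambda>x. (1 - \<kappa>) *\<^sub>R x + \<kappa> *\<^sub>R c) ` D \<in> sets lebesgue" using Dm by (simp add: fmeasurableD)
    show "(\<lambda>x. (1 - \<kappa>) *\<^sub>R x + \<kappa> *\<^sub>R c) ` D \<subseteq> (\<Union>m\<in>?F. cbox (rvec m) (rvec m + 1))"
    proof
      fix z assume z: "z \<in> (\<lambda>x. (1 - \<kappa>) *\<^sub>R x + \<kappa> *\<^sub>R c) ` D"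
      define m where "m = (\<chi> i. \<lfloor>z $ i\<rfloor>)"
      have b: "of_int \<lfloor>z $ i\<rfloor> \<le> z $ i" "z $ i \<le> of_int \<lfloor>z $ i\<rfloor> + 1" for i by linarith+
      have "norm (rvec m - z) \<le> real CARD('n)"
      proof (rule norm_le_card_cart)
        fix i
        have "(rvec m - z) $ i = of_int \<lfloor>z $ i\<rfloor> - z $ i" by (simp add: m_def)
        then show "\<bar>(rvec m - z) $ i\<bar> \<le> 1" using b[of i] by linarith
      qed
      then have "norm (rvec m - z) < \<kappa> * R" using \<kappa>(2) by simp
      from contraction_perturbation[OF D(1,3) z \<kappa>(1) \<kappa>1 this] have "m \<in> ?F" by simp
      moreover have "z \<in> cbox (rvec m) (rvec m + 1)" using b by (auto simp: mem_box_cart m_def)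
      ultimately show "z \<in> (\<Union>m\<in>?F. cbox (rvec m) (rvec m + 1))" by blast
    qed
  qed
  also have "\<dots> \<le> (\<Sum>m\<in>?F. measure lebesgue (cbox (rvec m) (rvec m + 1)))"
    by (rule measure_UNION_le[OF fin]) auto
  also have "\<dots> = real (card ?F)" by (simp add: measure_unit_cbox del: measure_completion)
  finally show "(1 - \<kappa>) ^ CARD('n) * measure lebesgue D \<le> real (card ?F)" .
qed

text \<open>Uniformity in v matters, because every residue class of h will produce a translation of
  its own. A body with empty interior lies in a hyperplane, so its volume is 0 and its lattice
  points are of lower order. Otherwise cubes are compared with \<kappa> of order 1 / t.\<close>

lemma lattice_points_convex:
  fixes C :: "(real ^ 'n::finite) set"
  assumes C: "bounded C" "convex C"
  shows "\<exists>K\<ge>0. \<forall>t\<ge>1. \<forall>v. finite {m. rvec m \<in> (\<lambda>x. t *\<^sub>R x + v) ` C} \<and>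
    \<bar>real (card {m. rvec m \<in> (\<lambda>x. t *\<^sub>R x + v) ` C}) - t ^ CARD('n) * measure lebesgue C\<bar> \<le> K * t ^ (CARD('n) - 1)"
proof -
  define n where "n = CARD('n)"
  have n1: "n \<ge> 1" by (simp add: n_def Suc_le_eq)
  obtain R where R: "R > 0" "\<And>x. x \<in> C \<Longrightarrow> norm x \<le> R" using C(1) bounded_pos by blast
  define F where "F t v = {m. rvec m \<in> (\<lambda>x. t *\<^sub>R x + v) ` C}" for t :: real and v
  have box: "v $ i - t * R \<le> real_of_int (m $ i) \<and> real_of_int (m $ i) \<le> (v $ i - t * R) + 2 * t * R"
    if m: "m \<in> F t v" and t: "t \<ge> 1" for m i t v
  proof -
    obtain x where x: "x \<in> C" "rvec m = t *\<^sub>R x + v" using m by (auto simp: F_def)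
    have "\<bar>x $ i\<bar> \<le> R" using component_le_norm_cart[of x i] R(2)[OF x(1)] by linarith
    then have "t * \<bar>x $ i\<bar> \<le> t * R" using t by (intro mult_left_mono) auto
    then have "\<bar>t * x $ i\<bar> \<le> t * R" using t by (simp add: abs_mult)
    moreover have "real_of_int (m $ i) = t * x $ i + v $ i"
      using arg_cong[OF x(2), of "\<lambda>y. y $ i"] by simp
    ultimately show ?thesis by linarith
  qed
  have fin: "finite (F t v)" if "t \<ge> 1" for t v
    using finite_lattice_box[OF box[OF _ that]] that R(1) by simp
  show ?thesis
  proof (cases "interior C = {}")
    case True
    obtain a b where ab: "a \<noteq> 0" "C \<subseteq> {x. a \<bullet> x = b}"
      using empty_interior_subset_hyperplane[OF C(2) True] by blast
    have "negligible C" using ab negligible_hyperplane[of a b] negligible_subset by blast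
    then have vol: "measure lebesgue C = 0" by (rule negligible_imp_measure0)
    obtain i0 where i0: "a $ i0 \<noteq> 0" using ab(1) by (metis vec_eq_iff zero_index)
    have "\<bar>real (card (F t v)) - t ^ n * measure lebesgue C\<bar> \<le> (2 * R + 1) ^ (n - 1) * t ^ (n - 1)"
      if t: "t \<ge> 1" for t v
    proof -
      have "real (card (F t v)) \<le> (2 * t * R + 1) ^ (n - 1)"
        unfolding n_def
      proof (rule card_lattice_hyperplane_le[OF box[OF _ t] _ _ i0])
        show "a \<bullet> rvec m = t * b + a \<bullet> v" if "m \<in> F t v" for m
          using that ab(2) by (auto simp: F_def inner_add_right)
      qed (use t R in auto)
      also have "\<dots> \<le> ((2 * R + 1) * t) ^ (n - 1)"
        using t R by (intro power_mono) (auto simp: algebra_simps)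
      finally show ?thesis by (simp add: vol power_mult_distrib)
    qed
    then show ?thesis using fin R(1) unfolding F_def n_def
      by (intro exI[of _ "(2 * R + 1) ^ (CARD('n) - 1)"]) auto
  next
    case False
    then obtain x0 \<rho> where x0: "\<rho> > 0" "ball x0 \<rho> \<subseteq> C"
      by (metis all_not_in_conv mem_interior)
    define V where "V = measure lebesgue C"
    \<comment> \<open>With \<kappa> = \<Lambda> / t and the inner radius \<rho> t the product is n +
      1, just above the bound n for the size of a cube.\<close>
    define \<Lambda> where "\<Lambda> = (real n + 1) / \<rho>"
    define K where "K = real n * (1 + \<Lambda>) ^ n * \<Lambda> * V"
    have \<Lambda>: "\<Lambda> > 0" using x0(1) by (simp add: \<Lambda>_def)
    have V: "V \<ge> 0" by (simp add: V_def)
    have "\<bar>real (card (F t v)) - t ^ n * V\<bar> \<le> K * t ^ (n - 1)" if t: "t \<ge> 1" for t v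
    proof -
      define D where "D = (\<lambda>x. t *\<^sub>R x + v) ` C"
      define c where "c = t *\<^sub>R x0 + v"
      define \<kappa> where "\<kappa> = \<Lambda> / t"
      have FD: "F t v = {m. rvec m \<in> D}" by (simp add: F_def D_def)
      have \<kappa>: "0 < \<kappa>" "\<kappa> \<le> \<Lambda>" using \<Lambda> t by (simp_all add: \<kappa>_def divide_le_eq mult_le_cancel_left1)
      have D1: "convex D"
        using convex_translation[OF convex_scaling[OF C(2), of t], of v]
        by (simp add: D_def image_image add.commute)
      have D2: "bounded D"
        using bounded_translation[OF bounded_scaling[OF C(1), of t], of v]
        by (simp add: D_def image_image add.commute)
      have D3: "ball c (\<rho> * t) \<subseteq> D"
      proof
        fix y assume y: "y \<in> ball c (\<rho> * t)"
        define x where "x = (y - v) /\<^sub>R t"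
        have yx: "y = t *\<^sub>R x + v" using t by (simp add: x_def)
        have "t *\<^sub>R (x0 - x) = c - y" unfolding c_def yx by (simp add: scaleR_diff_right)
        then have "t * norm (x0 - x) = norm (c - y)" using t by (metis norm_scaleR abs_of_nonneg order_trans zero_le_one)
        also have "\<dots> < \<rho> * t" using y by (simp add: dist_norm)
        finally have "norm (x0 - x) < \<rho>" using t by (simp add: mult.commute)
        then have "x \<in> C" using x0(2) by (auto simp: dist_norm)
        then show "y \<in> D" using yx by (auto simp: D_def)
      qed
      have \<kappa>R: "real CARD('n) < \<kappa> * (\<rho> * t)"
        using t x0(1) by (simp add: \<kappa>_def \<Lambda>_def n_def)
      have vol: "measure lebesgue D = t ^ n * V"
        using t unfolding D_def V_def by (subst measure_lebesgue_affine) (simp add: n_def)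
      note cnt = lattice_count_between_dilations[OF D1 D2 D3 fin[OF t, of v, unfolded FD] \<kappa>(1) \<kappa>R, folded FD n_def, unfolded vol]
      have tV: "0 \<le> t ^ n * V" using t V by simp
      have "(1 + \<kappa>) ^ n - 1 ^ n \<le> real n * (1 + \<Lambda>) ^ n * \<kappa>"
        using abs_power_diff_le[of "1 + \<kappa>" "1 + \<Lambda>" 1 n] \<kappa> \<Lambda> by simp
      then have up: "(1 + \<kappa>) ^ n * (t ^ n * V) \<le> (1 + real n * (1 + \<Lambda>) ^ n * \<kappa>) * (t ^ n * V)"
        using tV by (intro mult_right_mono) auto
      have lo: "(1 - real n * (1 + \<Lambda>) ^ n * \<kappa>) * (t ^ n * V) \<le> real (card (F t v))"
      proof (cases "\<kappa> \<le> 1")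
        case True
        have "1 - (1 - \<kappa>) ^ n \<le> real n * \<kappa>"
          using abs_power_diff_le[of 1 1 "1 - \<kappa>" n] \<kappa>(1) True by simp
        also have "\<dots> \<le> real n * (1 + \<Lambda>) ^ n * \<kappa>"
          using \<Lambda> \<kappa>(1) by (intro mult_right_mono) (auto simp: mult_le_cancel_left1)
        finally have "(1 - real n * (1 + \<Lambda>) ^ n * \<kappa>) * (t ^ n * V) \<le> (1 - \<kappa>) ^ n * (t ^ n * V)"
          using tV by (intro mult_right_mono) auto
        then show ?thesis using cnt(2)[OF True] by linarith
      next
        case False
        \<comment> \<open>For \<kappa> > 1 there is no smaller dilate, but the claimed lower bound
          is then not positive.\<close>
        have "1 * 1 * 1 \<le> real n * (1 + \<Lambda>) ^ n * \<kappa>"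
          using False n1 \<Lambda> by (intro mult_mono) auto
        then have "(1 - real n * (1 + \<Lambda>) ^ n * \<kappa>) * (t ^ n * V) \<le> 0"
          using tV by (intro mult_nonpos_nonneg) auto
        then show ?thesis by linarith
      qed
      have "real n * (1 + \<Lambda>) ^ n * \<kappa> * (t ^ n * V) = K * t ^ (n - 1)"
        using t n1 by (cases n) (simp_all add: K_def \<kappa>_def)
      then show ?thesis using up lo cnt(1) by (simp add: algebra_simps abs_le_iff)
    qed
    moreover have "K \<ge> 0" using V \<Lambda> by (simp add: K_def)
    ultimately show ?thesis using fin unfolding F_def n_def V_def by blast
  qed
qed

section \<open>Averages of the normalized density\<close>

text \<open>The offset of the k-th entry of a tuple from its first entry, if h is the vector of
  consecutive differences.\<close>

definition shift :: "int ^ 'n::{finite,linorder} \<Rightarrow> nat \<Rightarrow> int" where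
  "shift h k = (\<Sum>i | pos i < k. h $ i)"

section \<open>Tuples of squares as patterns of shifts\<close>

lemma inj_pos: "inj (pos :: 'n::{finite,linorder} \<Rightarrow> nat)"
  using bij_betw_pos[where 'n = 'n] by (simp add: bij_betw_def)

lemma pos_range: "pos (i :: 'n::{finite,linorder}) \<in> {1..CARD('n)}"
  using bij_betw_pos[where 'n = 'n] unfolding bij_betw_def by blast

lemma ex_pos:
  assumes "k \<in> {1..CARD('n::{finite,linorder})}"
  shows "\<exists>i::'n. pos i = k"
  using assms bij_betw_pos[where 'n = 'n] unfolding bij_betw_def by (metis imageE)

lemma shift_1 [simp]: "shift h (Suc 0) = 0"
proof -
  have "\<not> pos (i :: 'a) < Suc 0" for i using pos_range[of i] by simp
  then have "{i :: 'a. pos i < Suc 0} = {}" by blast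
  then show ?thesis unfolding shift_def by (simp only: sum.empty)
qed

lemma shift_Suc_pos: "shift h (Suc (pos i)) = shift h (pos i) + h $ i"
proof -
  have "{j. pos j < Suc (pos i)} = insert i {j. pos j < pos i}"
    using injD[OF inj_pos] by (auto simp: less_Suc_eq)
  then show ?thesis by (simp add: shift_def)
qed

text \<open>Given h, a tuple is determined by its first entry x: the k-th entry has to be the
  residue of \<open>x + shift h k\<close>.\<close>

lemma tuple_count_eq_pattern_count:
  fixes h :: "int ^ 'n::{finite,linorder}"
  assumes Q: "Q > 0"
  shows "tuple_count h Q = pattern_count {1..CARD('n) + 1} (shift h) Q"
proof -
  let ?I = "{1..CARD('n) + 1}"
  let ?S = "{\<sigma> \<in> ?I \<rightarrow>\<^sub>E squares_mod Q. \<forall>i. [\<sigma> (pos i + 1) - \<sigma> (pos i) = h $ i] (mod Q)}"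
  let ?X = "{x \<in> {0..<Q}. \<forall>k\<in>?I. sq_mod Q (x + shift h k)}"
  define g where "g x = (\<lambda>k\<in>?I. (x + shift h k) mod Q)" for x
  have sq: "y mod Q \<in> squares_mod Q \<longleftrightarrow> sq_mod Q y" for y
  proof -
    have "sq_mod Q (y mod Q) \<longleftrightarrow> sq_mod Q y" by (rule sq_mod_cong) simp
    then show ?thesis using Q by (simp add: squares_mod_eq)
  qed
  have bij: "bij_betw (\<lambda>\<sigma>. \<sigma> 1) ?S ?X"
  proof (rule bij_betw_byWitness[where f' = g])
    have \<sigma>: "\<sigma> k = (\<sigma> 1 + shift h k) mod Q" if S: "\<sigma> \<in> ?S" and k: "k \<in> ?I" for \<sigma> k
    proof -
      have range: "\<sigma> j \<in> {0..<Q}" if "j \<in> ?I" for j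
        using PiE_mem[of \<sigma> ?I "\<lambda>_. squares_mod Q" j] S that Q by (auto simp: squares_mod_eq)
      have "1 \<le> k" using k by simp
      then have "k \<le> CARD('n) + 1 \<Longrightarrow> [\<sigma> k = \<sigma> 1 + shift h k] (mod Q)"
      proof (induction k rule: dec_induct)
        case base
        then show ?case by simp
      next
        case (step j)
        then obtain i :: 'n where i: "pos i = j" using ex_pos[of j] by auto
        have "[\<sigma> (pos i + 1) - \<sigma> (pos i) = h $ i] (mod Q)" using S by blast
        from cong_add[OF this step.IH] step.prems i show ?case
          using shift_Suc_pos[of h i] by (simp add: algebra_simps)
      qed
      then have "\<sigma> k mod Q = (\<sigma> 1 + shift h k) mod Q" using k by (simp add: cong_def)
      then show ?thesis using range[OF k] by simp
    qed
    show "\<forall>\<sigma>\<in>?S. g (\<sigma> 1) = \<sigma>"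
    proof
      fix \<sigma> assume S: "\<sigma> \<in> ?S"
      show "g (\<sigma> 1) = \<sigma>"
      proof (rule PiE_ext[where k = ?I and s = "\<lambda>_. UNIV"])
        show "\<sigma> \<in> ?I \<rightarrow>\<^sub>E UNIV" using S by (auto simp: PiE_iff)
        show "g (\<sigma> 1) k = \<sigma> k" if "k \<in> ?I" for k
          using that \<sigma>[OF S that] by (simp add: g_def)
      qed (simp add: g_def)
    qed
    show "\<forall>x\<in>?X. g x 1 = x" by (auto simp: g_def)
    show "(\<lambda>\<sigma>. \<sigma> 1) ` ?S \<subseteq> ?X"
    proof
      fix x assume "x \<in> (\<lambda>\<sigma>. \<sigma> 1) ` ?S"
      then obtain \<sigma> where S: "\<sigma> \<in> ?S" "x = \<sigma> 1" by blast
      have "\<sigma> 1 \<in> squares_mod Q" using S PiE_mem[of \<sigma> ?I "\<lambda>_. squares_mod Q" 1] by simp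
      then have x: "x \<in> {0..<Q}" using Q S by (simp add: squares_mod_eq)
      have "sq_mod Q (x + shift h k)" if "k \<in> ?I" for k
        using \<sigma>[OF S(1) that] PiE_mem[of \<sigma> ?I "\<lambda>_. squares_mod Q" k] S that sq by auto
      with x show "x \<in> ?X" by blast
    qed
    show "g ` ?X \<subseteq> ?S"
    proof
      fix \<sigma> assume "\<sigma> \<in> g ` ?X"
      then obtain x where x: "x \<in> ?X" "\<sigma> = g x" by blast
      have "\<sigma> \<in> ?I \<rightarrow>\<^sub>E squares_mod Q" using x sq by (auto simp: g_def)
      moreover have "[\<sigma> (pos i + 1) - \<sigma> (pos i) = h $ i] (mod Q)" for i
      proof -
        have "pos i \<in> ?I" "pos i + 1 \<in> ?I" using pos_range[of i] by auto
        then have "\<sigma> (pos i + 1) - \<sigma> (pos i) = (x + shift h (pos i + 1)) mod Q - (x + shift h (pos i)) mod Q"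
          using x by (simp add: g_def)
        also have "[\<dots> = (x + shift h (pos i + 1)) - (x + shift h (pos i))] (mod Q)"
          by (intro cong_diff) simp_all
        finally show ?thesis using shift_Suc_pos[of h i] by simp
      qed
      ultimately show "\<sigma> \<in> ?S" by blast
    qed
  qed
  show ?thesis unfolding tuple_count_def pattern_count_def by (rule bij_betw_same_card[OF bij])
qed

abbreviation shift_density :: "int ^ 'n::{finite,linorder} \<Rightarrow> int \<Rightarrow> real" where
  "shift_density h q \<equiv> norm_density {1..CARD('n) + 1} (shift h) q"

lemma shift_density_eq:
  fixes h :: "int ^ 'n::{finite,linorder}"
  assumes "q > 0"
  shows "shift_density h q = mean_spacing q ^ (CARD('n) + 1) * real (tuple_count h q) / real_of_int q"
  using assms by (simp add: norm_density_def tuple_count_eq_pattern_count)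

section \<open>Means over residue classes and over dilated bodies\<close>

lemma tuple_count_cong:
  assumes "\<And>i. [h $ i = h' $ i] (mod q)"
  shows "tuple_count h q = tuple_count h' q"
proof -
  have "[x = h $ i] (mod q) \<longleftrightarrow> [x = h' $ i] (mod q)" for x i
    using assms cong_sym cong_trans by blast
  then show ?thesis by (simp add: tuple_count_def)
qed

definition residue_box :: "int \<Rightarrow> (int ^ 'n) set" where
  "residue_box q = {h. \<forall>i. h $ i \<in> {0..<q}}"

lemma finite_residue_box: "finite (residue_box q :: (int ^ 'n::finite) set)"
proof (cases "q > 0")
  case True
  show ?thesis
    by (rule finite_lattice_box[of _ "\<lambda>_. 0" q]) (use True in \<open>auto simp: residue_box_def less_imp_le\<close>)
qed (auto simp: residue_box_def)

text \<open>Double counting: every tuple of squares has exactly one reduced vector of differences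
  modulo q.\<close>

lemma sum_tuple_count:
  assumes "q > 0"
  shows "(\<Sum>h\<in>residue_box q. tuple_count (h :: int ^ 'n::{finite,linorder}) q) = num_squares q ^ (CARD('n) + 1)"
proof -
  define T where "T = {1..CARD('n) + 1} \<rightarrow>\<^sub>E squares_mod q"
  define rel where "rel h \<sigma> \<longleftrightarrow> (\<forall>i. [\<sigma> (pos i + 1) - \<sigma> (pos i) = h $ i] (mod q))"
    for h :: "(int, 'n) vec" and \<sigma> :: "nat \<Rightarrow> int"
  have finT: "finite T" unfolding T_def by (intro finite_PiE) auto
  have "(\<Sum>h\<in>residue_box q. tuple_count (h :: (int, 'n) vec) q) = (\<Sum>h\<in>residue_box q. \<Sum>\<sigma>\<in>T. if rel h \<sigma> then 1 else 0)"
    using finT by (simp add: tuple_count_def T_def rel_def sum.If_cases Int_def)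
  also have "\<dots> = (\<Sum>\<sigma>\<in>T. \<Sum>h\<in>residue_box q. if rel h \<sigma> then 1 else 0)" by (rule sum.swap)
  also have "\<dots> = (\<Sum>\<sigma>\<in>T. 1)"
  proof (rule sum.cong[OF refl])
    fix \<sigma> assume "\<sigma> \<in> T"
    define h0 where "h0 = (\<chi> i::'n. (\<sigma> (pos i + 1) - \<sigma> (pos i)) mod q)"
    have "{h \<in> residue_box q. rel h \<sigma>} = {h0}"
    proof (intro equalityI subsetI)
      fix h assume h: "h \<in> {h \<in> residue_box q. rel h \<sigma>}"
      have "h $ i = h0 $ i" for i
      proof -
        have "h $ i mod q = h $ i" using h assms by (simp add: residue_box_def)
        moreover have "(\<sigma> (pos i + 1) - \<sigma> (pos i)) mod q = h $ i mod q"
          using h by (simp add: rel_def cong_def)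
        ultimately show ?thesis by (simp add: h0_def)
      qed
      then show "h \<in> {h0}" by (simp add: vec_eq_iff)
    qed (use assms in \<open>auto simp: h0_def residue_box_def rel_def cong_def\<close>)
    moreover have "(\<Sum>h\<in>residue_box q. if rel h \<sigma> then 1 else 0) = card {h \<in> residue_box q. rel h \<sigma>}"
      using finite_residue_box[where 'n = 'n, of q] by (simp add: sum.If_cases Int_def)
    ultimately show "(\<Sum>h\<in>residue_box q. if rel h \<sigma> then 1 else 0) = (1::nat)" by simp
  qed
  also have "\<dots> = num_squares q ^ (CARD('n) + 1)"
    by (simp add: T_def card_PiE num_squares_def)
  finally show ?thesis .
qed

lemma sum_shift_density:
  assumes "q > 0"
  shows "(\<Sum>h\<in>residue_box q. shift_density (h :: int ^ 'n::{finite,linorder}) q) = real_of_int q ^ CARD('n)"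
proof -
  have "(\<Sum>h\<in>residue_box q. shift_density (h :: (int, 'n) vec) q) =
    mean_spacing q ^ (CARD('n) + 1) * real (\<Sum>h\<in>residue_box q. tuple_count (h :: (int, 'n) vec) q) / real_of_int q"
    unfolding shift_density_eq[OF assms] by (simp add: sum_distrib_left sum_divide_distrib)
  also have "\<dots> = (mean_spacing q * real (num_squares q)) ^ (CARD('n) + 1) / real_of_int q"
    unfolding sum_tuple_count[OF assms] by (simp only: power_mult_distrib of_nat_power)
  also have "mean_spacing q * real (num_squares q) = real_of_int q"
    using num_squares_pos[OF assms] by (simp add: mean_spacing_def)
  finally show ?thesis using assms by simp
qed

lemma correlation_eq:
  fixes C :: "(real ^ 'n::{finite,linorder}) set"
  assumes "Q > 0"
  shows "correlation C Q = (\<Sum>h | rvec h \<in> (\<lambda>x. mean_spacing Q *\<^sub>R x) ` C. shift_density h Q) / mean_spacing Q ^ CARD('n)"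
proof -
  have s: "mean_spacing Q > 0" using mean_spacing_ge_1[OF assms] by simp
  have N: "num_squares Q > 0" by (rule num_squares_pos[OF assms])
  have "1 / real (num_squares Q) * real (tuple_count h Q) = shift_density h Q / mean_spacing Q ^ CARD('n)" for h :: "(int, 'n) vec"
  proof -
    have "shift_density h Q / mean_spacing Q ^ CARD('n) = mean_spacing Q * real (tuple_count h Q) / real_of_int Q"
      unfolding shift_density_eq[OF assms] using s by simp
    also have "\<dots> = 1 / real (num_squares Q) * real (tuple_count h Q)"
      using N assms by (simp add: mean_spacing_def)
    finally show ?thesis ..
  qed
  then show ?thesis
    by (simp add: correlation_def rvec_def sum_distrib_left sum_divide_distrib)
qed

text \<open>The density depends only on h modulo q, and a residue class is a translate of q times
  the integer lattice, to be counted in a body dilated by s / q \<ge> 1. Weights of total q^n turn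
  the main terms into s^n times the volume and the errors (s / q)^(n - 1) into q s^(n - 1).\<close>

lemma shift_density_sum_dilate:
  fixes C :: "(real ^ 'n::{finite,linorder}) set"
  assumes C: "bounded C" "convex C"
  shows "\<exists>K\<ge>0. \<forall>s\<ge>1. finite {h. rvec h \<in> (\<lambda>x. s *\<^sub>R x) ` C} \<and>
    (\<forall>q. 1 \<le> q \<and> real_of_int q \<le> s \<longrightarrow>
      \<bar>(\<Sum>h | rvec h \<in> (\<lambda>x. s *\<^sub>R x) ` C. shift_density h q) - s ^ CARD('n) * measure lebesgue C\<bar>
        \<le> K * real_of_int q * s ^ (CARD('n) - 1))"
proof -
  obtain K where K: "K \<ge> 0" and fin: "\<And>t v. t \<ge> 1 \<Longrightarrow> finite {m. rvec m \<in> (\<lambda>x. t *\<^sub>R x + v) ` C}"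
    and cnt: "\<And>t v. t \<ge> 1 \<Longrightarrow> \<bar>real (card {m. rvec m \<in> (\<lambda>x. t *\<^sub>R x + v) ` C}) - t ^ CARD('n) * measure lebesgue C\<bar> \<le> K * t ^ (CARD('n) - 1)"
    using lattice_points_convex[OF C] by blast
  define n where "n = CARD('n)"
  have n: "n = Suc (n - 1)" by (simp add: n_def)
  define V where "V = measure lebesgue C"
  have "finite {h. rvec h \<in> (\<lambda>x. s *\<^sub>R x) ` C} \<and>
    (\<forall>q. 1 \<le> q \<and> real_of_int q \<le> s \<longrightarrow>
      \<bar>(\<Sum>h | rvec h \<in> (\<lambda>x. s *\<^sub>R x) ` C. shift_density h q) - s ^ n * V\<bar> \<le> K * real_of_int q * s ^ (n - 1))"
    if s: "s \<ge> 1" for s :: real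
  proof (intro conjI allI impI)
    define H where "H = {h. rvec h \<in> (\<lambda>x. s *\<^sub>R x) ` C}"
    show finH: "finite {h. rvec h \<in> (\<lambda>x. s *\<^sub>R x) ` C}" using fin[OF s, of 0] by simp
    fix q :: int assume "1 \<le> q \<and> real_of_int q \<le> s"
    then have q: "q > 0" "real_of_int q \<le> s" by auto
    define red where "red h = (\<chi> i. h $ i mod q)" for h :: "(int, 'n) vec"
    define cl where "cl h0 = {h \<in> H. red h = h0}" for h0
    define t where "t = s / real_of_int q"
    have t: "t \<ge> 1" using q by (simp add: t_def)
    have card_cl: "\<bar>real (card (cl h0)) - t ^ n * V\<bar> \<le> K * t ^ (n - 1)" if h0: "h0 \<in> residue_box q" for h0
    proof -
      define v where "v = - (1 / real_of_int q) *\<^sub>R rvec h0"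
      let ?M = "{m. rvec m \<in> (\<lambda>x. t *\<^sub>R x + v) ` C}"
      let ?f = "\<lambda>m. \<chi> i. h0 $ i + q * m $ i"
      have eq: "rvec (?f m) = rvec h0 + real_of_int q *\<^sub>R rvec m" for m
        by (simp add: vec_eq_iff)
      have iff: "rvec (?f m) = s *\<^sub>R x \<longleftrightarrow> rvec m = t *\<^sub>R x + v" for m x
      proof -
        have "rvec (?f m) = s *\<^sub>R x \<longleftrightarrow> real_of_int q *\<^sub>R rvec m = real_of_int q *\<^sub>R (t *\<^sub>R x + v)"
          using q by (simp add: eq t_def v_def scaleR_right_distrib algebra_simps)
        then show ?thesis using q by simp
      qed
      have "bij_betw ?f ?M (cl h0)"
      proof (rule bij_betw_byWitness[where f' = "\<lambda>h. \<chi> i. h $ i div q"])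
        show "\<forall>m\<in>?M. (\<chi> i. ?f m $ i div q) = m"
          using h0 q by (auto simp: vec_eq_iff residue_box_def)
        show f: "\<forall>h\<in>cl h0. ?f (\<chi> i. h $ i div q) = h"
        proof
          fix h assume "h \<in> cl h0"
          then have "h0 $ i = h $ i mod q" for i by (auto simp: cl_def red_def)
          then show "?f (\<chi> i. h $ i div q) = h" by (simp add: vec_eq_iff)
        qed
        show "?f ` ?M \<subseteq> cl h0"
        proof
          fix h assume "h \<in> ?f ` ?M"
          then obtain m where m: "m \<in> ?M" "h = ?f m" by blast
          then have "h \<in> H" using iff by (auto simp: H_def)
          moreover have "red h = h0" using h0 q m by (auto simp: red_def residue_box_def vec_eq_iff)
          ultimately show "h \<in> cl h0" by (simp add: cl_def)
        qed
        show "(\<lambda>h. \<chi> i. h $ i div q) ` cl h0 \<subseteq> ?M"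
        proof
          fix m assume "m \<in> (\<lambda>h. \<chi> i. h $ i div q) ` cl h0"
          then obtain h where h: "h \<in> cl h0" "m = (\<chi> i. h $ i div q)" by blast
          then have "?f m = h" using f by blast
          moreover obtain x where "x \<in> C" "rvec h = s *\<^sub>R x" using h(1) by (auto simp: cl_def H_def)
          ultimately show "m \<in> ?M" using iff by (metis (mono_tags, lifting) image_eqI mem_Collect_eq)
        qed
      qed
      then have "card ?M = card (cl h0)" by (rule bij_betw_same_card)
      then show ?thesis using cnt[OF t, of v] by (simp add: n_def V_def)
    qed
    have "(\<Sum>h\<in>H. shift_density h q) = (\<Sum>h0\<in>residue_box q. \<Sum>h\<in>cl h0. shift_density h q)"
      unfolding cl_def
      by (rule sum.group[symmetric]) (use finH q finite_residue_box in \<open>auto simp: H_def red_def residue_box_def\<close>)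
    also have "\<dots> = (\<Sum>h0\<in>residue_box q. \<Sum>h\<in>cl h0. shift_density h0 q)"
    proof (intro sum.cong refl)
      fix h0 h assume "h \<in> cl h0"
      then have "[h $ i = h0 $ i] (mod q)" for i by (auto simp: cl_def red_def)
      then show "shift_density h q = shift_density h0 q"
        unfolding shift_density_eq[OF q(1)] using tuple_count_cong[of h h0 q] by simp
    qed
    also have "\<dots> = (\<Sum>h0\<in>residue_box q. shift_density h0 q * real (card (cl h0)))"
      by (simp add: mult.commute)
    finally have sum: "(\<Sum>h\<in>H. shift_density h q) = (\<Sum>h0\<in>residue_box q. shift_density h0 q * real (card (cl h0)))" .
    have qt: "real_of_int q ^ n * t ^ n = s ^ n" using q by (simp add: t_def power_divide)
    have qt1: "real_of_int q ^ n * t ^ (n - 1) = real_of_int q * s ^ (n - 1)"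
      using q by (subst n) (simp add: t_def power_divide)
    have "(\<Sum>h\<in>H. shift_density h q) - s ^ n * V =
      (\<Sum>h0\<in>residue_box q. shift_density h0 q * (real (card (cl h0)) - t ^ n * V))"
    proof -
      have "(\<Sum>h0\<in>residue_box q. shift_density (h0 :: (int, 'n) vec) q * (t ^ n * V)) = real_of_int q ^ n * (t ^ n * V)"
        by (simp only: sum_distrib_right[symmetric] sum_shift_density[OF q(1)] n_def)
      also have "\<dots> = s ^ n * V" by (simp only: mult.assoc[symmetric] qt)
      finally show ?thesis unfolding sum right_diff_distrib sum_subtractf by (simp only:)
    qed
    also have "\<bar>\<dots>\<bar> \<le> (\<Sum>h0\<in>residue_box q. \<bar>shift_density h0 q * (real (card (cl h0)) - t ^ n * V)\<bar>)"
      by (rule sum_abs)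
    also have "\<dots> \<le> (\<Sum>h0\<in>residue_box q. shift_density (h0 :: (int, 'n) vec) q * (K * t ^ (n - 1)))"
    proof (rule sum_mono)
      fix h0 :: "(int, 'n) vec" assume h0: "h0 \<in> residue_box q"
      show "\<bar>shift_density h0 q * (real (card (cl h0)) - t ^ n * V)\<bar> \<le> shift_density h0 q * (K * t ^ (n - 1))"
        unfolding abs_mult abs_of_nonneg[OF norm_density_nonneg[OF q(1)]]
        by (intro mult_left_mono card_cl[OF h0] norm_density_nonneg[OF q(1)])
    qed
    also have "\<dots> = real_of_int q ^ n * (K * t ^ (n - 1))"
      unfolding n_def by (simp only: sum_distrib_right[symmetric] sum_shift_density[OF q(1)])
    also have "\<dots> = K * (real_of_int q ^ n * t ^ (n - 1))" by (simp add: mult.left_commute)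
    also have "\<dots> = K * real_of_int q * s ^ (n - 1)" unfolding qt1 by simp
    finally show "\<bar>(\<Sum>h | rvec h \<in> (\<lambda>x. s *\<^sub>R x) ` C. shift_density h q) - s ^ n * V\<bar> \<le> K * real_of_int q * s ^ (n - 1)"
      by (simp add: H_def)
  qed
  with K show ?thesis unfolding n_def V_def by blast
qed

section \<open>Expansion over divisors\<close>

text \<open>Index 0 receives the value 1, which the densities take at p^0. Primes with exponent 0
  thus contribute trivial factors to products.\<close>

definition incr :: "(nat \<Rightarrow> real) \<Rightarrow> nat \<Rightarrow> real" where
  "incr f j = (if j = 0 then 1 else f j - f (j - 1))"

lemma sum_incr: "f 0 = 1 \<Longrightarrow> (\<Sum>j\<in>{0..k}. incr f j) = f k"
  by (induction k) (auto simp: incr_def)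

text \<open>An exponent vector J encodes the divisor that is the product of p^(J p), so this is the
  expansion over divisors.\<close>

lemma prod_eq_sum_incr:
  assumes "finite P" "\<And>p. p \<in> P \<Longrightarrow> b p 0 = 1"
  shows "(\<Prod>p\<in>P. b p (k p)) = (\<Sum>J\<in>(\<Pi>\<^sub>E p\<in>P. {0..k p}). \<Prod>p\<in>P. incr (b p) (J p))"
proof -
  have "(\<Prod>p\<in>P. b p (k p)) = (\<Prod>p\<in>P. \<Sum>j\<in>{0..k p}. incr (b p) j)"
    using assms(2) by (intro prod.cong refl) (simp only: sum_incr)
  also have "\<dots> = (\<Sum>J\<in>(\<Pi>\<^sub>E p\<in>P. {0..k p}). \<Prod>p\<in>P. incr (b p) (J p))"
    by (rule prod_sum_PiE[OF assms(1)]) simp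
  finally show ?thesis .
qed

lemma sum_alternating_Pow:
  assumes "finite A" "A \<noteq> {}"
  shows "(\<Sum>X\<in>Pow A. (-1) ^ card X :: real) = 0"
  using prod_diff_conv_sum[OF assms(1), of "\<lambda>_. 1::real" "\<lambda>_. 1"] assms by (simp add: power_0_left)

lemma prod_incr_eq_alternating:
  fixes b :: "'a \<Rightarrow> nat \<Rightarrow> real"
  assumes "finite A" "\<And>p. p \<in> A \<Longrightarrow> J p > 0"
  shows "(\<Prod>p\<in>A. incr (b p) (J p)) =
    (\<Sum>X\<in>Pow A. (-1) ^ card X * (\<Prod>p\<in>A. b p (J p - (if p \<in> X then 1 else 0))))"
proof -
  have "(\<Prod>p\<in>A. incr (b p) (J p)) = (\<Prod>p\<in>A. b p (J p) - b p (J p - 1))"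
    using assms(2) by (intro prod.cong) (auto simp: incr_def)
  also have "\<dots> = (\<Sum>X\<in>Pow A. (-1) ^ card X * (\<Prod>p\<in>X. b p (J p - 1)) * (\<Prod>p\<in>A - X. b p (J p)))"
    by (rule prod_diff_conv_sum[OF assms(1)])
  also have "\<dots> = (\<Sum>X\<in>Pow A. (-1) ^ card X * (\<Prod>p\<in>A. b p (J p - (if p \<in> X then 1 else 0))))"
  proof (rule sum.cong[OF refl])
    fix X assume X: "X \<in> Pow A"
    then have "(\<Prod>p\<in>A. b p (J p - (if p \<in> X then 1 else 0))) =
      (\<Prod>p\<in>A - X. b p (J p - (if p \<in> X then 1 else 0))) * (\<Prod>p\<in>X. b p (J p - (if p \<in> X then 1 else 0)))"
      using assms(1) by (intro prod.subset_diff) auto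
    then show "(-1) ^ card X * (\<Prod>p\<in>X. b p (J p - 1)) * (\<Prod>p\<in>A - X. b p (J p)) =
      (-1) ^ card X * (\<Prod>p\<in>A. b p (J p - (if p \<in> X then 1 else 0)))"
      by (simp add: mult_ac)
  qed
  finally show ?thesis .
qed

lemma coprime_int_prime_powers:
  assumes "prime p" "prime q" "p \<noteq> q"
  shows "coprime (int p ^ i) (int q ^ j)"
proof -
  have "coprime (int p) (int q)" using primes_coprime[OF assms] by simp
  then show ?thesis by simp
qed

text \<open>The term of a divisor d > 1 is an alternating sum of densities to moduli q \<le> d, one
  for each set of primes of d. Their sums over H share the main term A, which cancels; each error is
  at most K d, and the number of sets is at most d.\<close>

lemma small_modulus_sum_bound:
  fixes H :: "(int ^ 'n::{finite,linorder}) set"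
  assumes P: "finite P" "\<And>p. p \<in> P \<Longrightarrow> prime p"
    and H: "\<And>q. 1 \<le> q \<Longrightarrow> real_of_int q \<le> s \<Longrightarrow> \<bar>(\<Sum>h\<in>H. shift_density h q) - A\<bar> \<le> K * real_of_int q"
    and K: "K \<ge> 0"
    and J: "\<exists>p\<in>P. J p \<noteq> 0"
    and d: "real (\<Prod>p\<in>P. p ^ J p) \<le> s"
  shows "\<bar>\<Sum>h\<in>H. \<Prod>p\<in>P. incr (\<lambda>j. shift_density h (int p ^ j)) (J p)\<bar> \<le> K * (real (\<Prod>p\<in>P. p ^ J p))\<^sup>2"
proof -
  define d where "d = (\<Prod>p\<in>P. p ^ J p)"
  define T where "T = {p \<in> P. J p \<noteq> 0}"
  have finT: "finite T" and TP: "T \<subseteq> P" using P by (auto simp: T_def)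
  define e where "e X p = J p - (if p \<in> X then 1 else 0)" for X p
  define q where "q X = (\<Prod>p\<in>T. int p ^ e X p)" for X
  have p0: "p > 0" if "p \<in> P" for p using P(2)[OF that] by (rule prime_gt_0_nat)
  have q1: "1 \<le> q X" for X
  proof -
    have "0 < q X" unfolding q_def using p0 TP by (intro prod_pos) auto
    then show ?thesis by simp
  qed
  have dT: "d = (\<Prod>p\<in>T. p ^ J p)"
    unfolding d_def T_def using P by (intro prod.mono_neutral_right) auto
  have qd: "q X \<le> int d" for X
    unfolding q_def dT of_nat_prod of_nat_power
  proof (rule prod_mono)
    fix p assume "p \<in> T"
    then have "1 \<le> int p" using p0 TP by fastforce
    then show "0 \<le> int p ^ e X p \<and> int p ^ e X p \<le> int p ^ J p"
      by (auto simp: e_def intro!: power_increasing)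
  qed
  have "(\<Prod>p\<in>P. incr (\<lambda>j. shift_density h (int p ^ j)) (J p)) =
    (\<Sum>X\<in>Pow T. (-1) ^ card X * shift_density h (q X))" for h :: "(int, 'n) vec"
  proof -
    have "(\<Prod>p\<in>P. incr (\<lambda>j. shift_density h (int p ^ j)) (J p)) = (\<Prod>p\<in>T. incr (\<lambda>j. shift_density h (int p ^ j)) (J p))"
      unfolding T_def using P by (intro prod.mono_neutral_right) (auto simp: incr_def)
    also have "\<dots> = (\<Sum>X\<in>Pow T. (-1) ^ card X * (\<Prod>p\<in>T. shift_density h (int p ^ e X p)))"
      unfolding e_def by (rule prod_incr_eq_alternating[OF finT]) (simp add: T_def)
    also have "\<dots> = (\<Sum>X\<in>Pow T. (-1) ^ card X * shift_density h (q X))"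
    proof (intro sum.cong refl arg_cong2[where f = "(*)"])
      fix X
      show "(\<Prod>p\<in>T. shift_density h (int p ^ e X p)) = shift_density h (q X)"
        unfolding q_def
      proof (rule norm_density_prod_coprime(1)[symmetric, OF finT])
        show "coprime (int p ^ e X p) (int p' ^ e X p')" if "p \<in> T" "p' \<in> T" "p \<noteq> p'" for p p'
          using that P(2) TP by (intro coprime_int_prime_powers) auto
      qed (use p0 TP in auto)
    qed
    finally show ?thesis .
  qed
  then have "(\<Sum>h\<in>H. \<Prod>p\<in>P. incr (\<lambda>j. shift_density h (int p ^ j)) (J p)) =
    (\<Sum>X\<in>Pow T. (-1) ^ card X * (\<Sum>h\<in>H. shift_density h (q X)))"
    by (simp only: sum_distrib_left) (rule sum.swap)
  also have "\<dots> = (\<Sum>X\<in>Pow T. (-1) ^ card X * ((\<Sum>h\<in>H. shift_density h (q X)) - A))"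
  proof -
    have "(\<Sum>X\<in>Pow T. (-1) ^ card X * A) = 0"
    proof -
      have "T \<noteq> {}" using J by (auto simp: T_def)
      show ?thesis by (simp only: sum_distrib_right[symmetric] sum_alternating_Pow[OF finT \<open>T \<noteq> {}\<close>] mult_zero_left)
    qed
    then show ?thesis by (simp add: right_diff_distrib sum_subtractf)
  qed
  also have "\<bar>\<dots>\<bar> \<le> (\<Sum>X\<in>Pow T. \<bar>(-1) ^ card X * ((\<Sum>h\<in>H. shift_density h (q X)) - A)\<bar>)"
    by (rule sum_abs)
  also have "\<dots> \<le> (\<Sum>X\<in>Pow T. K * real d)"
  proof (rule sum_mono)
    fix X
    have qd': "real_of_int (q X) \<le> real d" using qd[of X] by linarith
    have "\<bar>(\<Sum>h\<in>H. shift_density h (q X)) - A\<bar> \<le> K * real_of_int (q X)"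
      using H[OF q1[of X]] qd' d unfolding d_def by linarith
    also have "\<dots> \<le> K * real d" using qd' K by (rule mult_left_mono)
    finally show "\<bar>(-1) ^ card X * ((\<Sum>h\<in>H. shift_density h (q X)) - A)\<bar> \<le> K * real d"
      by (simp add: abs_mult)
  qed
  also have "\<dots> = 2 ^ card T * (K * real d)" using finT by (simp add: card_Pow)
  also have "\<dots> \<le> real d * (K * real d)"
  proof (rule mult_right_mono)
    have "(\<Prod>p\<in>T. 2::nat) \<le> d"
      unfolding dT
    proof (rule prod_mono)
      fix p assume "p \<in> T"
      then have "2 \<le> p" "J p \<ge> 1" using P(2) TP prime_ge_2_nat by (auto simp: T_def)
      then have "p ^ 1 \<le> p ^ J p" by (intro power_increasing) auto
      then show "0 \<le> (2::nat) \<and> 2 \<le> p ^ J p" using \<open>2 \<le> p\<close> by simp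
    qed
    then have "real (2 ^ card T) \<le> real d" by (simp only: of_nat_le_iff prod_constant)
    then show "2 ^ card T \<le> real d" by simp
  qed (use K in simp)
  finally show ?thesis by (simp add: d_def power2_eq_square mult_ac)
qed

section \<open>Average weight of the primes dividing an integer\<close>

lemma card_multiples_le:
  assumes "d > 0"
  shows "real (card {v \<in> {1..m}. d dvd v}) \<le> real m / real (d::nat)"
proof -
  have "{v \<in> {1..m}. d dvd v} \<subseteq> (\<lambda>i. d * i) ` {1..m div d}"
  proof
    fix v assume "v \<in> {v \<in> {1..m}. d dvd v}"
    then obtain i where i: "v = d * i" "1 \<le> v" "v \<le> m" by (auto elim: dvdE)
    then have "i \<le> m div d" using assms by (simp add: less_eq_div_iff_mult_less_eq mult.commute)
    moreover have "1 \<le> i" using i by (cases i) auto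
    ultimately show "v \<in> (\<lambda>i. d * i) ` {1..m div d}" using i by auto
  qed
  then have "card {v \<in> {1..m}. d dvd v} \<le> card ((\<lambda>i. d * i) ` {1..m div d})" by (intro card_mono) auto
  also have "\<dots> \<le> card {1..m div d}" by (rule card_image_le) simp
  finally have "real (card {v \<in> {1..m}. d dvd v}) \<le> real (m div d)" by simp
  also have "\<dots> \<le> real m / real d"
  proof -
    have "real (m div d * d) \<le> real m" by (simp only: of_nat_le_iff div_times_less_eq_dividend)
    then show ?thesis using assms by (simp add: field_simps)
  qed
  finally show ?thesis .
qed

lemma prod_primes_dvd:
  fixes v :: nat
  assumes "finite S" "\<And>p. p \<in> S \<Longrightarrow> prime p" "\<And>p. p \<in> S \<Longrightarrow> p dvd v"
  shows "\<Prod>S dvd v"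
  using assms
proof (induction S rule: finite_induct)
  case (insert p S)
  have "coprime p (\<Prod>S)"
    using insert by (intro prod_coprime_right) (metis insertCI primes_coprime)
  then show ?case using insert by (simp add: divides_mult)
qed auto

text \<open>The product expands into a sum over sets S of primes dividing v. At most m divided by
  the product of S values of v occur for a given S, so that on average p carries the weight g p /
  p.\<close>

lemma sum_prod_dividing_primes_le:
  fixes g :: "nat \<Rightarrow> real"
  assumes P: "finite P" "\<And>p. p \<in> P \<Longrightarrow> prime p" and g: "\<And>p. p \<in> P \<Longrightarrow> g p \<ge> 0"
  shows "(\<Sum>v\<in>{1..m}. \<Prod>p | p \<in> P \<and> p dvd v. 1 + g p) \<le> real m * (\<Prod>p\<in>P. 1 + g p / real p)"
proof -
  have "(\<Prod>p | p \<in> P \<and> p dvd v. 1 + g p) = (\<Sum>S\<in>Pow P. if \<forall>p\<in>S. p dvd v then \<Prod>p\<in>S. g p else 0)" for v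
  proof -
    have "(\<Prod>p | p \<in> P \<and> p dvd v. 1 + g p) = (\<Prod>p | p \<in> P \<and> p dvd v. g p + 1)" by (simp add: add.commute)
    also have "\<dots> = (\<Sum>S\<in>Pow {p \<in> P. p dvd v}. \<Prod>p\<in>S. g p)"
      using P(1) by (subst prod_add) auto
    also have "\<dots> = (\<Sum>S\<in>Pow P. if \<forall>p\<in>S. p dvd v then \<Prod>p\<in>S. g p else 0)"
      using P(1) by (intro sum.mono_neutral_cong_left) auto
    finally show ?thesis .
  qed
  then have "(\<Sum>v\<in>{1..m}. \<Prod>p | p \<in> P \<and> p dvd v. 1 + g p) =
    (\<Sum>S\<in>Pow P. \<Sum>v\<in>{1..m}. if \<forall>p\<in>S. p dvd v then \<Prod>p\<in>S. g p else 0)"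
    by (simp only:) (rule sum.swap)
  also have "\<dots> \<le> (\<Sum>S\<in>Pow P. real m * (\<Prod>p\<in>S. g p / real p))"
  proof (rule sum_mono)
    fix S assume S: "S \<in> Pow P"
    then have finS: "finite S" using P(1) finite_subset by blast
    have pos: "\<Prod>S > 0" using S P(2) prime_gt_0_nat by (intro prod_pos) auto
    have "(\<Sum>v\<in>{1..m}. if \<forall>p\<in>S. p dvd v then \<Prod>p\<in>S. g p else 0) =
      real (card {v \<in> {1..m}. \<forall>p\<in>S. p dvd v}) * (\<Prod>p\<in>S. g p)"
      by (simp add: sum.If_cases Int_def)
    also have "\<dots> \<le> real m / real (\<Prod>S) * (\<Prod>p\<in>S. g p)"
    proof (rule mult_right_mono)
      have "{v \<in> {1..m}. \<forall>p\<in>S. p dvd v} \<subseteq> {v \<in> {1..m}. \<Prod>S dvd v}"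
        using S P(2) by (auto intro!: prod_primes_dvd[OF finS])
      then have "card {v \<in> {1..m}. \<forall>p\<in>S. p dvd v} \<le> card {v \<in> {1..m}. \<Prod>S dvd v}"
        by (intro card_mono) auto
      then show "real (card {v \<in> {1..m}. \<forall>p\<in>S. p dvd v}) \<le> real m / real (\<Prod>S)"
        using card_multiples_le[OF pos, of m] by linarith
    qed (use S g in \<open>auto intro!: prod_nonneg\<close>)
    also have "\<dots> = real m * (\<Prod>p\<in>S. g p / real p)" by (simp add: prod_dividef)
    finally show "(\<Sum>v\<in>{1..m}. if \<forall>p\<in>S. p dvd v then \<Prod>p\<in>S. g p else 0) \<le> real m * (\<Prod>p\<in>S. g p / real p)" .
  qed
  also have "\<dots> = real m * (\<Prod>p\<in>P. g p / real p + 1)"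
    using P(1) by (simp add: prod_add sum_distrib_left)
  finally show ?thesis by (simp add: add.commute)
qed

section \<open>Averaging over the bad primes\<close>

lemma shift_diff_inner:
  fixes h :: "int ^ 'n::{finite,linorder}"
  shows "real_of_int (shift h k - shift h l) = (\<chi> i. of_bool (pos i < k) - of_bool (pos i < l)) \<bullet> rvec h"
proof -
  have "real_of_int (shift h k) = (\<Sum>i\<in>UNIV. of_bool (pos i < k) * real_of_int (h $ i))" for k
    by (simp add: shift_def sum.If_cases of_bool_def if_distrib[of "\<lambda>x. x * _"] Collect_conj_eq Int_def cong: if_cong)
  then show ?thesis by (simp add: inner_vec_def left_diff_distrib sum_subtractf)
qed

text \<open>A shift difference is a linear form in h with coefficients 0, 1, -1. Its absolute value
  is a positive integer up to n R s with n = \<open>CARD('n)\<close>, and each value belongs to two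
  hyperplane sections of H, whence the factor 2 and the exponent n - 1. The weights are then
  averaged over the values.\<close>

lemma sum_dividing_shift_difference_le:
  fixes H :: "(int ^ 'n::{finite,linorder}) set" and g :: "nat \<Rightarrow> real" and R s :: real
  assumes finH: "finite H" and R: "R > 0" and s: "s \<ge> 1"
    and box: "\<And>h i. h \<in> H \<Longrightarrow> \<bar>real_of_int (h $ i)\<bar> \<le> R * s"
    and kl: "k \<in> {1..CARD('n) + 1}" "l \<in> {1..CARD('n) + 1}" "k \<noteq> l"
    and nz: "\<And>h. h \<in> H \<Longrightarrow> shift h k \<noteq> shift h l"
    and P: "finite P" "\<And>p. p \<in> P \<Longrightarrow> prime p" and g: "\<And>p. p \<in> P \<Longrightarrow> g p \<ge> 0"
  shows "(\<Sum>h\<in>H. \<Prod>p | p \<in> P \<and> int p dvd shift h k - shift h l. 1 + g p) \<le>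
    2 * ((2 * R + 1) * s) ^ (CARD('n) - 1) * (CARD('n) * R * s) * (\<Prod>p\<in>P. 1 + g p / real p)"
proof -
  define a where "a = (\<chi> i::'n. (of_bool (pos i < k) - of_bool (pos i < l) :: real))"
  define L where "L h = shift h k - shift h l" for h :: "(int, 'n) vec"
  define w where "w h = nat \<bar>L h\<bar>" for h
  define f where "f v = (\<Prod>p | p \<in> P \<and> p dvd v. 1 + g p)" for v :: nat
  define m where "m = nat \<lfloor>CARD('n) * R * s\<rfloor>"
  define Y where "Y = ((2 * R + 1) * s) ^ (CARD('n) - 1)"
  have La: "real_of_int (L h) = a \<bullet> rvec h" for h
    unfolding L_def a_def by (rule shift_diff_inner)
  \<comment> \<open>The coordinate at position min k l occurs in exactly one of the two partial
    sums, so the form is not zero.\<close>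
  have "min k l \<in> {1..CARD('n)}" using kl by auto
  then obtain i0 :: 'n where i0: "pos i0 = min k l" using ex_pos by blast
  have a0: "a $ i0 \<noteq> 0" using kl(3) by (auto simp: a_def i0 min_def)
  have cardL: "real (card {h \<in> H. L h = v}) \<le> Y" for v
  proof -
    have "real (card {h \<in> H. L h = v}) \<le> (2 * (R * s) + 1) ^ (CARD('n) - 1)"
    proof (rule card_lattice_hyperplane_le[of _ "\<lambda>_. - (R * s)" _ a "real_of_int v" i0])
      show "- (R * s) \<le> real_of_int (h $ i) \<and> real_of_int (h $ i) \<le> - (R * s) + 2 * (R * s)"
        if "h \<in> {h \<in> H. L h = v}" for h i
        using box[of h i] that by auto
      show "a \<bullet> rvec h = real_of_int v" if "h \<in> {h \<in> H. L h = v}" for h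
        using that La[of h] by simp
    qed (use R s a0 in auto)
    also have "\<dots> \<le> Y" unfolding Y_def
      using R s by (intro power_mono) (auto simp: algebra_simps)
    finally show ?thesis .
  qed
  have fib: "real (card {h \<in> H. w h = v}) \<le> 2 * Y" for v
  proof -
    have "{h \<in> H. w h = v} \<subseteq> {h \<in> H. L h = int v} \<union> {h \<in> H. L h = - int v}"
      by (auto simp: w_def)
    then have "card {h \<in> H. w h = v} \<le> card ({h \<in> H. L h = int v} \<union> {h \<in> H. L h = - int v})"
      using finH by (intro card_mono) auto
    also have "\<dots> \<le> card {h \<in> H. L h = int v} + card {h \<in> H. L h = - int v}" by (rule card_Un_le)
    finally show ?thesis using cardL[of "int v"] cardL[of "- int v"] by linarith
  qed
  have w: "w h \<in> {1..m}" if "h \<in> H" for h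
  proof -
    have "\<bar>a \<bullet> rvec h\<bar> \<le> (\<Sum>i\<in>UNIV. \<bar>a $ i * real_of_int (h $ i)\<bar>)"
      unfolding inner_vec_def by (simp add: sum_abs)
    also have "\<dots> \<le> (\<Sum>i\<in>(UNIV::'n set). R * s)"
    proof (rule sum_mono)
      fix i
      have "\<bar>a $ i\<bar> \<le> 1" by (simp add: a_def)
      then have "\<bar>a $ i\<bar> * \<bar>real_of_int (h $ i)\<bar> \<le> 1 * (R * s)"
        using box[OF that, of i] by (intro mult_mono) auto
      then show "\<bar>a $ i * real_of_int (h $ i)\<bar> \<le> R * s" by (simp add: abs_mult)
    qed
    finally have "\<bar>real_of_int (L h)\<bar> \<le> CARD('n) * R * s" by (simp add: La)
    then have "w h \<le> m" unfolding w_def m_def by linarith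
    moreover have "L h \<noteq> 0" using nz[OF that] by (simp add: L_def)
    ultimately show ?thesis by (simp add: w_def Suc_le_eq)
  qed
  have f0: "f v \<ge> 0" for v unfolding f_def using g by (intro prod_nonneg) (auto intro: add_nonneg_nonneg)
  have "(\<Sum>h\<in>H. \<Prod>p | p \<in> P \<and> int p dvd shift h k - shift h l. 1 + g p) = (\<Sum>h\<in>H. f (w h))"
    by (simp add: f_def w_def L_def dvd_nat_abs_iff)
  also have "\<dots> = (\<Sum>v\<in>{1..m}. \<Sum>h | h \<in> H \<and> w h = v. f (w h))"
    by (rule sum.group[symmetric]) (use finH w in auto)
  also have "\<dots> = (\<Sum>v\<in>{1..m}. real (card {h \<in> H. w h = v}) * f v)" by simp
  also have "\<dots> \<le> (\<Sum>v\<in>{1..m}. 2 * Y * f v)" by (intro sum_mono mult_right_mono fib f0)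
  also have "\<dots> = 2 * Y * (\<Sum>v\<in>{1..m}. f v)" by (simp add: sum_distrib_left)
  also have "(\<Sum>v\<in>{1..m}. f v) \<le> real m * (\<Prod>p\<in>P. 1 + g p / real p)"
    unfolding f_def by (rule sum_prod_dividing_primes_le[OF P g])
  also have "\<dots> \<le> (CARD('n) * R * s) * (\<Prod>p\<in>P. 1 + g p / real p)"
    using R s g by (intro mult_right_mono prod_nonneg) (auto simp: m_def)
  finally show ?thesis
    using R s by (simp add: Y_def mult_left_mono mult.assoc)
qed

text \<open>Elements above \<epsilon>^(-4) contribute at most \<epsilon> each, and the boundedly
  many others at most 1. This makes the cost of the local factors smaller than any given exponential
  in the number of primes.\<close>

lemma sum_powr_quarter_le:
  fixes \<epsilon> :: real
  assumes "\<epsilon> > 0"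
  shows "\<exists>X. \<forall>P. finite P \<longrightarrow> (\<forall>p\<in>P. p \<ge> 1) \<longrightarrow> (\<Sum>p\<in>P. real p powr (-1/4)) \<le> \<epsilon> * real (card P) + real X"
proof (intro exI allI impI)
  define X where "X = nat \<lceil>\<epsilon> powr (-4)\<rceil>"
  fix P :: "nat set" assume P: "finite P" "\<forall>p\<in>P. p \<ge> 1"
  have le: "real p powr (-1/4) \<le> \<epsilon> + of_bool (p \<in> {1..X})" if "p \<in> P" for p
  proof (cases "p \<le> X")
    case True
    have "real p powr (-1/4) \<le> real p powr 0" using P(2) that by (intro powr_mono) auto
    also have "\<dots> = 1" using P(2) that by auto
    finally show ?thesis using True P(2) that assms by simp
  next
    case False
    then have "\<epsilon> powr (-4) \<le> real p" unfolding X_def by linarith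
    then have "real p powr (-1/4) \<le> (\<epsilon> powr (-4)) powr (-1/4)"
      using assms by (intro powr_mono2') auto
    also have "\<dots> = \<epsilon>" using assms by (simp add: powr_powr)
    finally show ?thesis by simp
  qed
  have "(\<Sum>p\<in>P. real p powr (-1/4)) \<le> (\<Sum>p\<in>P. \<epsilon> + of_bool (p \<in> {1..X}))" by (rule sum_mono) (rule le)
  also have "\<dots> = \<epsilon> * real (card P) + real (card (P \<inter> {1..X}))"
    using P(1) by (simp add: sum.distrib Int_def)
  also have "card (P \<inter> {1..X}) \<le> card {1..X}" by (intro card_mono) auto
  finally show "(\<Sum>p\<in>P. real p powr (-1/4)) \<le> \<epsilon> * real (card P) + real X" by simp
qed

section \<open>Local factors in Rankin's trick\<close>

lemma sum_geometric_le:
  fixes x :: real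
  assumes "0 \<le> x" "x \<le> 6 / 7"
  shows "(\<Sum>j\<in>{1..k}. x ^ j) \<le> 7 * x"
proof -
  have "(\<Sum>j\<in>{1..k}. x ^ j) \<le> 7 * x - 7 * x ^ Suc k"
  proof (induction k)
    case (Suc k)
    have "x ^ Suc k * x \<le> x ^ Suc k * (6 / 7)" using assms by (intro mult_left_mono) auto
    then show ?case using Suc by (simp add: mult.commute)
  qed simp
  also have "\<dots> \<le> 7 * x" using assms by simp
  finally show ?thesis .
qed

text \<open>The fraction 6/7 is a handy upper bound for 2^(-1/4), with 1 / (1 - 6/7) = 7 as the
  constant of the geometric series.\<close>

lemma powr_quarter_le:
  assumes "p \<ge> 2"
  shows "real p powr (-1/4) \<le> 6 / 7"
proof -
  have "(2 powr (-1/4)) ^ Suc 3 = (2::real) powr (-1)" by (simp add: powr_power flip: power_Suc)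
  also have "\<dots> \<le> (6 / 7) ^ Suc 3" by (simp add: powr_minus power_divide)
  finally have "2 powr (-1/4) \<le> (6 / 7 :: real)" by (rule power_le_imp_le_base) simp
  moreover have "real p powr (-1/4) \<le> 2 powr (-1/4)" using assms by (intro powr_mono2') auto
  ultimately show ?thesis by linarith
qed

text \<open>As \<alpha> \<le> 1/4, the weight p^(j \<alpha>) consumes at most half of the decay
  p^(-j/2) and leaves a geometric series in p^(-1/4). Only j = 1 at a bad prime lacks decay and adds
  C p^\<alpha>. The bound is a product so that the part depending on h can be averaged
  separately.\<close>

lemma weighted_incr_sum_le:
  fixes b :: "nat \<Rightarrow> real"
  assumes p: "prime p" and C: "C \<ge> 0" and \<alpha>: "0 \<le> \<alpha>" "\<alpha> \<le> 1 / 4"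
    and b: "\<And>j. \<bar>b (Suc j) - b j\<bar> \<le> C * real p powr (- real (Suc j) / 2) * (if j = 0 \<and> bad then sqrt p else 1)"
  shows "(\<Sum>j\<in>{0..k}. (real p ^ j) powr \<alpha> * \<bar>incr b j\<bar>) \<le>
    (1 + 7 * C * real p powr (-1/4)) * (if bad then 1 + C * real p powr \<alpha> else 1)"
proof -
  define x where "x = real p powr (-1/4)"
  define B where "B = (if bad then C * real p powr \<alpha> else 0)"
  have p2: "p \<ge> 2" using p by (rule prime_ge_2_nat)
  have x: "0 \<le> x" "x \<le> 6 / 7" using powr_quarter_le[OF p2] by (simp_all add: x_def)
  have B: "B \<ge> 0" using C by (simp add: B_def)
  have pow_term: "(real p ^ j) powr \<alpha> * \<bar>incr b j\<bar> \<le> C * x ^ j + (if j = 1 then B else 0)" if j: "j \<ge> 1" for j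
  proof -
    obtain i where i: "j = Suc i" using j by (cases j) auto
    have pj: "(real p ^ j) powr \<alpha> = real p powr (real j * \<alpha>)"
      using p2 by (simp add: powr_powr flip: powr_realpow)
    have xj: "x ^ j = real p powr (- real j / 4)"
      unfolding x_def using p2 by (simp add: powr_powr flip: powr_realpow)
    have bi: "\<bar>incr b j\<bar> \<le> C * real p powr (- real j / 2) * (if i = 0 \<and> bad then sqrt p else 1)"
      using b[of i] by (simp add: incr_def i)
    show ?thesis
    proof (cases "i = 0 \<and> bad")
      case True
      have "(real p ^ j) powr \<alpha> * \<bar>incr b j\<bar> \<le> real p powr \<alpha> * (C * real p powr (- real j / 2) * sqrt p)"
        using bi True i unfolding pj by (intro mult_mono) auto
      also have "\<dots> = C * real p powr \<alpha> * (real p powr (- 1 / 2) * real p powr (1 / 2))"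
        using True i p2 by (simp add: powr_half_sqrt)
      also have "real p powr (- 1 / 2) * real p powr (1 / 2) = 1"
        using p2 by (simp flip: powr_add)
      finally have "(real p ^ j) powr \<alpha> * \<bar>incr b j\<bar> \<le> B" using True by (simp add: B_def)
      moreover have "0 \<le> C * x ^ j" using C x by simp
      ultimately show ?thesis using True i by simp
    next
      case False
      have "(real p ^ j) powr \<alpha> * \<bar>incr b j\<bar> \<le> real p powr (real j * \<alpha>) * (C * real p powr (- real j / 2))"
        using bi False unfolding pj by (intro mult_left_mono) auto
      also have "\<dots> = C * real p powr (real j * \<alpha> - real j / 2)"
        by (simp add: powr_add[symmetric] algebra_simps)
      also have "\<dots> \<le> C * real p powr (- real j / 4)"
      proof (intro mult_left_mono powr_mono C)
        have "real j * \<alpha> \<le> real j * (1 / 4)" using \<alpha> by (intro mult_left_mono) auto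
        then show "real j * \<alpha> - real j / 2 \<le> - real j / 4" by simp
      qed (use p2 in simp)
      finally show ?thesis using B by (auto simp: xj)
    qed
  qed
  have "(\<Sum>j\<in>{0..k}. (real p ^ j) powr \<alpha> * \<bar>incr b j\<bar>) = 1 + (\<Sum>j\<in>{1..k}. (real p ^ j) powr \<alpha> * \<bar>incr b j\<bar>)"
    by (subst sum.atLeast_Suc_atMost) (simp_all add: incr_def)
  also have "(\<Sum>j\<in>{1..k}. (real p ^ j) powr \<alpha> * \<bar>incr b j\<bar>) \<le> (\<Sum>j\<in>{1..k}. C * x ^ j + (if j = 1 then B else 0))"
    by (rule sum_mono) (use pow_term in auto)
  also have "\<dots> = C * (\<Sum>j\<in>{1..k}. x ^ j) + (\<Sum>j\<in>{1..k}. if j = 1 then B else 0)"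
    by (simp add: sum.distrib sum_distrib_left)
  also have "(\<Sum>j\<in>{1..k}. if j = 1 then B else 0) \<le> B" using B by simp
  also have "C * (\<Sum>j\<in>{1..k}. x ^ j) \<le> C * (7 * x)" by (intro mult_left_mono sum_geometric_le x C)
  finally have "(\<Sum>j\<in>{0..k}. (real p ^ j) powr \<alpha> * \<bar>incr b j\<bar>) \<le> 1 + 7 * C * x + B" by simp
  also have "\<dots> \<le> (1 + 7 * C * x) * (1 + B)" using B C x by (simp add: algebra_simps)
  finally show ?thesis by (cases bad) (simp_all add: x_def B_def)
qed

text \<open>Every factor is at most the largest, whose power occurs in the sum. In the role of
  Hoelder's inequality this separates the index pairs.\<close>

lemma prod_le_sum_power_card:
  fixes f :: "'a \<Rightarrow> real"
  assumes "finite T" "T \<noteq> {}" "\<And>t. t \<in> T \<Longrightarrow> f t \<ge> 0"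
  shows "(\<Prod>t\<in>T. f t) \<le> (\<Sum>t\<in>T. f t ^ card T)"
proof -
  have "Max (f ` T) \<in> f ` T" using assms by (intro Max_in) auto
  then obtain u where u: "u \<in> T" "f u = Max (f ` T)" by auto
  have "(\<Prod>t\<in>T. f t) \<le> (\<Prod>t\<in>T. f u)"
    using assms u by (intro prod_mono) auto
  also have "\<dots> = f u ^ card T" by simp
  also have "\<dots> \<le> (\<Sum>t\<in>T. f t ^ card T)"
    using assms u by (intro member_le_sum) auto
  finally show ?thesis .
qed

lemma prod_one_plus_le_exp:
  fixes f :: "'a \<Rightarrow> real"
  assumes "finite P" "\<And>p. p \<in> P \<Longrightarrow> f p \<ge> 0"
  shows "(\<Prod>p\<in>P. 1 + f p) \<le> exp (\<Sum>p\<in>P. f p)"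
proof -
  have "(\<Prod>p\<in>P. 1 + f p) \<le> (\<Prod>p\<in>P. exp (f p))"
    using assms by (intro prod_mono) (auto simp: add_nonneg_nonneg)
  then show ?thesis using assms(1) by (simp add: exp_sum)
qed

text \<open>A p related to several t is counted once on the left and repeatedly on the right, which
  only helps because u p \<ge> 1.\<close>

lemma prod_if_ex_le_prod_prod:
  fixes u :: "'a \<Rightarrow> real"
  assumes "finite P" "finite T" "\<And>p. p \<in> P \<Longrightarrow> u p \<ge> 1"
  shows "(\<Prod>p\<in>P. if \<exists>t\<in>T. D t p then u p else 1) \<le> (\<Prod>t\<in>T. \<Prod>p | p \<in> P \<and> D t p. u p)"
proof -
  have "(\<Prod>p\<in>P. if \<exists>t\<in>T. D t p then u p else 1) \<le> (\<Prod>p\<in>P. \<Prod>t\<in>T. if D t p then u p else 1)"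
  proof (rule prod_mono)
    fix p assume p: "p \<in> P"
    have ge1: "1 \<le> (\<Prod>t\<in>T'. if D t p then u p else 1)" for T'
      using assms(3)[OF p] by (intro prod_ge_1) auto
    have "(if \<exists>t\<in>T. D t p then u p else 1) \<le> (\<Prod>t\<in>T. if D t p then u p else 1)"
    proof (cases "\<exists>t\<in>T. D t p")
      case True
      then obtain t where t: "t \<in> T" "D t p" by blast
      have "(\<Prod>t\<in>T. if D t p then u p else 1) = u p * (\<Prod>t\<in>T - {t}. if D t p then u p else 1)"
        using assms(2) t by (subst prod.remove[of T t]) auto
      also have "\<dots> \<ge> u p * 1" using ge1 assms(3)[OF p] by (intro mult_left_mono) auto
      finally show ?thesis using True by simp
    qed (use ge1 in simp)
    then show "0 \<le> (if \<exists>t\<in>T. D t p then u p else 1) \<and>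
      (if \<exists>t\<in>T. D t p then u p else 1) \<le> (\<Prod>t\<in>T. if D t p then u p else 1)"
      using assms(3)[OF p] by auto
  qed
  also have "\<dots> = (\<Prod>t\<in>T. \<Prod>p\<in>P. if D t p then u p else 1)" by (rule prod.swap)
  also have "\<dots> = (\<Prod>t\<in>T. \<Prod>p | p \<in> P \<and> D t p. u p)"
    using assms(1) by (simp add: prod.If_cases Int_def)
  finally show ?thesis .
qed

text \<open>
  The product over the \<open>M\<close> pairs in \<open>T\<close> is bounded by a sum of \<open>M\<close>-th powers, which turns the exponent
  \<open>1 / (4 M)\<close> into \<open>1 / 4\<close>.
\<close>

lemma bad_primes_average:
  fixes H :: "(int ^ 'n::{finite,linorder}) set" and R s C :: real
  defines "T \<equiv> {(k, l). k \<in> {1..CARD('n) + 1} \<and> l \<in> {1..CARD('n) + 1} \<and> k \<noteq> l}"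
  defines "M \<equiv> card T"
  assumes finH: "finite H" and R: "R > 0" and s: "s \<ge> 1" and C: "C \<ge> 0"
    and box: "\<And>h i. h \<in> H \<Longrightarrow> \<bar>real_of_int (h $ i)\<bar> \<le> R * s"
    and nz: "\<And>h k l. h \<in> H \<Longrightarrow> (k, l) \<in> T \<Longrightarrow> shift h k \<noteq> shift h l"
    and P: "finite P" "\<And>p. p \<in> P \<Longrightarrow> prime p"
  shows "(\<Sum>h\<in>H. \<Prod>p\<in>P. if \<exists>(k, l)\<in>T. int p dvd shift h k - shift h l then 1 + C * real p powr (1 / (4 * M)) else 1) \<le>
    real M * (2 * ((2 * R + 1) * s) ^ (CARD('n) - 1) * (CARD('n) * R * s)) *
    exp ((1 + C) ^ M * (\<Sum>p\<in>P. real p powr (-1/4)))"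
proof -
  define \<alpha> where "\<alpha> = 1 / (4 * real M)"
  define u where "u p = 1 + C * real p powr \<alpha>" for p
  define D where "D h t p \<longleftrightarrow> (case t of (k, l) \<Rightarrow> int p dvd shift h k - shift h l)"
    for h :: "(int, 'n) vec" and t and p :: nat
  \<comment> \<open>(1 + C p^\<alpha>)^M is at most (1 + C)^M p^(M \<alpha>), and M \<alpha> =
    1/4.\<close>
  define g where "g p = (1 + C) ^ M * real p powr (1/4)" for p
  define E where "E = 2 * ((2 * R + 1) * s) ^ (CARD('n) - 1) * (CARD('n) * R * s)"
  have finT: "finite T"
    by (rule finite_subset[of _ "{1..CARD('n) + 1} \<times> {1..CARD('n) + 1}"]) (auto simp: T_def)
  have "(1, 2) \<in> T" by (simp add: T_def)
  then have T0: "T \<noteq> {}" by blast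
  then have M: "M > 0" using finT by (simp add: M_def card_gt_0_iff)
  have u1: "u p \<ge> 1" for p using C by (simp add: u_def)
  have g0: "g p \<ge> 0" for p using C by (simp add: g_def)
  have uM: "u p ^ M \<le> 1 + g p" if p: "p \<in> P" for p
  proof -
    have p1: "real p \<ge> 1" using prime_ge_1_nat[OF P(2)[OF p]] by simp
    have "u p \<le> (1 + C) * real p powr \<alpha>"
      using p1 by (simp add: u_def \<alpha>_def distrib_right ge_one_powr_ge_zero)
    then have "u p ^ M \<le> ((1 + C) * real p powr \<alpha>) ^ M"
      using u1[of p] by (intro power_mono) auto
    also have "\<dots> = (1 + C) ^ M * real p powr (real M * \<alpha>)"
      using p1 by (simp add: power_mult_distrib powr_power)
    also have "real M * \<alpha> = 1 / 4" using M by (simp add: \<alpha>_def)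
    finally show ?thesis by (simp add: g_def)
  qed
  have "(\<Sum>h\<in>H. \<Prod>p\<in>P. if \<exists>t\<in>T. D h t p then u p else 1) \<le>
    (\<Sum>h\<in>H. \<Sum>t\<in>T. \<Prod>p | p \<in> P \<and> D h t p. 1 + g p)"
  proof (rule sum_mono)
    fix h
    have "(\<Prod>p\<in>P. if \<exists>t\<in>T. D h t p then u p else 1) \<le> (\<Prod>t\<in>T. \<Prod>p | p \<in> P \<and> D h t p. u p)"
      by (rule prod_if_ex_le_prod_prod[OF P(1) finT u1])
    also have "\<dots> \<le> (\<Sum>t\<in>T. (\<Prod>p | p \<in> P \<and> D h t p. u p) ^ M)"
      unfolding M_def using u1 by (intro prod_le_sum_power_card finT T0 prod_nonneg) (auto intro: order_trans[OF zero_le_one])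
    also have "\<dots> \<le> (\<Sum>t\<in>T. \<Prod>p | p \<in> P \<and> D h t p. 1 + g p)"
      unfolding prod_power_distrib using uM u1
      by (intro sum_mono prod_mono) (auto intro!: zero_le_power intro: order_trans[OF zero_le_one])
    finally show "(\<Prod>p\<in>P. if \<exists>t\<in>T. D h t p then u p else 1) \<le> (\<Sum>t\<in>T. \<Prod>p | p \<in> P \<and> D h t p. 1 + g p)" .
  qed
  also have "\<dots> = (\<Sum>t\<in>T. \<Sum>h\<in>H. \<Prod>p | p \<in> P \<and> D h t p. 1 + g p)" by (rule sum.swap)
  also have "\<dots> \<le> (\<Sum>t\<in>T. E * (\<Prod>p\<in>P. 1 + g p / real p))"
  proof (rule sum_mono)
    fix t assume "t \<in> T"
    then obtain k l where t: "t = (k, l)" "(k, l) \<in> T" by (cases t) auto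
    show "(\<Sum>h\<in>H. \<Prod>p | p \<in> P \<and> D h t p. 1 + g p) \<le> E * (\<Prod>p\<in>P. 1 + g p / real p)"
      unfolding t(1) D_def prod.case E_def
      by (rule sum_dividing_shift_difference_le[OF finH R s box _ _ _ nz P g0]) (use t in \<open>auto simp: T_def\<close>)
  qed
  also have "\<dots> = real M * E * (\<Prod>p\<in>P. 1 + g p / real p)" by (simp add: M_def)
  also have "\<dots> \<le> real M * E * exp ((1 + C) ^ M * (\<Sum>p\<in>P. real p powr (-1/4)))"
  proof (rule mult_left_mono)
    have "(\<Prod>p\<in>P. 1 + g p / real p) \<le> exp (\<Sum>p\<in>P. g p / real p)"
      using g0 by (intro prod_one_plus_le_exp P) auto
    also have "\<dots> \<le> exp (\<Sum>p\<in>P. (1 + C) ^ M * real p powr (-1/4))"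
    proof (intro iffD2[OF exp_le_cancel_iff] sum_mono)
      fix p assume p: "p \<in> P"
      have p1: "real p \<ge> 1" using prime_ge_1_nat[OF P(2)[OF p]] by simp
      \<comment> \<open>The exponent -3/4 is relaxed to -1/4 so that good and bad primes lead to the
        same sum.\<close>
      have "real p powr (1/4) / real p = real p powr (1/4 - 1)"
        using p1 powr_diff[of "real p" "1/4" 1] by simp
      also have "\<dots> \<le> real p powr (-1/4)" using p1 by (intro powr_mono) auto
      finally show "g p / real p \<le> (1 + C) ^ M * real p powr (-1/4)"
        using C by (simp add: g_def mult_left_mono flip: times_divide_eq_right)
    qed
    finally show "(\<Prod>p\<in>P. 1 + g p / real p) \<le> exp ((1 + C) ^ M * (\<Sum>p\<in>P. real p powr (-1/4)))"
      by (simp add: sum_distrib_left)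
  qed (use R s in \<open>simp add: E_def\<close>)
  finally show ?thesis unfolding D_def u_def \<alpha>_def E_def by (simp add: case_prod_beta)
qed

text \<open>The condition D < d is traded for the factor (d / D)^\<alpha>, which is at least 1
  there. Without the condition the sum over exponent vectors splits into a product over
  primes.\<close>

lemma large_modulus_sum_bound:
  fixes b :: "'h \<Rightarrow> nat \<Rightarrow> nat \<Rightarrow> real"
  assumes P: "finite P" "\<And>p. p \<in> P \<Longrightarrow> p > 0" and D: "D > 0" and \<alpha>: "\<alpha> \<ge> 0"
  shows "(\<Sum>J | J \<in> (\<Pi>\<^sub>E p\<in>P. {0..k p}) \<and> D < real (\<Prod>p\<in>P. p ^ J p). \<bar>\<Sum>h\<in>H. \<Prod>p\<in>P. incr (b h p) (J p)\<bar>) \<le>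
    D powr (- \<alpha>) * (\<Sum>h\<in>H. \<Prod>p\<in>P. \<Sum>j\<in>{0..k p}. (real p ^ j) powr \<alpha> * \<bar>incr (b h p) j\<bar>)"
proof -
  let ?JJ = "\<Pi>\<^sub>E p\<in>P. {0..k p}"
  have finJ: "finite ?JJ" using P by (intro finite_PiE) auto
  have "(\<Sum>J | J \<in> ?JJ \<and> D < real (\<Prod>p\<in>P. p ^ J p). \<bar>\<Sum>h\<in>H. \<Prod>p\<in>P. incr (b h p) (J p)\<bar>) \<le>
    (\<Sum>J | J \<in> ?JJ \<and> D < real (\<Prod>p\<in>P. p ^ J p). D powr (- \<alpha>) * (\<Sum>h\<in>H. \<Prod>p\<in>P. (real p ^ J p) powr \<alpha> * \<bar>incr (b h p) (J p)\<bar>))"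
  proof (rule sum_mono)
    fix J assume "J \<in> {J. J \<in> ?JJ \<and> D < real (\<Prod>p\<in>P. p ^ J p)}"
    then have d: "D < real (\<Prod>p\<in>P. p ^ J p)" by simp
    have "real (\<Prod>p\<in>P. p ^ J p) powr \<alpha> = (\<Prod>p\<in>P. (real p ^ J p) powr \<alpha>)"
      by (simp add: prod_powr_distrib)
    moreover have "1 \<le> D powr (- \<alpha>) * real (\<Prod>p\<in>P. p ^ J p) powr \<alpha>"
    proof -
      have "D powr \<alpha> \<le> real (\<Prod>p\<in>P. p ^ J p) powr \<alpha>" using d D \<alpha> by (intro powr_mono2) auto
      then have "D powr (- \<alpha>) * D powr \<alpha> \<le> D powr (- \<alpha>) * real (\<Prod>p\<in>P. p ^ J p) powr \<alpha>"
        by (intro mult_left_mono) auto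
      then show ?thesis using D by (simp flip: powr_add)
    qed
    ultimately have w: "1 \<le> D powr (- \<alpha>) * (\<Prod>p\<in>P. (real p ^ J p) powr \<alpha>)" by simp
    have "\<bar>\<Sum>h\<in>H. \<Prod>p\<in>P. incr (b h p) (J p)\<bar> \<le> (\<Sum>h\<in>H. \<Prod>p\<in>P. \<bar>incr (b h p) (J p)\<bar>)"
      using sum_abs[of "\<lambda>h. \<Prod>p\<in>P. incr (b h p) (J p)" H] by (simp add: abs_prod)
    also have "\<dots> \<le> D powr (- \<alpha>) * (\<Prod>p\<in>P. (real p ^ J p) powr \<alpha>) * (\<Sum>h\<in>H. \<Prod>p\<in>P. \<bar>incr (b h p) (J p)\<bar>)"
      using mult_right_mono[OF w, of "\<Sum>h\<in>H. \<Prod>p\<in>P. \<bar>incr (b h p) (J p)\<bar>"]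
      by (simp add: sum_nonneg prod_nonneg)
    also have "\<dots> = D powr (- \<alpha>) * (\<Sum>h\<in>H. \<Prod>p\<in>P. (real p ^ J p) powr \<alpha> * \<bar>incr (b h p) (J p)\<bar>)"
      by (simp add: prod.distrib sum_distrib_left mult.assoc)
    finally show "\<bar>\<Sum>h\<in>H. \<Prod>p\<in>P. incr (b h p) (J p)\<bar> \<le>
      D powr (- \<alpha>) * (\<Sum>h\<in>H. \<Prod>p\<in>P. (real p ^ J p) powr \<alpha> * \<bar>incr (b h p) (J p)\<bar>)" .
  qed
  also have "\<dots> \<le> (\<Sum>J\<in>?JJ. D powr (- \<alpha>) * (\<Sum>h\<in>H. \<Prod>p\<in>P. (real p ^ J p) powr \<alpha> * \<bar>incr (b h p) (J p)\<bar>))"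
    using finJ by (intro sum_mono2) (auto intro!: mult_nonneg_nonneg sum_nonneg prod_nonneg)
  also have "\<dots> = D powr (- \<alpha>) * (\<Sum>h\<in>H. \<Sum>J\<in>?JJ. \<Prod>p\<in>P. (real p ^ J p) powr \<alpha> * \<bar>incr (b h p) (J p)\<bar>)"
    by (subst sum.swap) (simp add: sum_distrib_left)
  also have "\<dots> = D powr (- \<alpha>) * (\<Sum>h\<in>H. \<Prod>p\<in>P. \<Sum>j\<in>{0..k p}. (real p ^ j) powr \<alpha> * \<bar>incr (b h p) j\<bar>)"
    using P(1) by (subst prod_sum_PiE) auto
  finally show ?thesis .
qed

section \<open>The factorization of Q and the size of its mean spacing\<close>

lemma prime_factors_int_nat: "prime_factors (int N) = int ` prime_factors N"
proof (cases "N = 0")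
  case False
  show ?thesis
  proof (intro equalityI subsetI)
    fix q assume q: "q \<in> prime_factors (int N)"
    then have "q \<ge> 0" "prime q" "q dvd int N" by (auto simp: in_prime_factors_iff prime_ge_0_int)
    moreover from this obtain m where "q = int m" by (metis nonneg_int_cases)
    ultimately show "q \<in> int ` prime_factors N" using False by (simp add: in_prime_factors_iff)
  qed (use False in \<open>auto simp: in_prime_factors_iff\<close>)
qed auto

lemma int_eq_prod_prime_powers:
  assumes "N > 0"
  shows "int N = (\<Prod>p\<in>prime_factors N. int p ^ multiplicity p N)"
proof -
  have "N = (\<Prod>p\<in>prime_factors N. p ^ multiplicity p N)"
    using prod_prime_factors[of N] assms by simp
  then show ?thesis by (metis (mono_tags, lifting) of_nat_power of_nat_prod prod.cong)
qed

text \<open>Every odd prime contributes at least 3/2. The prime 2 may contribute only 1, since both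
  residues modulo 2 are squares; this accounts for the exponent card P - 1.\<close>

lemma mean_spacing_ge_power:
  assumes P: "finite P" "\<And>p. p \<in> P \<Longrightarrow> prime p" and k: "\<And>p. p \<in> P \<Longrightarrow> k p > 0"
  shows "(3 / 2) ^ (card P - 1) \<le> mean_spacing (\<Prod>p\<in>P. int p ^ k p)"
proof -
  have "mean_spacing (\<Prod>p\<in>P. int p ^ k p) = (\<Prod>p\<in>P. mean_spacing (int p ^ k p))"
  proof (rule norm_density_prod_coprime(2)[OF P(1)])
    show "coprime (int p ^ k p) (int q ^ k q)" if "p \<in> P" "q \<in> P" "p \<noteq> q" for p q
      using that P(2) by (intro coprime_int_prime_powers) auto
  qed (use prime_gt_0_nat[OF P(2)] in simp)
  moreover have "(\<Prod>p\<in>P. if p = 2 then 1 else 3 / 2) \<le> (\<Prod>p\<in>P. mean_spacing (int p ^ k p))"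
  proof (rule prod_mono)
    fix p assume p: "p \<in> P"
    show "0 \<le> (if p = 2 then 1 else 3 / 2 :: real) \<and> (if p = 2 then 1 else 3 / 2) \<le> mean_spacing (int p ^ k p)"
    proof (cases "p = 2")
      case True
      then show ?thesis using mean_spacing_bounds(1)[OF P(2)[OF p]] by simp
    next
      case False
      then have "odd p" using P(2)[OF p] prime_odd_nat[of p] prime_ge_2_nat[of p] by simp
      moreover obtain j where "k p = Suc j" using k[OF p] by (cases "k p") auto
      ultimately show ?thesis using False mean_spacing_odd_prime_power_ge[OF P(2)[OF p], of j] by simp
    qed
  qed
  moreover have "(\<Prod>p\<in>P. if p = 2 then 1 else 3 / 2 :: real) = (3 / 2) ^ card (P - {2})"
    using P(1) by (simp add: prod.If_cases Diff_eq)
  moreover have "(3 / 2 :: real) ^ (card P - 1) \<le> (3 / 2) ^ card (P - {2})"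
    using P(1) by (intro power_increasing) (auto simp: card_Diff_singleton_if)
  ultimately show ?thesis by linarith
qed

section \<open>Separation of the shifts and the deviation from the volume\<close>

lemma shift_injective_of_separated:
  fixes C :: "(real ^ 'n::{finite,linorder}) set" and s :: real
  assumes sep: "\<And>x :: nat \<Rightarrow> real. (\<chi> i. x (pos i) - x (pos i + 1)) \<in> C \<Longrightarrow>
           (\<forall>i\<in>{1..CARD('n) + 1}. \<forall>j\<in>{1..CARD('n) + 1}. i \<noteq> j \<longrightarrow> x i \<noteq> x j)"
    and s: "s > 0" and h: "rvec h \<in> (\<lambda>x. s *\<^sub>R x) ` C"
    and kl: "k \<in> {1..CARD('n) + 1}" "l \<in> {1..CARD('n) + 1}" "k \<noteq> l"
  shows "shift h k \<noteq> shift h l"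
proof -
  obtain c where c: "c \<in> C" "rvec h = s *\<^sub>R c" using h by blast
  \<comment> \<open>The hypothesis concerns x i - x (i + 1), whereas h consists of forward
    differences; hence the sign.\<close>
  define x where "x k = - real_of_int (shift h k) / s" for k
  have "c = (\<chi> i. x (pos i) - x (pos i + 1))"
  proof (rule iffD2[OF vec_eq_iff], rule allI)
    fix i
    have "real_of_int (h $ i) = s * c $ i" using arg_cong[OF c(2), of "\<lambda>v. v $ i"] by simp
    then have "c $ i = real_of_int (h $ i) / s" using s by simp
    also have "\<dots> = x (pos i) - x (pos i + 1)"
      by (simp add: x_def shift_Suc_pos add_divide_distrib diff_divide_distrib)
    finally show "c $ i = (\<chi> i. x (pos i) - x (pos i + 1)) $ i" by simp
  qed
  then have "x k \<noteq> x l" using sep[of x] c(1) kl by blast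
  then show ?thesis by (auto simp: x_def)
qed

text \<open>Let D = s^(1/4). At most D divisors are small, each with an error of order s^(n-1) D^2,
  which relative to s^n amounts to s^(-1/4). The large divisors save D^(-\<alpha>) =
  s^(-\<alpha>/4); this is the weaker saving and fixes \<beta>. The exponential collects the local
  factors.\<close>

lemma correlation_deviation_bound:
  fixes C :: "(real ^ 'n::{finite,linorder}) set"
  assumes C: "bounded C" "convex C"
    and sep: "\<And>x :: nat \<Rightarrow> real. (\<chi> i. x (pos i) - x (pos i + 1)) \<in> C \<Longrightarrow>
           (\<forall>i\<in>{1..CARD('n) + 1}. \<forall>j\<in>{1..CARD('n) + 1}. i \<noteq> j \<longrightarrow> x i \<noteq> x j)"
  shows "\<exists>K\<ge>0. \<exists>\<beta>>0. \<exists>B>0. \<forall>N\<ge>1.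
    \<bar>correlation C (int N) - measure lebesgue C\<bar> \<le>
      K * mean_spacing (int N) powr (- \<beta>) * exp (B * (\<Sum>p\<in>prime_factors N. real p powr (-1/4)))"
proof -
  define n where "n = CARD('n)"
  define V where "V = measure lebesgue C"
  define T where "T = {(k, l). k \<in> {1..CARD('n) + 1} \<and> l \<in> {1..CARD('n) + 1} \<and> k \<noteq> l}"
  define M where "M = card T"
  define \<alpha> where "\<alpha> = 1 / (4 * real M)"
  obtain A where A: "A \<ge> 1" and incr_bound: "\<And>p (a :: nat \<Rightarrow> int) j. prime p \<Longrightarrow>
    \<bar>norm_density {1..CARD('n) + 1} a (int p ^ Suc j) - norm_density {1..CARD('n) + 1} a (int p ^ j)\<bar> \<le>
      A * real p powr (- real (Suc j) / 2) *
      (if j = 0 \<and> (\<exists>k\<in>{1..CARD('n) + 1}. \<exists>l\<in>{1..CARD('n) + 1}. k \<noteq> l \<and> int p dvd a k - a l) then sqrt p else 1)"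
    using norm_density_difference_bound[of "{1..CARD('n) + 1}"] by blast
  obtain K1 where K1: "K1 \<ge> 0" and finH: "\<And>s. s \<ge> 1 \<Longrightarrow> finite {h. rvec h \<in> (\<lambda>x. s *\<^sub>R x) ` C}"
    and S: "\<And>s q. s \<ge> 1 \<Longrightarrow> 1 \<le> q \<Longrightarrow> real_of_int q \<le> s \<Longrightarrow>
      \<bar>(\<Sum>h | rvec h \<in> (\<lambda>x. s *\<^sub>R x) ` C. shift_density h q) - s ^ n * V\<bar> \<le> K1 * real_of_int q * s ^ (n - 1)"
    using shift_density_sum_dilate[OF C] unfolding n_def V_def by blast
  obtain R where R: "R > 0" "\<And>x. x \<in> C \<Longrightarrow> norm x \<le> R" using C(1) bounded_pos by blast
  have n: "n = Suc (n - 1)" by (simp add: n_def)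
  have finT: "finite T"
    by (rule finite_subset[of _ "{1..CARD('n) + 1} \<times> {1..CARD('n) + 1}"]) (auto simp: T_def)
  have "(1, 2) \<in> T" by (simp add: T_def)
  then have M: "M \<ge> 1" using finT by (auto simp: M_def card_gt_0_iff Suc_le_eq)
  have \<alpha>: "0 < \<alpha>" "\<alpha> \<le> 1 / 4" using M by (simp_all add: \<alpha>_def field_simps)
  \<comment> \<open>The geometric series at each prime gives 7 A, the average over bad primes gives
    (1 + A)^M.\<close>
  define B where "B = 7 * A + (1 + A) ^ M"
  define K2 where "K2 = real M * (2 * (2 * R + 1) ^ (n - 1) * (n * R))"
  define \<beta> where "\<beta> = \<alpha> / 4"
  have B: "B > 0" using A by (simp add: B_def add_pos_pos)
  have K2: "K2 \<ge> 0" using R(1) by (simp add: K2_def)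
  have \<beta>: "\<beta> > 0" "\<beta> \<le> 1 / 4" using \<alpha> by (simp_all add: \<beta>_def)
  have "\<bar>correlation C (int N) - V\<bar> \<le>
      (2 * K1 + K2) * mean_spacing (int N) powr (- \<beta>) * exp (B * (\<Sum>p\<in>prime_factors N. real p powr (-1/4)))"
    if N: "N \<ge> 1" for N
  proof -
    define P where "P = prime_factors N"
    define k where "k p = multiplicity p N" for p
    define s where "s = mean_spacing (int N)"
    define H where "H = {h. rvec h \<in> (\<lambda>x. s *\<^sub>R x) ` C}"
    define b where "b h p j = shift_density h (int p ^ j)" for h :: "(int, 'n) vec" and p j :: nat
    define \<Sigma> where "\<Sigma> = (\<Sum>p\<in>P. real p powr (-1/4))"
    define D where "D = s powr (1/4)"
    define d where "d J = (\<Prod>p\<in>P. p ^ J p)" for J :: "nat \<Rightarrow> nat"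
    define F where "F J = (\<Sum>h\<in>H. \<Prod>p\<in>P. incr (b h p) (J p))" for J
    define JJ where "JJ = (\<Pi>\<^sub>E p\<in>P. {0..k p})"
    define J0 where "J0 = (\<lambda>p\<in>P. 0 :: nat)"
    define small where "small = {J \<in> JJ. J \<noteq> J0 \<and> real (d J) \<le> D}"
    define large where "large = {J \<in> JJ. D < real (d J)}"
    have s1: "s \<ge> 1" unfolding s_def using N by (intro mean_spacing_ge_1) simp
    have D1: "1 \<le> D" "D \<le> s"
      using s1 powr_mono[of "1/4" 1 s] by (simp_all add: D_def ge_one_powr_ge_zero)
    have fin: "finite H" "finite P" using finH[OF s1] by (simp_all add: H_def P_def)
    have P: "prime p" if "p \<in> P" for p using that by (auto simp: P_def)
    have p0: "p > 0" if "p \<in> P" for p using P[OF that] by (rule prime_gt_0_nat)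
    have finJJ: "finite JJ" unfolding JJ_def using fin by (intro finite_PiE) auto
    have Nprod: "int N = (\<Prod>p\<in>P. int p ^ k p)"
      unfolding P_def k_def by (rule int_eq_prod_prime_powers) (use N in simp)
    have b0: "b h p 0 = 1" for h p by (simp add: b_def norm_density_1)
    have b_prod: "shift_density h (int N) = (\<Prod>p\<in>P. b h p (k p))" for h :: "(int, 'n) vec"
      unfolding b_def Nprod
    proof (rule norm_density_prod_coprime(1)[OF fin(2)])
      show "coprime (int p ^ k p) (int q ^ k q)" if "p \<in> P" "q \<in> P" "p \<noteq> q" for p q
        using that P by (intro coprime_int_prime_powers) auto
    qed (use p0 in simp)
    have sum_eq: "(\<Sum>h\<in>H. shift_density h (int N)) = (\<Sum>J\<in>JJ. F J)"
    proof -
      have "shift_density h (int N) = (\<Sum>J\<in>JJ. \<Prod>p\<in>P. incr (b h p) (J p))" for h :: "(int, 'n) vec"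
        unfolding b_prod JJ_def by (rule prod_eq_sum_incr) (use fin(2) b0 in auto)
      then show ?thesis unfolding F_def by (simp only:) (rule sum.swap)
    qed
    have J0: "J0 \<in> JJ" by (simp add: J0_def JJ_def)
    have dJ0: "d J0 = 1" by (simp add: d_def J0_def)
    have split: "(\<Sum>J\<in>JJ. F J) = F J0 + (\<Sum>J\<in>small. F J) + (\<Sum>J\<in>large. F J)"
    proof -
      have "JJ = insert J0 (small \<union> large)" using J0 by (auto simp: small_def large_def)
      moreover have "J0 \<notin> small \<union> large" using dJ0 D1 by (auto simp: small_def large_def)
      moreover have "small \<inter> large = {}" by (auto simp: small_def large_def)
      moreover have "finite small" "finite large" using finJJ by (auto simp: small_def large_def)
      ultimately show ?thesis by (simp add: sum.union_disjoint add.assoc)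
    qed
    have SH: "\<bar>(\<Sum>h\<in>H. shift_density h q) - s ^ n * V\<bar> \<le> K1 * s ^ (n - 1) * real_of_int q"
      if "1 \<le> q" "real_of_int q \<le> s" for q
      using S[OF s1 that] by (simp add: H_def mult_ac)
    have F0: "\<bar>F J0 - s ^ n * V\<bar> \<le> K1 * s ^ (n - 1)"
    proof -
      have "F J0 = (\<Sum>h\<in>H. shift_density h 1)"
        by (simp add: F_def J0_def incr_def norm_density_1)
      then show ?thesis using SH[of 1] s1 by simp
    qed
    have Fsmall: "\<bar>F J\<bar> \<le> K1 * s ^ (n - 1) * D\<^sup>2" if J: "J \<in> small" for J
    proof -
      have "\<exists>p\<in>P. J p \<noteq> 0"
      proof (rule ccontr)
        assume "\<not> (\<exists>p\<in>P. J p \<noteq> 0)"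
        then have "J = J0" using J
          by (intro PiE_ext[where k = P and s = "\<lambda>p. {0..k p}"]) (auto simp: small_def JJ_def J0_def)
        then show False using J by (simp add: small_def)
      qed
      moreover have "real (\<Prod>p\<in>P. p ^ J p) \<le> s" using J D1 by (simp add: small_def d_def)
      ultimately have "\<bar>F J\<bar> \<le> K1 * s ^ (n - 1) * (real (d J))\<^sup>2"
        unfolding F_def b_def d_def
        by (intro small_modulus_sum_bound[OF fin(2) P SH]) (use K1 s1 in auto)
      also have "\<dots> \<le> K1 * s ^ (n - 1) * D\<^sup>2"
        using J K1 s1 by (intro mult_left_mono power_mono) (auto simp: small_def)
      finally show ?thesis .
    qed
    have "\<bar>\<Sum>J\<in>small. F J\<bar> \<le> (\<Sum>J\<in>small. \<bar>F J\<bar>)" by (rule sum_abs)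
    also have "\<dots> \<le> real (card small) * (K1 * s ^ (n - 1) * D\<^sup>2)"
      using Fsmall by (intro sum_bounded_above) auto
    also have "\<dots> \<le> D * (K1 * s ^ (n - 1) * D\<^sup>2)"
    proof (rule mult_right_mono)
      \<comment> \<open>By unique factorization the small exponent vectors stand for distinct
        positive integers up to D.\<close>
      have "inj_on d JJ"
      proof (rule inj_onI)
        fix J J' assume JJ': "J \<in> JJ" "J' \<in> JJ" "d J = d J'"
        have "J p = J' p" if "p \<in> P" for p
          using multiplicity_prod_prime_powers[of P p J] multiplicity_prod_prime_powers[of P p J']
            fin(2) P that JJ'(3) by (simp add: d_def)
        with JJ'(1,2) show "J = J'" unfolding JJ_def by (rule PiE_ext)
      qed
      then have "card small = card (d ` small)"
        by (intro card_image[symmetric]) (auto intro: inj_on_subset simp: small_def)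
      also have "\<dots> \<le> card {1..nat \<lfloor>D\<rfloor>}"
      proof (intro card_mono subsetI)
        fix v assume "v \<in> d ` small"
        then obtain J where J: "v = d J" "real (d J) \<le> D" by (auto simp: small_def)
        have "d J > 0" unfolding d_def using p0 by (intro prod_pos) auto
        then show "v \<in> {1..nat \<lfloor>D\<rfloor>}" using J by (auto simp: le_nat_floor)
      qed simp
      also have "\<dots> = nat \<lfloor>D\<rfloor>" by simp
      finally show "real (card small) \<le> D" using D1(1) by linarith
    qed (use K1 s1 in simp)
    also have "\<dots> = K1 * (s ^ (n - 1) * D ^ 3)" by (simp add: power2_eq_square power3_eq_cube)
    finally have small_bound: "\<bar>\<Sum>J\<in>small. F J\<bar> \<le> K1 * (s ^ (n - 1) * D ^ 3)" .
    define good where "good p = 1 + 7 * A * real p powr (-1/4)" for p :: nat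
    define bad where "bad h p = (if \<exists>(k, l)\<in>T. int p dvd shift h k - shift h l then 1 + A * real p powr \<alpha> else 1)"
      for h :: "(int, 'n) vec" and p :: nat
    have local_bound: "(\<Sum>j\<in>{0..k p}. (real p ^ j) powr \<alpha> * \<bar>incr (b h p) j\<bar>) \<le> good p * bad h p"
      if p: "p \<in> P" for h p
      unfolding good_def bad_def
    proof (rule weighted_incr_sum_le[OF P[OF p]])
      show "\<bar>b h p (Suc j) - b h p j\<bar> \<le> A * real p powr (- real (Suc j) / 2) *
        (if j = 0 \<and> (\<exists>(k, l)\<in>T. int p dvd shift h k - shift h l) then sqrt p else 1)" for j
      proof -
        have "(\<exists>(k, l)\<in>T. int p dvd shift h k - shift h l) \<longleftrightarrow>
          (\<exists>k\<in>{1..CARD('n) + 1}. \<exists>l\<in>{1..CARD('n) + 1}. k \<noteq> l \<and> int p dvd shift h k - shift h l)"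
          unfolding T_def Bex_def mem_Collect_eq split_paired_Ex prod.case by blast
        then show ?thesis unfolding b_def using incr_bound[OF P[OF p], of "shift h" j] by (simp only:)
      qed
    qed (use A \<alpha> in auto)
    have "\<bar>\<Sum>J\<in>large. F J\<bar> \<le> (\<Sum>J\<in>large. \<bar>F J\<bar>)" by (rule sum_abs)
    also have "\<dots> \<le> D powr (- \<alpha>) * (\<Sum>h\<in>H. \<Prod>p\<in>P. \<Sum>j\<in>{0..k p}. (real p ^ j) powr \<alpha> * \<bar>incr (b h p) j\<bar>)"
      unfolding large_def JJ_def F_def d_def
      by (rule large_modulus_sum_bound[OF fin(2)]) (use p0 D1 \<alpha> in auto)
    also have "(\<Sum>h\<in>H. \<Prod>p\<in>P. \<Sum>j\<in>{0..k p}. (real p ^ j) powr \<alpha> * \<bar>incr (b h p) j\<bar>) \<le>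
      (\<Sum>h\<in>H. \<Prod>p\<in>P. good p * bad h p)"
      by (intro sum_mono prod_mono conjI local_bound sum_nonneg) auto
    also have "\<dots> = (\<Prod>p\<in>P. good p) * (\<Sum>h\<in>H. \<Prod>p\<in>P. bad h p)"
      by (simp add: prod.distrib sum_distrib_left)
    also have "\<dots> \<le> exp (7 * A * \<Sigma>) * (K2 * s ^ n * exp ((1 + A) ^ M * \<Sigma>))"
    proof (rule mult_mono)
      show "(\<Prod>p\<in>P. good p) \<le> exp (7 * A * \<Sigma>)"
        using prod_one_plus_le_exp[OF fin(2), of "\<lambda>p. 7 * A * real p powr (-1/4)"] A
        by (simp add: good_def \<Sigma>_def sum_distrib_left)
      have "(\<Sum>h\<in>H. \<Prod>p\<in>P. bad h p) \<le>
        real M * (2 * ((2 * R + 1) * s) ^ (CARD('n) - 1) * (CARD('n) * R * s)) * exp ((1 + A) ^ M * \<Sigma>)"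
        unfolding bad_def \<alpha>_def \<Sigma>_def M_def T_def
      proof (rule bad_primes_average[OF fin(1) R(1) s1 _ _ _ fin(2) P])
        show "\<bar>real_of_int (h $ i)\<bar> \<le> R * s" if h: "h \<in> H" for h i
        proof -
          obtain x where x: "x \<in> C" "rvec h = s *\<^sub>R x" using h by (auto simp: H_def)
          have "real_of_int (h $ i) = s * x $ i" using arg_cong[OF x(2), of "\<lambda>v. v $ i"] by simp
          moreover have "\<bar>x $ i\<bar> \<le> R" using component_le_norm_cart[of x i] R(2)[OF x(1)] by linarith
          ultimately show ?thesis using s1 by (simp add: abs_mult mult.commute mult_left_mono)
        qed
        show "shift h k \<noteq> shift h l"
          if "h \<in> H" "(k, l) \<in> {(k, l). k \<in> {1..CARD('n) + 1} \<and> l \<in> {1..CARD('n) + 1} \<and> k \<noteq> l}" for h k l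
          using that s1 by (intro shift_injective_of_separated[OF sep, where s = s]) (auto simp: H_def)
      qed (use A in simp)
      also have "real M * (2 * ((2 * R + 1) * s) ^ (CARD('n) - 1) * (CARD('n) * R * s)) = K2 * s ^ n"
        unfolding K2_def n_def[symmetric] by (subst (4) n) (simp add: power_mult_distrib)
      finally show "(\<Sum>h\<in>H. \<Prod>p\<in>P. bad h p) \<le> K2 * s ^ n * exp ((1 + A) ^ M * \<Sigma>)" .
      show "0 \<le> (\<Sum>h\<in>H. \<Prod>p\<in>P. bad h p)"
        unfolding bad_def using A by (intro sum_nonneg prod_nonneg) auto
    qed simp
    also have "\<dots> = K2 * s ^ n * exp (B * \<Sigma>)" by (simp add: B_def distrib_right exp_add)
    finally have large_bound: "\<bar>\<Sum>J\<in>large. F J\<bar> \<le> D powr (- \<alpha>) * (K2 * s ^ n * exp (B * \<Sigma>))"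
      by (simp add: mult_left_mono)
    define Z where "Z = s powr (- \<beta>) * exp (B * \<Sigma>)"
    have sn: "s ^ n > 0" using s1 by simp
    have \<Sigma>0: "\<Sigma> \<ge> 0" unfolding \<Sigma>_def by (intro sum_nonneg) auto
    have expge: "exp (B * \<Sigma>) \<ge> 1" using B \<Sigma>0 by simp
    have Zge: "s powr (- \<beta>) \<le> Z"
      unfolding Z_def using mult_left_mono[OF expge, of "s powr (- \<beta>)"] by simp
    have D3: "s ^ (n - 1) * D ^ 3 \<le> s ^ n * Z"
    proof -
      have "D ^ 3 = s powr (3 / 4)" using s1 by (simp add: D_def powr_power)
      also have "\<dots> \<le> s powr (1 + - \<beta>)" using s1 \<beta> by (intro powr_mono) auto
      also have "\<dots> = s * s powr (- \<beta>)" using s1 by (subst powr_add) simp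
      also have "\<dots> \<le> s * Z" using Zge s1 by (intro mult_left_mono) auto
      finally have "s ^ (n - 1) * D ^ 3 \<le> s ^ (n - 1) * (s * Z)" using s1 by (intro mult_left_mono) auto
      also have "\<dots> = s ^ n * Z" by (subst (2) n) simp
      finally show ?thesis .
    qed
    have "s ^ (n - 1) * 1 \<le> s ^ (n - 1) * D ^ 3" using s1 D1 by (intro mult_left_mono) auto
    then have s1': "K1 * s ^ (n - 1) \<le> K1 * (s ^ n * Z)" using D3 K1 by (intro mult_left_mono) auto
    have D3': "K1 * (s ^ (n - 1) * D ^ 3) \<le> K1 * (s ^ n * Z)" using D3 K1 by (intro mult_left_mono)
    have "D powr (- \<alpha>) = s powr (- \<beta>)" by (simp add: D_def powr_powr \<beta>_def)
    then have L: "D powr (- \<alpha>) * (K2 * s ^ n * exp (B * \<Sigma>)) = K2 * (s ^ n * Z)" by (simp add: Z_def)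
    have "\<bar>(\<Sum>J\<in>JJ. F J) - s ^ n * V\<bar> \<le> (2 * K1 + K2) * (s ^ n * Z)"
      using F0 small_bound large_bound s1' D3' unfolding split L by (simp add: algebra_simps)
    then have "\<bar>(\<Sum>J\<in>JJ. F J) - s ^ n * V\<bar> / s ^ n \<le> (2 * K1 + K2) * (s ^ n * Z) / s ^ n"
      using sn by (intro divide_right_mono) auto
    moreover have "correlation C (int N) - V = ((\<Sum>J\<in>JJ. F J) - s ^ n * V) / s ^ n"
    proof -
      have "correlation C (int N) = (\<Sum>J\<in>JJ. F J) / s ^ n"
        unfolding sum_eq[symmetric] H_def s_def n_def by (rule correlation_eq) (use N in simp)
      then show ?thesis using s1 by (simp add: diff_divide_distrib)
    qed
    ultimately show ?thesis using s1 unfolding Z_def \<Sigma>_def P_def s_def by (simp add: abs_divide)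
  qed
  moreover have "2 * K1 + K2 \<ge> 0" using K1 K2 by simp
  ultimately show ?thesis using \<beta> B unfolding V_def by blast
qed

theorem theorem1:
  fixes r :: nat and C :: "(real ^ 'n::{finite,linorder}) set"
  assumes "r \<ge> 2" and "CARD('n) = r - 1"
    and "bounded C" and "convex C"
    and "\<And>x :: nat \<Rightarrow> real. (\<chi> i. x (pos i) - x (pos i + 1)) \<in> C \<Longrightarrow>
           (\<forall>i\<in>{1..r}. \<forall>j\<in>{1..r}. i \<noteq> j \<longrightarrow> x i \<noteq> x j)"
  shows "\<exists>c0>0. \<exists>K>0. \<forall>Q::int. Q \<ge> 2 \<longrightarrow>
           \<bar>correlation C Q - measure lebesgue C\<bar> \<le> K * exp (- c0 * sqrt (real (omega Q)))"
proof -
  have r: "r = CARD('n) + 1" using assms(1,2) by simp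
  obtain K \<beta> B where K: "K \<ge> 0" and \<beta>: "\<beta> > 0" and B: "B > 0"
    and dev: "\<And>N. N \<ge> 1 \<Longrightarrow> \<bar>correlation C (int N) - measure lebesgue C\<bar> \<le>
      K * mean_spacing (int N) powr (- \<beta>) * exp (B * (\<Sum>p\<in>prime_factors N. real p powr (-1/4)))"
    using correlation_deviation_bound[OF assms(3,4,5)[unfolded r]] by blast
  \<comment> \<open>The saving per prime factor: (3/2)^(-\<beta>) = exp(-\<theta>).\<close>
  define \<theta> where "\<theta> = \<beta> * ln (3 / 2)"
  have \<theta>: "\<theta> > 0" using \<beta> by (simp add: \<theta>_def)
  \<comment> \<open>With the share \<theta> / (2 B) the local factors consume only half of the
    saving.\<close>
  obtain X where X: "\<And>P. finite P \<Longrightarrow> \<forall>p\<in>P. p \<ge> 1 \<Longrightarrow>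
    (\<Sum>p\<in>P. real p powr (-1/4)) \<le> \<theta> / (2 * B) * real (card P) + real X"
    using sum_powr_quarter_le[of "\<theta> / (2 * B)"] \<theta> B by auto
  \<comment> \<open>The factor exp \<theta> pays for the exponent w - 1 in place of w, and exp (B X)
    for the boundedly many small primes. As K may be 0, the added 1 keeps K' positive.\<close>
  define K' where "K' = K * exp (\<theta> + B * real X) + 1"
  have "\<bar>correlation C Q - measure lebesgue C\<bar> \<le> K' * exp (- (\<theta> / 2) * sqrt (real (omega Q)))"
    if Q: "Q \<ge> 2" for Q :: int
  proof -
    define N where "N = nat Q"
    define P where "P = prime_factors N"
    define w where "w = card P"
    have QN: "Q = int N" and N: "N \<ge> 1" using Q by (simp_all add: N_def)
    have w: "omega Q = w"
      unfolding omega_def QN prime_factors_int_nat w_def P_def by (simp add: card_image)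
    have P: "finite P" "\<And>p. p \<in> P \<Longrightarrow> prime p" by (auto simp: P_def)
    have Nprod: "int N = (\<Prod>p\<in>P. int p ^ multiplicity p N)"
      unfolding P_def by (rule int_eq_prod_prime_powers) (use N in simp)
    have sw: "(3 / 2) ^ (w - 1) \<le> mean_spacing (int N)"
      unfolding w_def Nprod
      by (rule mean_spacing_ge_power[OF P]) (auto simp: P_def prime_factors_multiplicity)
    have "mean_spacing (int N) powr (- \<beta>) \<le> ((3 / 2) ^ (w - 1)) powr (- \<beta>)"
      using sw \<beta> by (intro powr_mono2') auto
    also have "\<dots> = exp (- \<theta> * real (w - 1))"
      by (simp add: powr_def ln_realpow \<theta>_def mult_ac)
    also have "\<dots> \<le> exp (\<theta> - \<theta> * real w)" using \<theta> by (cases w) (auto simp: algebra_simps)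
    finally have 1: "mean_spacing (int N) powr (- \<beta>) \<le> exp (\<theta> - \<theta> * real w)" .
    have "B * (\<Sum>p\<in>P. real p powr (-1/4)) \<le> B * (\<theta> / (2 * B) * real w + real X)"
      using X[of P] P prime_ge_1_nat B unfolding w_def by (intro mult_left_mono) auto
    also have "\<dots> = \<theta> / 2 * real w + B * real X" using B by (simp add: field_simps)
    finally have 2: "exp (B * (\<Sum>p\<in>P. real p powr (-1/4))) \<le> exp (\<theta> / 2 * real w + B * real X)" by simp
    \<comment> \<open>The estimate below decays exponentially in w itself; this inequality weakens
      it to the stated form.\<close>
    have "sqrt (real w) \<le> real w"
    proof (cases "w = 0")
      case False
      then show ?thesis by (intro real_le_lsqrt) (auto simp: power2_eq_square)
    qed simp
    then have 3: "- (\<theta> / 2) * real w \<le> - (\<theta> / 2) * sqrt (real w)" using \<theta> by simp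
    have "\<bar>correlation C Q - measure lebesgue C\<bar> \<le>
      K * mean_spacing (int N) powr (- \<beta>) * exp (B * (\<Sum>p\<in>P. real p powr (-1/4)))"
      unfolding QN P_def by (rule dev[OF N])
    also have "\<dots> \<le> K * exp (\<theta> - \<theta> * real w) * exp (\<theta> / 2 * real w + B * real X)"
      using 1 2 K by (intro mult_mono mult_left_mono) auto
    also have "\<dots> = K * exp (\<theta> + B * real X) * exp (- (\<theta> / 2) * real w)"
      by (simp add: mult.assoc algebra_simps flip: exp_add)
    also have "\<dots> \<le> K * exp (\<theta> + B * real X) * exp (- (\<theta> / 2) * sqrt (real w))"
      using 3 K by (intro mult_left_mono) auto
    also have "\<dots> \<le> K' * exp (- (\<theta> / 2) * sqrt (real w))"
      by (intro mult_right_mono) (auto simp: K'_def)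
    finally show ?thesis by (simp only: w)
  qed
  moreover have "K' > 0" using K by (simp add: K'_def add_nonneg_pos)
  ultimately show ?thesis using \<theta> by (intro exI[of _ "\<theta> / 2"] conjI exI[of _ K']) auto
qed

end
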